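(* Let $n\ge2$ and fix $\alpha\in(2,4)$. Let $\{\beta_m\}_m\subseteq(2,\alpha)$ be such that $\beta_m\searrow2$, and define a sequence $\{\mu_m\}_m\subseteq\mathcal{P}(\mathbb{R}^n)$ by $\mu_m\in\operatorname{argmin}_{\mathcal{P}(\mathbb{R}^n)}\mathcal{E}_{\alpha,\beta_m}$. Then every subsequence of $\{\mu_m\}_m$ has a further subsequence which weakly converges to some spherical shell.
   Context: $\mathcal{P}(\mathbb{R}^n)$ is the set of probability measures on $\mathbb{R}^n$; weak convergence is convergence against bounded continuous functions. For $\alpha>\beta>0$, $\mathcal{E}_{\alpha,\beta}[\mu]=\frac12\iint_{\mathbb{R}^n\times\mathbb{R}^n}\left(\frac{|x-y|^\alpha}{\alpha}-\frac{|x-y|^\beta}{\beta}\right)d\mu(x)d\mu(y)$, and $\operatorname{argmin}_{\mathcal{P}(\mathbb{R}^n)}\mathcal{E}_{\alpha,\beta}$ is the set of its global minimizers over $\mathcal{P}(\mathbb{R}^n)$. The spherical shell (measure) of radius $r\ge0$ is the uniform distribution over $\partial B_r(0)$.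
   Formalization: Since the energy is translation invariant, the claim fails for arbitrarily translated minimizers; it is proved here with each minimizer μ_m replaced by its translate having centre of mass at the origin (so verbatim when the μ_m are centred). *)

theory Defs
  imports "HOL-Probability.Probability"
begin

definition prob_measures :: "'a::topological_space measure set" where
  "prob_measures = {\<mu>. prob_space \<mu> \<and> sets \<mu> = sets borel}"

definition weakly_converges ::
    "(nat \<Rightarrow> 'a::topological_space measure) \<Rightarrow> 'a measure \<Rightarrow> bool" where
  "weakly_converges \<mu> \<nu> \<longleftrightarrow>
     (\<forall>f :: 'a \<Rightarrow> real. continuous_on UNIV f \<longrightarrow> bounded (range f) \<longrightarrow>
        (\<lambda>k. \<integral>x. f x \<partial>(\<mu> k)) \<longlonglongrightarrow> (\<integral>x. f x \<partial>\<nu>))"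

definition pair_potential :: "real \<Rightarrow> real \<Rightarrow> 'a::real_normed_vector \<Rightarrow> 'a \<Rightarrow> real" where
  "pair_potential \<alpha> \<beta> x y = norm (x - y) powr \<alpha> / \<alpha> - norm (x - y) powr \<beta> / \<beta>"

text \<open>
  For \<open>\<alpha> > \<beta> > 0\<close> the potential is bounded below (lemma \<open>pair_potential_ge\<close>) but not above, so the
  energy of a probability measure is a well-defined element of \<open>(-\<infinity>, \<infinity>]\<close>.  It is written as
  positive part minus negative part, because the Bochner integral would assign energy \<open>0\<close> instead
  of \<open>\<infinity>\<close> to measures for which the potential is not integrable.
\<close>

definition energy :: "real \<Rightarrow> real \<Rightarrow> 'a::euclidean_space measure \<Rightarrow> ereal" where
  "energy \<alpha> \<beta> \<mu> = ereal (1 / 2) *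
     (enn2ereal (\<integral>\<^sup>+(x, y). ennreal (pair_potential \<alpha> \<beta> x y) \<partial>(\<mu> \<Otimes>\<^sub>M \<mu>))
    - enn2ereal (\<integral>\<^sup>+(x, y). ennreal (- pair_potential \<alpha> \<beta> x y) \<partial>(\<mu> \<Otimes>\<^sub>M \<mu>)))"

definition energy_minimizers :: "real \<Rightarrow> real \<Rightarrow> 'a::euclidean_space measure set" where
  "energy_minimizers \<alpha> \<beta> = {\<mu>. is_arg_min (energy \<alpha> \<beta>) (\<lambda>\<nu>. \<nu> \<in> prob_measures) \<mu>}"

text \<open>
  The uniform distribution over the sphere of radius \<open>r\<close> about the origin: normalised surface
  measure, obtained from Lebesgue measure by polar coordinates, i.e. the law of
  \<open>r x / |x|\<close> for \<open>x\<close> uniform in the unit ball.  For \<open>r = 0\<close> this is the point mass at the origin.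
\<close>

definition spherical_shell :: "real \<Rightarrow> 'a::euclidean_space measure" where
  "spherical_shell r = distr (uniform_measure lborel (ball 0 1)) borel (\<lambda>x. (r / norm x) *\<^sub>R x)"

text \<open>
  The energy is translation invariant, so a sequence of minimizers may run off to infinity, and
  compactness can only hold modulo translations.  As spherical shells are centred at the origin, each
  minimizer is represented by its translate with centre of mass at the origin; nothing changes
  for measures that are already centred (lemma \<open>centred_id\<close>).
\<close>

definition centred :: "'a::euclidean_space measure \<Rightarrow> 'a measure" where
  "centred \<mu> = distr \<mu> borel (\<lambda>x. x - (\<integral>y. y \<partial>\<mu>))"

lemma centred_id:
  assumes "\<mu> \<in> prob_measures" and "(\<integral>y. y \<partial>\<mu>) = 0"
  shows "centred \<mu> = \<mu>"
  using assms by (simp add: centred_def prob_measures_def distr_id2)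

lemma pair_potential_ge:
  assumes "\<alpha> > \<beta>" "\<beta> > 0"
  shows "pair_potential \<alpha> \<beta> x y \<ge> 1 / \<alpha> - 1 / \<beta>"
proof (cases "x = y")
  case True
  then show ?thesis
    using assms by (simp add: pair_potential_def frac_le)
next
  case False
  define r where "r = norm (x - y)"
  have r: "r > 0" using False by (simp add: r_def)
  have "(r powr \<alpha>) powr (\<beta> / \<alpha>) * 1 powr (1 - \<beta> / \<alpha>) \<le> \<beta> / \<alpha> * r powr \<alpha> + (1 - \<beta> / \<alpha>) * 1"
    using assms r by (intro Youngs_inequality_0) auto
  then have "r powr \<beta> \<le> \<beta> / \<alpha> * r powr \<alpha> + (1 - \<beta> / \<alpha>)"
    using assms by (simp add: powr_powr)
  then have "r powr \<beta> / \<beta> \<le> (\<beta> / \<alpha> * r powr \<alpha> + (1 - \<beta> / \<alpha>)) / \<beta>"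
    using assms by (intro divide_right_mono) auto
  also have "\<dots> = r powr \<alpha> / \<alpha> + 1 / \<beta> - 1 / \<alpha>"
    using assms by (simp add: field_simps)
  finally show ?thesis
    by (simp add: pair_potential_def r_def)
qed

lemma energy_eq_integral:
  assumes "integrable (\<mu> \<Otimes>\<^sub>M \<mu>) (\<lambda>(x, y). pair_potential \<alpha> \<beta> x y)"
  shows "energy \<alpha> \<beta> \<mu> = ereal (1 / 2 * (\<integral>(x, y). pair_potential \<alpha> \<beta> x y \<partial>(\<mu> \<Otimes>\<^sub>M \<mu>)))"
proof -
  let ?P = "\<integral>\<^sup>+(x, y). ennreal (pair_potential \<alpha> \<beta> x y) \<partial>(\<mu> \<Otimes>\<^sub>M \<mu>)"
  let ?N = "\<integral>\<^sup>+(x, y). ennreal (- pair_potential \<alpha> \<beta> x y) \<partial>(\<mu> \<Otimes>\<^sub>M \<mu>)"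
  have "?P < \<infinity>" "?N < \<infinity>"
    using assms by (auto simp: real_integrable_def case_prod_unfold top.not_eq_extremum)
  moreover have "(\<integral>(x, y). pair_potential \<alpha> \<beta> x y \<partial>(\<mu> \<Otimes>\<^sub>M \<mu>)) = enn2real ?P - enn2real ?N"
    using real_lebesgue_integral_def[OF assms] by (simp add: case_prod_unfold)
  ultimately show ?thesis
    by (cases ?P; cases ?N) (auto simp: energy_def)
qed

lemma spherical_shell_prob: "spherical_shell r \<in> prob_measures"
proof -
  have "prob_space (uniform_measure lborel (ball (0::'a) 1))"
    by (rule prob_space_uniform_measure)
       (use emeasure_bounded_finite[of "ball (0::'a) 1"] in
         \<open>auto simp: emeasure_lborel_ball_finite less_top unit_ball_vol_pos[THEN less_imp_neq, symmetric] emeasure_ball\<close>)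
  then show ?thesis
    unfolding prob_measures_def spherical_shell_def by (auto intro!: prob_space.prob_space_distr)
qed

lemma AE_spherical_shell:
  assumes "r \<ge> 0"
  shows "AE x in spherical_shell r. x \<in> sphere (0::'a::euclidean_space) r"
proof -
  have ne: "AE x in lborel. x \<noteq> (0::'a)"
    by (rule AE_lborel_singleton)
  have AE: "AE x in uniform_measure lborel (ball (0::'a) 1). (r / norm x) *\<^sub>R x \<in> sphere 0 r"
    by (rule AE_uniform_measureI, simp, rule AE_mp[OF ne], rule AE_I2)
       (simp add: assms dist_norm)
  have meas: "(\<lambda>x::'a. (r / norm x) *\<^sub>R x) \<in> measurable (uniform_measure lborel (ball 0 1)) borel"
    by measurable
  have sets: "{x \<in> space borel. x \<in> sphere (0::'a) r} \<in> sets borel"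
    by simp
  show ?thesis
    unfolding spherical_shell_def AE_distr_iff[OF meas sets] by (rule AE)
qed

text \<open>The sort of the index type is the one required by the library lemma \<open>measure_orthogonal_image\<close>.\<close>

lemma spherical_shell_orthogonal_invariant:
  fixes f :: "real ^ 'n::{finite,wellorder} \<Rightarrow> real ^ 'n::_"
  assumes "orthogonal_transformation f"
  shows "distr (spherical_shell r) borel f = spherical_shell r"
proof (rule measure_eqI)
  fix A assume "A \<in> sets (distr (spherical_shell r) borel f)"
  then have A [measurable]: "A \<in> sets borel" by simp
  have lin: "linear f" and inj: "inj f" and surj: "surj f" and nrm: "\<And>x. norm (f x) = norm x"
    using assms orthogonal_transformation_linear orthogonal_transformation_inj
      orthogonal_transformation_surj orthogonal_transformation_norm by blast+
  have [measurable]: "f \<in> borel_measurable borel"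
    using lin by (intro borel_measurable_continuous_onI linear_continuous_on)
      (simp add: linear_conv_bounded_linear)
  define T where "T = (\<lambda>x :: real ^ 'n::{finite,wellorder}. (r / norm x) *\<^sub>R x)"
  have [measurable]: "T \<in> borel_measurable borel" unfolding T_def by measurable
  define B where "B = ball 0 1 \<inter> T -` A"
  define C where "C = ball 0 1 \<inter> T -` (f -` A)"
  have fT: "f (T x) = T (f x)" for x
    by (simp add: T_def nrm linear_cmul[OF lin])
  have B [measurable]: "B \<in> sets borel"
    unfolding B_def using measurable_sets[of T borel borel A] by auto
  have C [measurable]: "C \<in> sets borel"
    unfolding C_def
    using measurable_sets[of "\<lambda>x. f (T x)" borel borel A] by (auto simp: vimage_def)
  have fC: "f ` C = B"
  proof (intro set_eqI iffI)
    fix x assume "x \<in> B"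
    moreover obtain y where "x = f y" using surj by blast
    ultimately show "x \<in> f ` C"
      by (auto simp: B_def C_def fT nrm)
  qed (auto simp: B_def C_def fT nrm)
  have bdd: "bounded C" "bounded B"
    by (rule bounded_subset[OF bounded_ball[of 0 1]], simp add: B_def C_def)+
  have fin: "C \<in> lmeasurable" "B \<in> lmeasurable"
    using bdd by (auto intro: bounded_set_imp_lmeasurable)
  have "measure lborel C = measure lborel B"
    using measure_orthogonal_image[OF assms fin(1)] by (simp add: fC measure_completion)
  then have eq: "emeasure lborel C = emeasure lborel B"
    using emeasure_bounded_finite[OF bdd(1)] emeasure_bounded_finite[OF bdd(2)]
    by (simp add: emeasure_eq_ennreal_measure)
  let ?B1 = "ball (0 :: real ^ 'n::{finite,wellorder}) 1"
  let ?U = "uniform_measure lborel ?B1"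
  have shell: "spherical_shell r = distr ?U borel T"
    by (simp add: spherical_shell_def T_def)
  have TU: "T \<in> measurable ?U borel" by measurable
  have fS: "f \<in> measurable (spherical_shell r) borel" by (simp add: shell)
  have fA: "f -` A \<in> sets borel"
    using measurable_sets[of f borel borel A] by simp
  have TfA: "T -` (f -` A) \<in> sets borel" and TA: "T -` A \<in> sets borel"
    using measurable_sets[of T borel borel] fA by simp_all
  have "emeasure (distr (spherical_shell r) borel f) A = emeasure (spherical_shell r) (f -` A)"
    using emeasure_distr[OF fS A] by (simp add: spherical_shell_def)
  also have "\<dots> = emeasure ?U (T -` (f -` A))"
    by (simp add: shell emeasure_distr[OF TU fA])
  also have "\<dots> = emeasure lborel C / emeasure lborel ?B1"
    unfolding C_def using TfA by (subst emeasure_uniform_measure) simp_all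
  also have "\<dots> = emeasure ?U (T -` A)"
    unfolding eq B_def using TA by (subst emeasure_uniform_measure) simp_all
  also have "\<dots> = emeasure (spherical_shell r) A"
    by (simp add: shell emeasure_distr[OF TU A])
  finally show "emeasure (distr (spherical_shell r) borel f) A = emeasure (spherical_shell r) A" .
qed (simp add: spherical_shell_def)

end

theory Submission
  imports Defs
begin

text \<open>
  The energy of a measure is half the quadratic form of the pair potential on it. At the exponents
  \<open>(\<alpha>, 2)\<close> with \<open>2 < \<alpha> < 4\<close> and \<open>n \<ge> 2\<close>, one spherical shell \<open>\<sigma>\<close> about the origin is the
  only centred minimizer, and it is so in a quantitative way. Minimizers for \<open>(\<alpha>, \<beta>)\<close> with \<open>\<beta>\<close> near \<open>2\<close>
  almost minimize the limiting energy, so after centring they are close to \<open>\<sigma>\<close>. Thus the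
  whole sequence of centred minimizers converges to \<open>\<sigma>\<close>.

  Euler--Lagrange condition. Let \<open>A(s)\<close> be the average of \<open>|x - y|\<^sup>\<alpha>\<close> over \<open>y\<close> in the unit sphere, where
  \<open>|x| = s\<close>. Since the Laplacian of \<open>|x|\<^sup>\<alpha>\<close> is \<open>\<alpha> (\<alpha> + n - 2) |x|\<^sup>\<alpha>\<^sup>-\<^sup>2\<close>, the derivative of \<open>s\<^sup>n\<^sup>-\<^sup>1 A'(s)\<close> is
  that factor times \<open>s\<^sup>n\<^sup>-\<^sup>1\<close> times the average with exponent \<open>\<alpha> - 2\<close> (\<open>radial_laplacian\<close>). That average is
  nondecreasing in \<open>s\<close>: inside the sphere by the same identity one level down, outside by
  inspection. Hence \<open>A'(s) / s\<close> is nondecreasing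
  (\<open>radial_pot1_over_s_mono\<close>), that is, \<open>A\<close> is convex as a function of \<open>s\<^sup>2\<close>, and subtracting a suitable
  multiple of \<open>s\<^sup>2\<close> makes \<open>s = 1\<close> a minimum point. Scaling then selects the radius for which the
  potential of the shell at the exponents \<open>(\<alpha>, 2)\<close> is minimal on the shell itself
  (\<open>shell_Euler_Lagrange\<close>).

  Strict convexity. For two centred measures the quadratic form of \<open>|x - y|\<^sup>2\<close> vanishes on the difference
  \<open>\<eta>\<close>. Up to a positive factor, \<open>d\<^sup>\<alpha>\<close> is the integral of \<open>exp (- t d\<^sup>2) - 1 + t d\<^sup>2\<close> against
  \<open>t\<^sup>-\<^sup>1\<^sup>-\<^sup>\<alpha>\<^sup>/\<^sup>2 dt\<close> (\<open>powr_gaussian_mixture\<close>), so the quadratic form of \<open>|x - y|\<^sup>\<alpha>\<close> on \<open>\<eta>\<close> is an integral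
  over \<open>t\<close> of Gaussian quadratic forms (\<open>pair_diff_mixture\<close>). Each of these is nonnegative: it is a
  multiple of the squared \<open>L\<^sup>2\<close> norm of \<open>\<eta>\<close> smoothed by a Gaussian (\<open>gauss_conv_diff_square\<close>). Together with the
  Euler--Lagrange condition, the energy excess over the shell bounds the form on \<open>\<eta>\<close>
  (\<open>shell_energy_gap\<close>).

  Weak convergence. If the quadratic form of \<open>|x - y|\<^sup>\<alpha>\<close> on \<open>\<eta>\<close> is small, then in every interval \<open>[T, T + 1]\<close>
  there is a \<open>t\<close> at which the smoothed difference is small in \<open>L\<^sup>2\<close>. For large \<open>T\<close> smoothing hardly changes a
  test function of compact support, so its integral against \<open>\<eta>\<close> is small. Bounded second moments extend this
  to all bounded continuous functions (\<open>weakly_converges_of_pair_diff\<close>).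

  Comparison of exponents. Interpolating \<open>d\<^sup>\<beta>\<close> between \<open>d\<^sup>2\<close> and \<open>d\<^sup>\<alpha>\<close>, and comparing with the shell as
  a competitor, bounds the excess of the limiting energy by a multiple of \<open>\<beta> - 2\<close> times the
  \<open>\<alpha>\<close>-moment plus \<open>1/2 - 1/\<beta>\<close> (\<open>reduced_energy_comparison\<close>); coercivity bounds the moments.
\<close>

section \<open>Rotation invariance of Lebesgue measure and of spherical shells\<close>

lemma nn_integral_lborel_reflect_shift:
  fixes g :: "'a::euclidean_space \<Rightarrow> ennreal"
  assumes [measurable]: "g \<in> borel_measurable borel"
  shows "(\<integral>\<^sup>+y. g (t - y) \<partial>lborel) = (\<integral>\<^sup>+y. g y \<partial>lborel)"
    and "(\<integral>\<^sup>+y. g (y + t) \<partial>lborel) = (\<integral>\<^sup>+y. g y \<partial>lborel)"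
proof -
  have "(\<integral>\<^sup>+y. g y \<partial>lborel) =
      (\<integral>\<^sup>+y. g y \<partial>density (distr lborel borel (\<lambda>x. t + (-1) *\<^sub>R x)) (\<lambda>_. \<bar>-1::real\<bar> ^ DIM('a)))"
    using lborel_affine[of "-1" t] by simp
  also have "\<dots> = (\<integral>\<^sup>+y. g (t - y) \<partial>lborel)"
    by (simp add: nn_integral_density nn_integral_distr)
  finally show "(\<integral>\<^sup>+y. g (t - y) \<partial>lborel) = (\<integral>\<^sup>+y. g y \<partial>lborel)" ..
  have "(\<integral>\<^sup>+y. g y \<partial>lborel) =
      (\<integral>\<^sup>+y. g y \<partial>density (distr lborel borel (\<lambda>x. t + 1 *\<^sub>R x)) (\<lambda>_. \<bar>1::real\<bar> ^ DIM('a)))"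
    using lborel_affine[of "1" t] by simp
  also have "\<dots> = (\<integral>\<^sup>+y. g (y + t) \<partial>lborel)"
    by (simp add: nn_integral_density nn_integral_distr add.commute)
  finally show "(\<integral>\<^sup>+y. g (y + t) \<partial>lborel) = (\<integral>\<^sup>+y. g y \<partial>lborel)" ..
qed

text \<open>
  Uniqueness of Haar measure. Both sides equal the double integral of
  \<open>indicator A x * indicator B (y + x)\<close> over \<open>x\<close> and \<open>y\<close>: for the left side translate in \<open>y\<close>, for the right
  side translate in \<open>x\<close> and reflect in \<open>y\<close>.
\<close>

lemma translation_invariant_proportional_lborel:
  fixes M :: "'a::euclidean_space measure"
  assumes "sigma_finite_measure M" and sets [measurable_cong, simp]: "sets M = sets borel"
    and inv: "\<And>c. distr M borel (\<lambda>x. x + c) = M"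
    and [measurable]: "A \<in> sets borel" "B \<in> sets borel"
  shows "emeasure M A * emeasure lborel B = emeasure M B * emeasure lborel A"
proof -
  interpret M: sigma_finite_measure M by fact
  interpret P: pair_sigma_finite M lborel ..
  have invI: "(\<integral>\<^sup>+x. g (x + c) \<partial>M) = (\<integral>\<^sup>+x. g x \<partial>M)" if [measurable]: "g \<in> borel_measurable borel" for g c
    by (subst (2) inv[of c, symmetric]) (simp add: nn_integral_distr)
  have "emeasure M A * emeasure lborel B
      = (\<integral>\<^sup>+x. indicator A x * (\<integral>\<^sup>+y. indicator B y \<partial>lborel) \<partial>M)"
    by (simp add: nn_integral_multc)
  also have "\<dots> = (\<integral>\<^sup>+x. indicator A x * (\<integral>\<^sup>+y. indicator B (y + x) \<partial>lborel) \<partial>M)"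
    by (intro nn_integral_cong arg_cong2[where f="(*)"] refl nn_integral_lborel_reflect_shift(2)[symmetric]) simp
  also have "\<dots> = (\<integral>\<^sup>+x. \<integral>\<^sup>+y. indicator A x * indicator B (y + x) \<partial>lborel \<partial>M)"
    by (simp add: nn_integral_cmult)
  also have "\<dots> = (\<integral>\<^sup>+y. \<integral>\<^sup>+x. indicator A x * indicator B (y + x) \<partial>M \<partial>lborel)"
    by (rule P.Fubini'[symmetric]) measurable
  also have "\<dots> = (\<integral>\<^sup>+y. \<integral>\<^sup>+x. indicator A (x - y) * indicator B x \<partial>M \<partial>lborel)"
  proof (rule nn_integral_cong)
    fix y :: 'a
    show "(\<integral>\<^sup>+x. indicator A x * indicator B (y + x) \<partial>M) = (\<integral>\<^sup>+x. indicator A (x - y) * indicator B x \<partial>M)"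
      using invI[of "\<lambda>x. indicator A x * indicator B (y + x)" "-y"] by simp
  qed
  also have "\<dots> = (\<integral>\<^sup>+x. \<integral>\<^sup>+y. indicator A (x - y) * indicator B x \<partial>lborel \<partial>M)"
    by (rule P.Fubini') measurable
  also have "\<dots> = (\<integral>\<^sup>+x. emeasure lborel A * indicator B x \<partial>M)"
    using nn_integral_lborel_reflect_shift(1)[of "indicator A"]
    by (intro nn_integral_cong) (simp add: nn_integral_multc)
  also have "\<dots> = emeasure M B * emeasure lborel A"
    by (subst nn_integral_cmult) (simp_all add: mult.commute)
  finally show ?thesis .
qed

text \<open>
  The image of Lebesgue measure is again translation invariant, hence proportional to Lebesgue
  measure; the unit ball is preserved and fixes the factor.
\<close>

lemma lborel_distr_orthogonal:
  fixes f :: "'a::euclidean_space \<Rightarrow> 'a"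
  assumes f: "orthogonal_transformation f"
  shows "distr lborel borel f = lborel"
proof -
  have lin: "linear f" and nrm: "\<And>x. norm (f x) = norm x" and inj: "inj f" and surj: "surj f"
    using f orthogonal_transformation_linear orthogonal_transformation_norm
      orthogonal_transformation_inj orthogonal_transformation_surj by blast+
  have [measurable]: "f \<in> borel_measurable borel"
    using lin by (intro borel_measurable_continuous_onI linear_continuous_on)
      (simp add: linear_conv_bounded_linear)
  define M where "M = distr lborel borel f"
  have setsM: "sets M = sets borel" by (simp add: M_def)
  have vim: "f -` cball 0 r = cball 0 r" for r
    by (auto simp: nrm)
  have emM: "emeasure M (cball 0 r) = emeasure lborel (cball (0::'a) r)" for r
    by (simp add: M_def emeasure_distr vim)
  have fin: "emeasure lborel (cball (0::'a) r) < \<infinity>" for r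
    by (rule emeasure_bounded_finite) simp
  have sf: "sigma_finite_measure M"
  proof (intro sigma_finite_measure.intro exI conjI)
    show "countable (range (\<lambda>n::nat. cball (0::'a) (real n)))" by simp
    show "range (\<lambda>n::nat. cball (0::'a) (real n)) \<subseteq> sets M" by (auto simp: setsM)
    show "\<Union> (range (\<lambda>n::nat. cball (0::'a) (real n))) = space M"
      by (auto simp: M_def real_arch_simple)
    show "\<forall>a\<in>range (\<lambda>n::nat. cball (0::'a) (real n)). emeasure M a \<noteq> \<infinity>"
      using fin by (auto simp: emM less_top)
  qed
  have inv: "distr M borel (\<lambda>x. x + c) = M" for c
  proof -
    obtain d where d: "c = f d" using surj by blast
    have "distr M borel (\<lambda>x. x + c) = distr lborel borel (\<lambda>x. f (d + x))"
      by (simp add: M_def distr_distr comp_def d linear_add[OF lin] add.commute)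
    also have "\<dots> = distr (distr lborel borel ((+) d)) borel f"
      by (simp add: distr_distr comp_def)
    also have "\<dots> = M" by (simp add: lborel_distr_plus M_def)
    finally show ?thesis .
  qed
  show ?thesis
  proof (rule measure_eqI)
    fix A assume "A \<in> sets (distr lborel borel f)"
    then have A: "A \<in> sets borel" by simp
    let ?B = "cball (0::'a) 1"
    have "emeasure M A * emeasure lborel ?B = emeasure lborel A * emeasure lborel ?B"
      using translation_invariant_proportional_lborel[OF sf setsM inv A, of ?B]
      by (simp add: emM mult.commute)
    moreover have "emeasure lborel ?B \<noteq> 0"
      by (simp add: emeasure_cball unit_ball_vol_pos[THEN less_imp_neq, symmetric])
    ultimately show "emeasure (distr lborel borel f) A = emeasure lborel A"
      using fin[of 1] ennreal_mult_cancel_left[of "emeasure lborel ?B" "emeasure M A" "emeasure lborel A"]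
      by (auto simp: M_def[symmetric] less_top mult.commute)
  qed simp
qed

lemma spherical_shell_orthogonal:
  fixes f :: "'a::euclidean_space \<Rightarrow> 'a"
  assumes f: "orthogonal_transformation f"
  shows "distr (spherical_shell r) borel f = spherical_shell r"
proof -
  have lin: "linear f" and nrm: "\<And>x. norm (f x) = norm x"
    using f orthogonal_transformation_linear orthogonal_transformation_norm by blast+
  have [measurable]: "f \<in> borel_measurable borel"
    using lin by (intro borel_measurable_continuous_onI linear_continuous_on)
      (simp add: linear_conv_bounded_linear)
  let ?U = "uniform_measure lborel (ball (0::'a) 1)"
  have U: "distr ?U borel f = ?U"
  proof (rule measure_eqI)
    fix A assume "A \<in> sets (distr ?U borel f)"
    then have [measurable]: "A \<in> sets borel" by simp
    have fA: "f -` A \<in> sets borel" using measurable_sets[of f borel borel A] by simp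
    have "emeasure (distr ?U borel f) A = emeasure ?U (f -` A)"
      by (simp add: emeasure_distr)
    also have "\<dots> = emeasure lborel (f -` (ball 0 1 \<inter> A)) / emeasure lborel (ball (0::'a) 1)"
    proof -
      have "ball 0 1 \<inter> f -` A = f -` (ball 0 1 \<inter> A)" by (auto simp: nrm)
      then show ?thesis using fA by (simp add: emeasure_uniform_measure)
    qed
    also have "emeasure lborel (f -` (ball 0 1 \<inter> A)) = emeasure (distr lborel borel f) (ball 0 1 \<inter> A)"
      by (simp add: emeasure_distr)
    finally show "emeasure (distr ?U borel f) A = emeasure ?U A"
      by (simp add: lborel_distr_orthogonal[OF f] emeasure_uniform_measure)
  qed simp
  have "distr (spherical_shell r) borel f = distr ?U borel (\<lambda>x. (r / norm x) *\<^sub>R f x)"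
    unfolding spherical_shell_def
    by (subst distr_distr) (auto simp: comp_def linear_cmul[OF lin])
  also have "\<dots> = distr (distr ?U borel f) borel (\<lambda>x. (r / norm x) *\<^sub>R x)"
    by (subst distr_distr) (auto simp: comp_def nrm)
  finally show ?thesis by (simp add: U spherical_shell_def)
qed

abbreviation unit_shell :: "'a::euclidean_space measure" where
  "unit_shell \<equiv> spherical_shell 1"

lemma spherical_shell_scale:
  "spherical_shell r = distr unit_shell borel (\<lambda>x::'a::euclidean_space. r *\<^sub>R x)"
  unfolding spherical_shell_def by (subst distr_distr) (auto simp: comp_def)

text \<open>
  Reflection in the hyperplane orthogonal to \<open>a - b\<close>.
\<close>

lemma householder_reflection:
  fixes a b :: "'a::euclidean_space"
  assumes "norm a = norm b"
  obtains f where "orthogonal_transformation f" "f a = b"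
proof -
  define v where "v = a - b"
  define f where "f = (\<lambda>x. x - (2 * (x \<bullet> v) / (v \<bullet> v)) *\<^sub>R v)"
  have "linear f"
    unfolding f_def by (rule linearI) (simp_all add: inner_add_left add_divide_distrib algebra_simps)
  moreover have "f x \<bullet> f y = x \<bullet> y" for x y
    by (cases "v = 0") (simp_all add: f_def inner_diff_left inner_diff_right inner_commute field_simps)
  moreover have "f a = b"
  proof (cases "a = b")
    case False
    have "v \<bullet> v = 2 * (a \<bullet> v)"
      using assms[unfolded norm_eq] by (simp add: v_def inner_diff_left inner_diff_right inner_commute)
    moreover have "v \<bullet> v \<noteq> 0" using False by (simp add: v_def)
    ultimately show ?thesis by (simp add: f_def v_def)
  qed (simp add: f_def v_def)
  ultimately show ?thesis using that by (auto simp: orthogonal_transformation_def)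
qed

text \<open>
  Rotation by \<open>\<theta>\<close> in the plane of two distinct basis vectors \<open>b\<close> and \<open>j\<close>, the identity on the orthogonal complement.
\<close>

definition plane_rotation :: "'a::euclidean_space \<Rightarrow> 'a \<Rightarrow> real \<Rightarrow> 'a \<Rightarrow> 'a" where
  "plane_rotation b j \<theta> y = y + ((cos \<theta> - 1) * (y \<bullet> b) - sin \<theta> * (y \<bullet> j)) *\<^sub>R b
                             + (sin \<theta> * (y \<bullet> b) + (cos \<theta> - 1) * (y \<bullet> j)) *\<^sub>R j"

lemma plane_rotation:
  assumes "b \<in> Basis" "j \<in> Basis" "b \<noteq> j"
  shows "orthogonal_transformation (plane_rotation b j \<theta>)"
    and "plane_rotation b j \<theta> y \<bullet> b = cos \<theta> * (y \<bullet> b) - sin \<theta> * (y \<bullet> j)"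
    and "plane_rotation b j \<theta> y \<bullet> j = sin \<theta> * (y \<bullet> b) + cos \<theta> * (y \<bullet> j)"
proof -
  have i: "b \<bullet> b = 1" "j \<bullet> j = 1" "b \<bullet> j = 0" "j \<bullet> b = 0"
    using assms by (auto simp: inner_Basis)
  have "linear (plane_rotation b j \<theta>)"
    by (rule linearI) (simp_all add: plane_rotation_def inner_add_left algebra_simps)
  moreover have "norm (plane_rotation b j \<theta> y) = norm y" for y
  proof -
    define u v where "u = (cos \<theta> - 1) * (y \<bullet> b) - sin \<theta> * (y \<bullet> j)"
      and "v = sin \<theta> * (y \<bullet> b) + (cos \<theta> - 1) * (y \<bullet> j)"
    have "plane_rotation b j \<theta> y \<bullet> plane_rotation b j \<theta> y = y \<bullet> y + 2 * u * (y \<bullet> b) + 2 * v * (y \<bullet> j) + u * u + v * v"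
      unfolding plane_rotation_def u_def[symmetric] v_def[symmetric]
      by (simp add: inner_add_left inner_add_right i inner_commute[of b y] inner_commute[of j y] distrib_left)
    also have "\<dots> = y \<bullet> y - (y \<bullet> b)\<^sup>2 - (y \<bullet> j)\<^sup>2 + (u + y \<bullet> b)\<^sup>2 + (v + y \<bullet> j)\<^sup>2"
      by (simp add: power2_eq_square algebra_simps)
    also have "(u + y \<bullet> b)\<^sup>2 + (v + y \<bullet> j)\<^sup>2 = ((y \<bullet> b)\<^sup>2 + (y \<bullet> j)\<^sup>2) * ((sin \<theta>)\<^sup>2 + (cos \<theta>)\<^sup>2)"
      unfolding u_def v_def by (simp add: power2_eq_square algebra_simps del: sin_cos_squared_add sin_cos_squared_add2 sin_cos_squared_add3)
    then have "y \<bullet> y - (y \<bullet> b)\<^sup>2 - (y \<bullet> j)\<^sup>2 + (u + y \<bullet> b)\<^sup>2 + (v + y \<bullet> j)\<^sup>2 = y \<bullet> y"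
      by simp
    finally show ?thesis by (simp add: norm_eq_sqrt_inner)
  qed
  ultimately show "orthogonal_transformation (plane_rotation b j \<theta>)" by (simp add: orthogonal_transformation)
  show "plane_rotation b j \<theta> y \<bullet> b = cos \<theta> * (y \<bullet> b) - sin \<theta> * (y \<bullet> j)"
    "plane_rotation b j \<theta> y \<bullet> j = sin \<theta> * (y \<bullet> b) + cos \<theta> * (y \<bullet> j)"
    by (simp_all add: plane_rotation_def inner_add_left i algebra_simps)
qed

section \<open>Averages over the unit sphere\<close>

lemma integrable_continuous_on_compact:
  fixes f :: "'a::t2_space \<Rightarrow> real"
  assumes "prob_space M" "sets M = sets borel" "compact K" "AE y in M. y \<in> K"
    and f: "f \<in> borel_measurable borel" "continuous_on K f"
  shows "integrable M f"
proof -
  interpret prob_space M by fact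
  have "bounded (f ` K)" by (intro compact_imp_bounded compact_continuous_image assms)
  then obtain B where "\<And>y. y \<in> K \<Longrightarrow> norm (f y) \<le> B" by (auto simp: bounded_iff)
  with assms(4) have "AE y in M. norm (f y) \<le> B" by auto
  moreover have "f \<in> borel_measurable M" using f(1) measurable_cong_sets[OF assms(2) refl] by blast
  ultimately show ?thesis by (rule integrable_const_bound)
qed

text \<open>
  Dominated convergence for the difference quotients: on a smaller closed interval times \<open>K\<close> the
  derivative is bounded by compactness, and the mean value theorem transfers the bound.
\<close>

lemma has_real_derivative_integral_compact:
  fixes f f' :: "real \<Rightarrow> 'a::t2_space \<Rightarrow> real"
  assumes M: "prob_space M" "sets M = sets borel" "compact K" "AE y in M. y \<in> K"
    and s0: "s0 \<in> {a<..<b}"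
    and D: "\<And>s y. s \<in> {a<..<b} \<Longrightarrow> y \<in> K \<Longrightarrow> ((\<lambda>s. f s y) has_real_derivative f' s y) (at s)"
    and cont: "continuous_on ({a<..<b} \<times> K) (\<lambda>(s, y). f' s y)"
    and integ: "\<And>s. s \<in> {a<..<b} \<Longrightarrow> integrable M (f s)"
    and meas: "f' s0 \<in> borel_measurable borel"
  shows "((\<lambda>s. \<integral>y. f s y \<partial>M) has_real_derivative (\<integral>y. f' s0 y \<partial>M)) (at s0)"
proof -
  interpret prob_space M by fact
  have meas': "f' s0 \<in> borel_measurable M" using meas measurable_cong_sets[OF M(2) refl] by blast
  define c d where "c = (a + s0) / 2" and "d = (s0 + b) / 2"
  have cd: "a < c" "c < s0" "s0 < d" "d < b" using s0 by (auto simp: c_def d_def field_simps)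
  have "bounded ((\<lambda>(s, y). f' s y) ` ({c..d} \<times> K))"
    using cd by (intro compact_imp_bounded compact_continuous_image compact_Times M
        continuous_on_subset[OF cont]) auto
  then obtain B where B: "\<And>s y. s \<in> {c..d} \<Longrightarrow> y \<in> K \<Longrightarrow> \<bar>f' s y\<bar> \<le> B"
    by (force simp: bounded_iff)
  have "((\<lambda>s. ((\<integral>y. f s y \<partial>M) - (\<integral>y. f s0 y \<partial>M)) / (s - s0)) \<longlongrightarrow> (\<integral>y. f' s0 y \<partial>M))
      (at s0 within {c<..<d})"
    unfolding tendsto_at_iff_sequentially comp_def
  proof (intro allI impI)
    fix X :: "nat \<Rightarrow> real" assume X: "\<forall>i. X i \<in> {c<..<d} - {s0}" and lim: "X \<longlonglongrightarrow> s0"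
    have Xab: "X i \<in> {a<..<b}" "X i \<in> {c..d}" "X i \<noteq> s0" for i using X cd by (auto dest!: spec[of _ i])
    have "((\<integral>y. f (X i) y \<partial>M) - (\<integral>y. f s0 y \<partial>M)) / (X i - s0)
        = (\<integral>y. (f (X i) y - f s0 y) / (X i - s0) \<partial>M)" for i
      using integ[OF Xab(1)] integ[OF s0] by simp
    moreover have "(\<lambda>i. \<integral>y. (f (X i) y - f s0 y) / (X i - s0) \<partial>M) \<longlonglongrightarrow> (\<integral>y. f' s0 y \<partial>M)"
    proof (rule integral_dominated_convergence[where w="\<lambda>_. B"])
      show "(\<lambda>y. (f (X i) y - f s0 y) / (X i - s0)) \<in> borel_measurable M" for i
        using integ[OF Xab(1)] integ[OF s0] by simp
      show "AE y in M. (\<lambda>i. (f (X i) y - f s0 y) / (X i - s0)) \<longlonglongrightarrow> f' s0 y"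
        using M(4)
      proof eventually_elim
        case (elim y)
        have "((\<lambda>s. (f s y - f s0 y) / (s - s0)) \<longlongrightarrow> f' s0 y) (at s0)"
          using D[OF s0 elim] by (simp add: has_field_derivative_iff)
        then show ?case
          using lim Xab(3) unfolding tendsto_at_iff_sequentially comp_def by auto
      qed
      show "AE y in M. norm ((f (X i) y - f s0 y) / (X i - s0)) \<le> B" for i
        using M(4)
      proof eventually_elim
        case (elim y)
        have "norm (f (X i) y - f s0 y) \<le> B * norm (X i - s0)"
        proof (rule field_differentiable_bound[where S="{c..d}" and f'="\<lambda>s. f' s y"])
          show "((\<lambda>s. f s y) has_field_derivative f' z y) (at z within {c..d})" if "z \<in> {c..d}" for z
          proof -
            have "z \<in> {a<..<b}" using that cd by auto
            from D[OF this elim] show ?thesis by (rule has_field_derivative_at_within)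
          qed
          show "norm (f' z y) \<le> B" if "z \<in> {c..d}" for z using B[OF that elim] by simp
        qed (use Xab(2) cd in auto)
        then show ?case using Xab(3)[of i] by (simp add: divide_le_eq)
      qed
    qed (use meas' in auto)
    ultimately show "(\<lambda>i. ((\<integral>y. f (X i) y \<partial>M) - (\<integral>y. f s0 y \<partial>M)) / (X i - s0)) \<longlonglongrightarrow> (\<integral>y. f' s0 y \<partial>M)"
      by (simp only:)
  qed
  then show ?thesis
    unfolding has_field_derivative_iff using cd by (simp add: at_within_open[of s0 "{c<..<d}"])
qed

lemma continuous_on_integral_compact:
  fixes f :: "real \<Rightarrow> 'a::t2_space \<Rightarrow> real"
  assumes M: "prob_space M" "sets M = sets borel" "compact K" "AE y in M. y \<in> K"
    and S: "compact S"
    and cont: "continuous_on (S \<times> K) (\<lambda>(s, y). f s y)"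
    and meas: "\<And>s. s \<in> S \<Longrightarrow> f s \<in> borel_measurable borel"
  shows "continuous_on S (\<lambda>s. \<integral>y. f s y \<partial>M)"
proof -
  interpret prob_space M by fact
  have meas': "f s \<in> borel_measurable M" if "s \<in> S" for s
    using meas[OF that] measurable_cong_sets[OF M(2) refl] by blast
  have "bounded ((\<lambda>(s, y). f s y) ` (S \<times> K))"
    by (intro compact_imp_bounded compact_continuous_image compact_Times M S cont)
  then obtain B where B: "\<And>s y. s \<in> S \<Longrightarrow> y \<in> K \<Longrightarrow> \<bar>f s y\<bar> \<le> B"
    by (force simp: bounded_iff)
  show ?thesis
    unfolding continuous_on_sequentially comp_def
  proof (intro allI ballI impI, elim conjE)
    fix X :: "nat \<Rightarrow> real" and s0 assume s0: "s0 \<in> S" and X: "\<forall>i. X i \<in> S" and lim: "X \<longlonglongrightarrow> s0"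
    show "(\<lambda>i. \<integral>y. f (X i) y \<partial>M) \<longlonglongrightarrow> (\<integral>y. f s0 y \<partial>M)"
    proof (rule integral_dominated_convergence[where w="\<lambda>_. B"])
      show "AE y in M. (\<lambda>i. f (X i) y) \<longlonglongrightarrow> f s0 y"
        using M(4)
      proof eventually_elim
        case (elim y)
        have "continuous_on S (\<lambda>s. f s y)"
        proof -
          have "continuous_on S ((\<lambda>(s, y). f s y) \<circ> (\<lambda>s. (s, y)))"
            using elim by (intro continuous_on_compose continuous_intros continuous_on_subset[OF cont]) auto
          then show ?thesis by (simp add: comp_def)
        qed
        then show ?case using s0 X lim unfolding continuous_on_sequentially comp_def by blast
      qed
      show "AE y in M. norm (f (X i) y) \<le> B" for i
        using M(4) by eventually_elim (use B X in auto)
    qed (use meas' s0 X in auto)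
  qed
qed

lemma unit_shell_facts:
  shows "prob_space (unit_shell :: 'a::euclidean_space measure)"
    and "sets (unit_shell :: 'a measure) = sets borel"
    and "AE y in (unit_shell :: 'a measure). y \<in> sphere 0 1"
  using spherical_shell_prob[of 1, where 'a='a] AE_spherical_shell[of 1, where 'a='a]
  by (simp_all add: prob_measures_def)

lemma integral_shell_orthogonal:
  fixes f :: "'a::euclidean_space \<Rightarrow> 'a" and g :: "'a \<Rightarrow> real"
  assumes f: "orthogonal_transformation f" and [measurable]: "g \<in> borel_measurable borel"
  shows "(\<integral>y. g (f y) \<partial>spherical_shell r) = (\<integral>y. g y \<partial>spherical_shell r)"
proof -
  have [measurable]: "f \<in> borel_measurable borel"
    using orthogonal_transformation_linear[OF f]
    by (intro borel_measurable_continuous_onI linear_continuous_on) (simp add: linear_conv_bounded_linear)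
  have [measurable_cong]: "sets (spherical_shell r :: 'a measure) = sets borel"
    by (simp add: spherical_shell_def)
  have "(\<integral>y. g y \<partial>spherical_shell r) = (\<integral>y. g y \<partial>distr (spherical_shell r) borel f)"
    by (simp add: spherical_shell_orthogonal[OF f])
  also have "\<dots> = (\<integral>y. g (f y) \<partial>spherical_shell r)"
    by (rule integral_distr) measurable
  finally show ?thesis ..
qed

text \<open>
  Integration by parts for the law of one coordinate under the uniform distribution on the sphere,
  obtained from rotation invariance. Rotating in the plane of \<open>b\<close> and a second
  basis vector \<open>j\<close> does not change the average of \<open>\<phi> (y \<bullet> b) * (y \<bullet> j)\<close>, so the derivative at angle zero
  vanishes: the average of \<open>\<phi> (y \<bullet> b) * (y \<bullet> b)\<close> equals that of \<open>\<phi>' (y \<bullet> b) * (y \<bullet> j)\<^sup>2\<close>. Summing over the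
  \<open>n - 1\<close> possible \<open>j\<close> gives the claim.
\<close>

lemma unit_shell_integration_by_parts:
  fixes b :: "'a::euclidean_space" and \<phi> \<phi>' :: "real \<Rightarrow> real"
  assumes b: "b \<in> Basis"
    and D: "\<And>t. \<bar>t\<bar> \<le> 1 \<Longrightarrow> (\<phi> has_real_derivative \<phi>' t) (at t)"
    and cont: "continuous_on {-1..1} \<phi>'"
    and [measurable]: "\<phi> \<in> borel_measurable borel" "\<phi>' \<in> borel_measurable borel"
  shows "(real DIM('a) - 1) * (\<integral>y. \<phi> (y \<bullet> b) * (y \<bullet> b) \<partial>unit_shell)
       = (\<integral>y. \<phi>' (y \<bullet> b) * (1 - (y \<bullet> b)\<^sup>2) \<partial>unit_shell)"
proof -
  let ?U = "unit_shell :: 'a measure"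
  note U = unit_shell_facts[where 'a='a]
  interpret U: prob_space ?U by (rule U)
  have le1: "\<bar>y \<bullet> b\<bar> \<le> 1" if "y \<in> sphere 0 1" for y
    using Basis_le_norm[OF b, of y] that by simp
  have cphi: "continuous_on {-1..1} \<phi>"
  proof (intro continuous_at_imp_continuous_on ballI)
    fix t :: real assume "t \<in> {-1..1}"
    then show "isCont \<phi> t" by (intro DERIV_isCont[OF D]) auto
  qed
  have int: "integrable ?U g" if "continuous_on (sphere 0 1) g" "g \<in> borel_measurable borel" for g :: "'a \<Rightarrow> real"
    by (rule integrable_continuous_on_compact[OF U(1,2) compact_sphere U(3)]) (use that in auto)
  have c1: "continuous_on (sphere 0 1) (\<lambda>y. \<phi> (y \<bullet> b))" "continuous_on (sphere 0 1) (\<lambda>y. \<phi>' (y \<bullet> b))"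
  proof -
    have c: "continuous_on (sphere 0 1) (\<lambda>y. y \<bullet> b)" by (intro continuous_intros)
    have im: "(\<lambda>y. y \<bullet> b) ` sphere 0 1 \<subseteq> {-1..1}" using le1 by (auto simp: abs_le_iff)
    show "continuous_on (sphere 0 1) (\<lambda>y. \<phi> (y \<bullet> b))" "continuous_on (sphere 0 1) (\<lambda>y. \<phi>' (y \<bullet> b))"
      using continuous_on_compose2[OF cphi c im] continuous_on_compose2[OF cont c im] .
  qed
  have key: "(\<integral>y. \<phi> (y \<bullet> b) * (y \<bullet> b) \<partial>?U) = (\<integral>y. \<phi>' (y \<bullet> b) * (y \<bullet> j)\<^sup>2 \<partial>?U)"
    if j: "j \<in> Basis - {b}" for j
  proof -
    define R where "R = plane_rotation b j"
    \<comment> \<open>\<open>u\<close> and \<open>v\<close> are the coordinates of the rotated point along \<open>b\<close> and \<open>j\<close>, so \<open>u' = - v\<close> and \<open>v' = u\<close>\<close>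
    have bj: "b \<noteq> j" "j \<in> Basis" using j by auto
    note R = plane_rotation[OF b bj(2,1), folded R_def]
    define u v where "u = (\<lambda>\<theta> (y::'a). cos \<theta> * (y \<bullet> b) - sin \<theta> * (y \<bullet> j))"
      and "v = (\<lambda>\<theta> (y::'a). sin \<theta> * (y \<bullet> b) + cos \<theta> * (y \<bullet> j))"
    have Ru: "R \<theta> y \<bullet> b = u \<theta> y" and Rv: "R \<theta> y \<bullet> j = v \<theta> y" for \<theta> y
      using R(2,3)[of \<theta> y] by (simp_all add: u_def v_def)
    have u1: "\<bar>u \<theta> y\<bar> \<le> 1" if "y \<in> sphere 0 1" for \<theta> y
      using le1[of "R \<theta> y"] that R(1)[of \<theta>] by (simp add: Ru orthogonal_transformation_norm)
    have cuv: "continuous_on S (\<lambda>(\<theta>, y). u \<theta> y)" "continuous_on S (\<lambda>(\<theta>, y). v \<theta> y)" for S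
      unfolding u_def v_def case_prod_unfold by (intro continuous_intros)+
    have cphiu: "continuous_on ({-1<..<1} \<times> sphere 0 1) (\<lambda>(\<theta>, y). \<phi> (u \<theta> y))"
      "continuous_on ({-1<..<1} \<times> sphere 0 1) (\<lambda>(\<theta>, y). \<phi>' (u \<theta> y))"
    proof -
      have im: "(\<lambda>(\<theta>, y). u \<theta> y) ` ({-1<..<1} \<times> sphere 0 1) \<subseteq> {-1..1}"
      proof clarify
        fix \<theta> :: real and y :: 'a assume "y \<in> sphere 0 1"
        from u1[OF this, of \<theta>] show "u \<theta> y \<in> {-1..1}" by (simp add: abs_le_iff)
      qed
      show "continuous_on ({-1<..<1} \<times> sphere 0 1) (\<lambda>(\<theta>, y). \<phi> (u \<theta> y))"
        "continuous_on ({-1<..<1} \<times> sphere 0 1) (\<lambda>(\<theta>, y). \<phi>' (u \<theta> y))"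
        using continuous_on_compose2[OF cphi cuv(1) im] continuous_on_compose2[OF cont cuv(1) im]
        by (simp_all add: case_prod_unfold)
    qed
    have [measurable]: "u \<theta> \<in> borel_measurable borel" "v \<theta> \<in> borel_measurable borel" for \<theta>
      unfolding u_def v_def by measurable
    have "((\<lambda>\<theta>. \<integral>y. \<phi> (u \<theta> y) * v \<theta> y \<partial>?U) has_real_derivative
           (\<integral>y. \<phi>' (u 0 y) * (- v 0 y) * v 0 y + \<phi> (u 0 y) * u 0 y \<partial>?U)) (at 0)"
    proof (rule has_real_derivative_integral_compact[OF U(1,2) compact_sphere U(3), of 0 "-1" 1])
      fix \<theta> y assume "\<theta> \<in> {-1<..<1::real}" and y: "y \<in> sphere (0::'a) 1"
      show "((\<lambda>\<theta>. \<phi> (u \<theta> y) * v \<theta> y) has_real_derivative \<phi>' (u \<theta> y) * (- v \<theta> y) * v \<theta> y + \<phi> (u \<theta> y) * u \<theta> y) (at \<theta>)"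
      proof -
        have dv: "((\<lambda>\<theta>. v \<theta> y) has_real_derivative u \<theta> y) (at \<theta>)"
          unfolding u_def v_def by (auto intro!: derivative_eq_intros)
        have du: "((\<lambda>\<theta>. u \<theta> y) has_real_derivative - v \<theta> y) (at \<theta>)"
          unfolding u_def v_def by (auto intro!: derivative_eq_intros)
        have "((\<lambda>\<theta>. \<phi> (u \<theta> y)) has_real_derivative \<phi>' (u \<theta> y) * (- v \<theta> y)) (at \<theta>)"
          using D[OF u1[OF y]] du by (rule DERIV_chain2)
        from DERIV_mult[OF this dv] show ?thesis by (simp add: mult.commute)
      qed
    next
      show "continuous_on ({-1<..<1} \<times> sphere 0 1)
          (\<lambda>(\<theta>, y). \<phi>' (u \<theta> y) * (- v \<theta> y) * v \<theta> y + \<phi> (u \<theta> y) * u \<theta> y)"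
        using cphiu cuv[of "{-1<..<1} \<times> sphere 0 1"] unfolding case_prod_unfold by (intro continuous_intros)
    next
      fix \<theta> :: real
      have "continuous_on (sphere 0 1) (\<lambda>y. \<phi> (u \<theta> y))"
      proof (rule continuous_on_compose2[OF cphi])
        show "continuous_on (sphere 0 1) (u \<theta>)" unfolding u_def by (intro continuous_intros)
        show "u \<theta> ` sphere 0 1 \<subseteq> {-1..1}"
        proof clarify
          fix y :: 'a assume "y \<in> sphere 0 1"
          from u1[OF this, of \<theta>] show "u \<theta> y \<in> {-1..1}" by (simp add: abs_le_iff)
        qed
      qed
      then show "integrable ?U (\<lambda>y. \<phi> (u \<theta> y) * v \<theta> y)"
        by (intro int continuous_intros) (auto simp: v_def intro!: continuous_intros)
    qed auto
    moreover have "(\<integral>y. \<phi> (u \<theta> y) * v \<theta> y \<partial>?U) = (\<integral>y. \<phi> (y \<bullet> b) * (y \<bullet> j) \<partial>?U)" for \<theta>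
      using integral_shell_orthogonal[OF R(1)[of \<theta>], of "\<lambda>y. \<phi> (y \<bullet> b) * (y \<bullet> j)" 1]
      by (simp add: Ru Rv)
    ultimately have "(\<integral>y. \<phi>' (u 0 y) * (- v 0 y) * v 0 y + \<phi> (u 0 y) * u 0 y \<partial>?U) = 0"
      using DERIV_unique[OF _ DERIV_const] by simp
    moreover have "(\<integral>y. \<phi>' (u 0 y) * (- v 0 y) * v 0 y + \<phi> (u 0 y) * u 0 y \<partial>?U)
        = (\<integral>y. \<phi> (y \<bullet> b) * (y \<bullet> b) - \<phi>' (y \<bullet> b) * (y \<bullet> j)\<^sup>2 \<partial>?U)"
      by (intro Bochner_Integration.integral_cong) (auto simp: u_def v_def power2_eq_square)
    moreover have "\<dots> = (\<integral>y. \<phi> (y \<bullet> b) * (y \<bullet> b) \<partial>?U) - (\<integral>y. \<phi>' (y \<bullet> b) * (y \<bullet> j)\<^sup>2 \<partial>?U)"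
      using c1 by (intro Bochner_Integration.integral_diff int continuous_intros) auto
    ultimately show ?thesis by simp
  qed
  have "(real DIM('a) - 1) * (\<integral>y. \<phi> (y \<bullet> b) * (y \<bullet> b) \<partial>?U)
      = (\<Sum>j\<in>Basis - {b}. \<integral>y. \<phi> (y \<bullet> b) * (y \<bullet> b) \<partial>?U)"
    using b by (simp add: card_Diff_singleton of_nat_diff DIM_positive Suc_leI)
  also have "\<dots> = (\<Sum>j\<in>Basis - {b}. \<integral>y. \<phi>' (y \<bullet> b) * (y \<bullet> j)\<^sup>2 \<partial>?U)"
    by (intro sum.cong refl key)
  also have "\<dots> = (\<integral>y. (\<Sum>j\<in>Basis - {b}. \<phi>' (y \<bullet> b) * (y \<bullet> j)\<^sup>2) \<partial>?U)"
    using c1 by (intro Bochner_Integration.integral_sum[symmetric] int continuous_intros) auto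
  also have "\<dots> = (\<integral>y. \<phi>' (y \<bullet> b) * (1 - (y \<bullet> b)\<^sup>2) \<partial>?U)"
  proof (rule integral_cong_AE)
    show "AE y in ?U. (\<Sum>j\<in>Basis - {b}. \<phi>' (y \<bullet> b) * (y \<bullet> j)\<^sup>2) = \<phi>' (y \<bullet> b) * (1 - (y \<bullet> b)\<^sup>2)"
      using U(3)
    proof eventually_elim
      case (elim y)
      have "1 = (norm y)\<^sup>2" using elim by simp
      also have "\<dots> = (\<Sum>j\<in>Basis. (y \<bullet> j)\<^sup>2)"
        unfolding power2_norm_eq_inner by (subst euclidean_inner) (simp add: power2_eq_square)
      also have "\<dots> = (y \<bullet> b)\<^sup>2 + (\<Sum>j\<in>Basis - {b}. (y \<bullet> j)\<^sup>2)"
        by (rule sum.remove) (use b in auto)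
      finally show ?case by (simp add: sum_distrib_left[symmetric])
    qed
  qed (simp_all add: measurable_cong_sets[OF U(2) refl])
  finally show ?thesis .
qed

section \<open>The radial potential of the unit shell\<close>

text \<open>
  The squared distance between \<open>s *\<^sub>R b\<close> and a unit vector \<open>y\<close> with \<open>y \<bullet> b = t\<close>, for a unit vector \<open>b\<close>.
\<close>

definition chord2 :: "real \<Rightarrow> real \<Rightarrow> real" where
  "chord2 s t = s\<^sup>2 + 1 - 2 * s * t"

lemma chord2_alt: "chord2 s t = (s - t)\<^sup>2 + (1 - t\<^sup>2)"
  by (simp add: chord2_def power2_eq_square algebra_simps)

lemma chord2_nonneg: "\<bar>t\<bar> \<le> 1 \<Longrightarrow> 0 \<le> chord2 s t"
  unfolding chord2_alt by (simp add: abs_square_le_1)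

lemma chord2_pos:
  assumes "\<bar>t\<bar> \<le> 1" "s > -1" "s \<noteq> 1"
  shows "0 < chord2 s t"
proof (rule ccontr)
  assume "\<not> ?thesis"
  moreover have "t\<^sup>2 \<le> 1" using assms(1) by (simp add: abs_square_le_1)
  moreover have "0 \<le> (s - t)\<^sup>2" by simp
  ultimately have "(s - t)\<^sup>2 = 0" "t\<^sup>2 = 1" unfolding chord2_alt by linarith+
  then show False using assms by (simp add: power2_eq_1_iff)
qed

lemma chord2_norm:
  fixes y b :: "'a::euclidean_space"
  assumes "norm y = 1" "norm b = 1"
  shows "(norm (s *\<^sub>R b - y))\<^sup>2 = chord2 s (y \<bullet> b)"
  using assms unfolding chord2_def norm_eq_1 power2_norm_eq_inner
  by (simp add: inner_diff_left inner_diff_right inner_commute power2_eq_square)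

lemma continuous_on_chord2 [continuous_intros]:
  "continuous_on S f \<Longrightarrow> continuous_on S g \<Longrightarrow> continuous_on S (\<lambda>x. chord2 (f x) (g x))"
  unfolding chord2_def by (intro continuous_intros)

lemma measurable_chord2 [measurable]: "chord2 s \<in> borel_measurable borel"
  unfolding chord2_def by measurable

lemma DERIV_chord2_powr:
  assumes "0 < chord2 s t"
  shows "((\<lambda>s. chord2 s t powr \<delta>) has_real_derivative \<delta> * chord2 s t powr (\<delta> - 1) * (2 * (s - t))) (at s)"
    and "((\<lambda>t. chord2 s t powr \<delta>) has_real_derivative \<delta> * chord2 s t powr (\<delta> - 1) * (- 2 * s)) (at t)"
proof -
  have 1: "((\<lambda>s. chord2 s t) has_real_derivative 2 * (s - t)) (at s)"
    unfolding chord2_def by (auto intro!: derivative_eq_intros)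
  have 2: "((\<lambda>t. chord2 s t) has_real_derivative - 2 * s) (at t)"
    unfolding chord2_def by (auto intro!: derivative_eq_intros)
  have *: "((\<lambda>x. x powr \<delta>) has_real_derivative \<delta> * chord2 s t powr (\<delta> - 1)) (at (chord2 s t))"
    using assms by (rule has_real_derivative_powr)
  show "((\<lambda>s. chord2 s t powr \<delta>) has_real_derivative \<delta> * chord2 s t powr (\<delta> - 1) * (2 * (s - t))) (at s)"
    using * 1 by (rule DERIV_chain2)
  show "((\<lambda>t. chord2 s t powr \<delta>) has_real_derivative \<delta> * chord2 s t powr (\<delta> - 1) * (- 2 * s)) (at t)"
    using * 2 by (rule DERIV_chain2)
qed

text \<open>
  The average of \<open>norm (s *\<^sub>R b - y) powr p\<close> over unit vectors \<open>y\<close>, for a unit vector \<open>b\<close>. For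
  \<open>s > -1\<close> and \<open>s \<noteq> 1\<close> the next two functions are its first and second derivatives in \<open>s\<close>.
\<close>

definition radial_pot :: "'a::euclidean_space \<Rightarrow> real \<Rightarrow> real \<Rightarrow> real" where
  "radial_pot b p s = (\<integral>y. chord2 s (y \<bullet> b) powr (p / 2) \<partial>unit_shell)"

definition radial_pot1 :: "'a::euclidean_space \<Rightarrow> real \<Rightarrow> real \<Rightarrow> real" where
  "radial_pot1 b p s =
     (\<integral>y. p * chord2 s (y \<bullet> b) powr (p / 2 - 1) * (s - y \<bullet> b) \<partial>unit_shell)"

definition radial_pot2 :: "'a::euclidean_space \<Rightarrow> real \<Rightarrow> real \<Rightarrow> real" where
  "radial_pot2 b p s = (\<integral>y. p * chord2 s (y \<bullet> b) powr (p / 2 - 1)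
     + p * (p - 2) * chord2 s (y \<bullet> b) powr (p / 2 - 2) * (s - y \<bullet> b)\<^sup>2 \<partial>unit_shell)"

lemma radial_pot_nonneg: "0 \<le> radial_pot b p s"
  unfolding radial_pot_def by (rule Bochner_Integration.integral_nonneg) simp

abbreviation shell_potential :: "real \<Rightarrow> real \<Rightarrow> 'a::euclidean_space \<Rightarrow> real" where
  "shell_potential p r x \<equiv> \<integral>y. norm (x - y) powr p \<partial>spherical_shell r"

context
  fixes b :: "'a::euclidean_space"
  assumes b: "b \<in> Basis"
begin

interpretation U: prob_space "unit_shell :: 'a measure"
  by (rule unit_shell_facts)

lemma inner_le1: "y \<in> sphere 0 1 \<Longrightarrow> \<bar>y \<bullet> b\<bar> \<le> 1"
  using Basis_le_norm[OF b, of y] by simp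

lemma AE_inner_le1: "AE y in unit_shell. \<bar>y \<bullet> b\<bar> \<le> 1"
  using unit_shell_facts(3)[where 'a='a] by eventually_elim (rule inner_le1)

lemma integrable_shell_inner:
  fixes f :: "real \<Rightarrow> real"
  assumes "continuous_on {-1..1} f" "f \<in> borel_measurable borel"
  shows "integrable unit_shell (\<lambda>y. f (y \<bullet> b))"
proof (rule integrable_continuous_on_compact[OF unit_shell_facts(1,2) compact_sphere unit_shell_facts(3)])
  have "continuous_on (sphere 0 1) (\<lambda>y. y \<bullet> b)" by (intro continuous_intros)
  moreover have "(\<lambda>y. y \<bullet> b) ` sphere 0 1 \<subseteq> {-1..1}" using inner_le1 by (auto simp: abs_le_iff)
  ultimately show "continuous_on (sphere 0 1) (\<lambda>y. f (y \<bullet> b))"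
    by (rule continuous_on_compose2[OF assms(1)])
qed (use assms(2) in measurable)

lemma shell_average_DERIV:
  fixes f f' :: "real \<Rightarrow> real \<Rightarrow> real"
  assumes s0: "s0 > -1" "s0 \<noteq> 1"
    and D: "\<And>s t. 0 < chord2 s t \<Longrightarrow> ((\<lambda>s. f s t) has_real_derivative f' s t) (at s)"
    and cont: "continuous_on {z. 0 < chord2 (fst z) (snd z)} (\<lambda>z. f (fst z) (snd z))"
      "continuous_on {z. 0 < chord2 (fst z) (snd z)} (\<lambda>z. f' (fst z) (snd z))"
    and meas: "\<And>s. f s \<in> borel_measurable borel" "\<And>s. f' s \<in> borel_measurable borel"
  shows "((\<lambda>s. \<integral>y. f s (y \<bullet> b) \<partial>unit_shell) has_real_derivative
          (\<integral>y. f' s0 (y \<bullet> b) \<partial>unit_shell)) (at s0)"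
proof -
  define l r where "l = (if s0 < 1 then -1 else 1::real)" and "r = (if s0 < 1 then 1 else s0 + 1)"
  have s0': "s0 \<in> {l<..<r}" using s0 by (auto simp: l_def r_def)
  have pos: "0 < chord2 s t" if "s \<in> {l<..<r}" "\<bar>t\<bar> \<le> 1" for s t
    by (rule chord2_pos) (use that in \<open>auto simp: l_def r_def split: if_splits\<close>)
  show ?thesis
  proof (rule has_real_derivative_integral_compact[OF unit_shell_facts(1,2) compact_sphere unit_shell_facts(3) s0'])
    fix s y assume "s \<in> {l<..<r}" "y \<in> sphere (0::'a) 1"
    then show "((\<lambda>s. f s (y \<bullet> b)) has_real_derivative f' s (y \<bullet> b)) (at s)"
      by (intro D pos inner_le1)
  next
    have "continuous_on ({l<..<r} \<times> sphere 0 1) (\<lambda>(s, y). (s, y \<bullet> b))"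
      unfolding case_prod_unfold by (intro continuous_intros)
    moreover have "(\<lambda>(s, y). (s, y \<bullet> b)) ` ({l<..<r} \<times> sphere 0 1) \<subseteq> {z. 0 < chord2 (fst z) (snd z)}"
      using pos inner_le1 by auto
    ultimately have "continuous_on ({l<..<r} \<times> sphere 0 1) (\<lambda>x. (\<lambda>z. f' (fst z) (snd z)) ((\<lambda>(s, y). (s, y \<bullet> b)) x))"
      by (rule continuous_on_compose2[OF cont(2)])
    then show "continuous_on ({l<..<r} \<times> sphere 0 1) (\<lambda>(s, y). f' s (y \<bullet> b))"
      by (simp add: case_prod_unfold)
  next
    fix s assume s: "s \<in> {l<..<r}"
    have "continuous_on {-1..1} (\<lambda>t. (\<lambda>z. f (fst z) (snd z)) (s, t))"
    proof (rule continuous_on_compose2[OF cont(1)])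
      show "continuous_on {-1..1} (\<lambda>t. (s, t))" by (intro continuous_intros)
      show "(\<lambda>t. (s, t)) ` {-1..1} \<subseteq> {z. 0 < chord2 (fst z) (snd z)}" using pos[OF s] by (auto simp: abs_le_iff)
    qed
    then show "integrable unit_shell (\<lambda>y. f s (y \<bullet> b))"
      by (intro integrable_shell_inner meas) simp
  qed (use meas(2)[of s0] in measurable)
qed

lemma continuous_on_chord2_powr:
  "continuous_on {z. 0 < chord2 (fst z) (snd z)} (\<lambda>z. chord2 (fst z) (snd z) powr \<delta>)"
  by (intro continuous_intros) auto

lemma DERIV_radial_pot: "s > -1 \<Longrightarrow> s \<noteq> 1 \<Longrightarrow> (radial_pot b p has_real_derivative radial_pot1 b p s) (at s)"
  unfolding radial_pot_def[abs_def] radial_pot1_def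
proof (rule shell_average_DERIV)
  show "((\<lambda>s. chord2 s t powr (p / 2)) has_real_derivative p * chord2 s t powr (p / 2 - 1) * (s - t)) (at s)"
    if "0 < chord2 s t" for s t
    using DERIV_chord2_powr(1)[OF that, of "p / 2"] by (rule DERIV_cong) simp
next
  show "continuous_on {z. 0 < chord2 (fst z) (snd z)} (\<lambda>z. chord2 (fst z) (snd z) powr (p / 2))"
    by (rule continuous_on_chord2_powr)
  show "continuous_on {z. 0 < chord2 (fst z) (snd z)} (\<lambda>z. p * chord2 (fst z) (snd z) powr (p / 2 - 1) * (fst z - snd z))"
    by (intro continuous_on_chord2_powr continuous_on_mult continuous_on_diff continuous_on_const
      continuous_on_fst continuous_on_snd continuous_on_id)
  show "(\<lambda>t. chord2 s t powr (p / 2)) \<in> borel_measurable borel"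
    "(\<lambda>t. p * chord2 s t powr (p / 2 - 1) * (s - t)) \<in> borel_measurable borel" for s
    by measurable
qed

lemma DERIV_radial_pot1: "s > -1 \<Longrightarrow> s \<noteq> 1 \<Longrightarrow> (radial_pot1 b p has_real_derivative radial_pot2 b p s) (at s)"
  unfolding radial_pot1_def[abs_def] radial_pot2_def
proof (rule shell_average_DERIV)
  show "((\<lambda>s. p * chord2 s t powr (p / 2 - 1) * (s - t)) has_real_derivative
      p * chord2 s t powr (p / 2 - 1) + p * (p - 2) * chord2 s t powr (p / 2 - 2) * (s - t)\<^sup>2) (at s)"
    if "0 < chord2 s t" for s t
  proof -
    have "((\<lambda>s. p * (s - t)) has_real_derivative p) (at s)"
      by (auto intro!: derivative_eq_intros)
    from DERIV_mult[OF DERIV_chord2_powr(1)[OF that, of "p / 2 - 1"] this]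
    have D: "((\<lambda>s. chord2 s t powr (p / 2 - 1) * (p * (s - t))) has_real_derivative
       (p / 2 - 1) * chord2 s t powr (p / 2 - 1 - 1) * (2 * (s - t)) * (p * (s - t))
       + p * chord2 s t powr (p / 2 - 1)) (at s)" .
    have e: "p / 2 - 1 - 1 = p / 2 - 2" by simp
    have "((\<lambda>s. chord2 s t powr (p / 2 - 1) * (p * (s - t))) has_real_derivative
      p * chord2 s t powr (p / 2 - 1) + p * (p - 2) * chord2 s t powr (p / 2 - 2) * (s - t)\<^sup>2) (at s)"
      by (rule DERIV_cong[OF D]) (simp add: e power2_eq_square field_simps)
    moreover have "(\<lambda>s. chord2 s t powr (p / 2 - 1) * (p * (s - t))) = (\<lambda>s. p * chord2 s t powr (p / 2 - 1) * (s - t))"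
      by (simp add: fun_eq_iff)
    ultimately show ?thesis by (simp only:)
  qed
next
  show "continuous_on {z. 0 < chord2 (fst z) (snd z)} (\<lambda>z. p * chord2 (fst z) (snd z) powr (p / 2 - 1) * (fst z - snd z))"
    by (intro continuous_on_chord2_powr continuous_on_mult continuous_on_diff continuous_on_const
      continuous_on_fst continuous_on_snd continuous_on_id)
  show "continuous_on {z. 0 < chord2 (fst z) (snd z)} (\<lambda>z. p * chord2 (fst z) (snd z) powr (p / 2 - 1)
     + p * (p - 2) * chord2 (fst z) (snd z) powr (p / 2 - 2) * (fst z - snd z)\<^sup>2)"
    by (intro continuous_on_chord2_powr continuous_on_mult continuous_on_diff continuous_on_const
      continuous_on_add continuous_on_power continuous_on_fst continuous_on_snd continuous_on_id)
  show "(\<lambda>t. p * chord2 s t powr (p / 2 - 1) * (s - t)) \<in> borel_measurable borel" for s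
    by measurable
  show "(\<lambda>t. p * chord2 s t powr (p / 2 - 1)
     + p * (p - 2) * chord2 s t powr (p / 2 - 2) * (s - t)\<^sup>2) \<in> borel_measurable borel" for s
    by measurable
qed

text \<open>
  The identity \<open>\<Delta> |x|\<^sup>p = p (p + n - 2) |x|\<^sup>p\<^sup>-\<^sup>2\<close>, averaged over the sphere, in polar coordinates and multiplied by \<open>s\<close>.
  Integration by parts in the angle turns the part of the first derivative that is linear in \<open>t = y \<bullet> b\<close> into a
  multiple of \<open>1 - t\<^sup>2\<close>, which together with \<open>(s - t)\<^sup>2\<close> from the second derivative adds up to \<open>chord2 s t\<close>.
\<close>

lemma radial_laplacian:
  assumes s: "s > -1" "s \<noteq> 1"
  shows "s * radial_pot2 b p s + (real DIM('a) - 1) * radial_pot1 b p s = p * (p + real DIM('a) - 2) * s * radial_pot b (p - 2) s"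
proof -
  let ?I = "\<lambda>f. \<integral>y. f (y \<bullet> b) \<partial>(unit_shell :: 'a measure)"
  define W1 W2 where "W1 = (\<lambda>t. chord2 s t powr (p / 2 - 1))" and "W2 = (\<lambda>t. chord2 s t powr (p / 2 - 2))"
  have pos: "0 < chord2 s t" if "\<bar>t\<bar> \<le> 1" for t using chord2_pos[OF that s] .
  have c: "continuous_on {-1..1} (\<lambda>t. chord2 s t powr \<delta>)" for \<delta>
  proof (rule continuous_on_powr)
    show "\<forall>t\<in>{-1..1}. chord2 s t \<noteq> 0" using pos by (force simp: abs_le_iff)
  qed (intro continuous_intros)+
  have cW [continuous_intros]: "continuous_on {-1..1} W1" "continuous_on {-1..1} W2"
    unfolding W1_def W2_def by (rule c)+
  have [measurable]: "W1 \<in> borel_measurable borel" "W2 \<in> borel_measurable borel"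
    unfolding W1_def W2_def by measurable
  have ibp: "(real DIM('a) - 1) * ?I (\<lambda>t. W1 t * t) = ?I (\<lambda>t. (- (p - 2) * s * W2 t) * (1 - t\<^sup>2))"
  proof (rule unit_shell_integration_by_parts[OF b])
    show "(W1 has_real_derivative - (p - 2) * s * W2 t) (at t)" if "\<bar>t\<bar> \<le> 1" for t
      using DERIV_chord2_powr(2)[OF pos[OF that], of "p / 2 - 1"]
      unfolding W1_def W2_def by (rule DERIV_cong) (simp add: algebra_simps)
  qed ((intro continuous_intros)?, measurable)
  have i: "integrable unit_shell (\<lambda>y. W1 (y \<bullet> b))"
     "integrable unit_shell (\<lambda>y. W1 (y \<bullet> b) * (y \<bullet> b))"
     "integrable unit_shell (\<lambda>y. W2 (y \<bullet> b) * (1 - (y \<bullet> b)\<^sup>2))"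
     "integrable unit_shell (\<lambda>y. W2 (y \<bullet> b) * (s - y \<bullet> b)\<^sup>2)"
    by (rule integrable_shell_inner, (intro continuous_intros), measurable)+
  have ibp': "(real DIM('a) - 1) * ?I (\<lambda>t. W1 t * t) = - (p - 2) * s * ?I (\<lambda>t. W2 t * (1 - t\<^sup>2))"
    using ibp by (simp add: mult.assoc)
  have G1: "radial_pot1 b p s = p * s * ?I W1 - p * ?I (\<lambda>t. W1 t * t)"
  proof -
    have "radial_pot1 b p s = ?I (\<lambda>t. p * s * W1 t - p * (W1 t * t))"
      unfolding radial_pot1_def W1_def by (intro Bochner_Integration.integral_cong) (simp_all add: algebra_simps)
    then show ?thesis using i by simp
  qed
  have G2: "radial_pot2 b p s = p * ?I W1 + p * (p - 2) * ?I (\<lambda>t. W2 t * (s - t)\<^sup>2)"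
  proof -
    have "radial_pot2 b p s = ?I (\<lambda>t. p * W1 t + p * (p - 2) * (W2 t * (s - t)\<^sup>2))"
      unfolding radial_pot2_def W1_def W2_def by (intro Bochner_Integration.integral_cong) (simp_all add: algebra_simps)
    then show ?thesis using i by simp
  qed
  have sum: "?I (\<lambda>t. W2 t * (s - t)\<^sup>2) + ?I (\<lambda>t. W2 t * (1 - t\<^sup>2)) = ?I W1"
  proof -
    have "?I (\<lambda>t. W2 t * (s - t)\<^sup>2) + ?I (\<lambda>t. W2 t * (1 - t\<^sup>2)) = ?I (\<lambda>t. W2 t * (s - t)\<^sup>2 + W2 t * (1 - t\<^sup>2))"
      using i by simp
    also have "\<dots> = ?I W1"
    proof (rule integral_cong_AE)
      show "AE y in unit_shell. W2 (y \<bullet> b) * (s - y \<bullet> b)\<^sup>2 + W2 (y \<bullet> b) * (1 - (y \<bullet> b)\<^sup>2) = W1 (y \<bullet> b)"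
        using AE_inner_le1
      proof eventually_elim
        case (elim y)
        have "W1 (y \<bullet> b) = W2 (y \<bullet> b) * chord2 s (y \<bullet> b)"
          using pos[OF elim] powr_add[of "chord2 s (y \<bullet> b)" "p / 2 - 2" 1]
          by (simp add: W1_def W2_def)
        then show ?case by (simp add: chord2_alt distrib_left)
      qed
    qed (simp_all add: measurable_cong_sets[OF unit_shell_facts(2) refl])
    finally show ?thesis .
  qed
  have GW: "radial_pot b (p - 2) s = ?I W1"
    unfolding radial_pot_def W1_def by (simp add: diff_divide_distrib)
  define n where "n = real DIM('a)"
  define A B X Y where "A = ?I (\<lambda>t. W2 t * (s - t)\<^sup>2)" and "B = ?I (\<lambda>t. W2 t * (1 - t\<^sup>2))"
    and "X = ?I (\<lambda>t. W1 t * t)" and "Y = ?I W1"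
  note fold = A_def[symmetric] B_def[symmetric] X_def[symmetric] Y_def[symmetric] n_def[symmetric]
  note G1 = G1[unfolded fold] and G2 = G2[unfolded fold] and ibp' = ibp'[unfolded fold]
    and sum = sum[unfolded fold] and GW = GW[unfolded fold]
  have "s * radial_pot2 b p s + (n - 1) * radial_pot1 b p s
      = s * p * Y + s * p * (p - 2) * A + p * s * (n - 1) * Y - p * ((n - 1) * X)"
    by (simp add: G1 G2 algebra_simps)
  also have "\<dots> = s * p * n * Y + s * p * (p - 2) * (A + B)"
    unfolding ibp' by (simp add: algebra_simps)
  also have "\<dots> = p * (p + n - 2) * s * radial_pot b (p - 2) s"
    by (simp add: sum GW algebra_simps)
  finally show ?thesis by (simp add: n_def)
qed

lemma continuous_on_chord2_powr_nonneg:
  assumes "0 < \<delta>"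
  shows "continuous_on (S \<times> sphere 0 1) (\<lambda>(s, y). chord2 s (y \<bullet> b) powr \<delta>)"
  unfolding case_prod_unfold
proof (rule continuous_on_powr')
  show "\<forall>x\<in>S \<times> sphere 0 1. 0 \<le> chord2 (fst x) (snd x \<bullet> b) \<and> (chord2 (fst x) (snd x \<bullet> b) = 0 \<longrightarrow> 0 < \<delta>)"
    using assms chord2_nonneg inner_le1 by auto
qed (intro continuous_intros)+

lemma continuous_on_radial_pot:
  assumes "0 < p"
  shows "continuous_on {x..y} (radial_pot b p)"
  unfolding radial_pot_def[abs_def]
  by (rule continuous_on_integral_compact[OF unit_shell_facts(1,2) compact_sphere unit_shell_facts(3)])
     (use assms in \<open>auto intro!: continuous_on_chord2_powr_nonneg\<close>)

lemma continuous_on_radial_pot1: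
  assumes "2 < p"
  shows "continuous_on {x..y} (radial_pot1 b p)"
  unfolding radial_pot1_def[abs_def]
proof (rule continuous_on_integral_compact[OF unit_shell_facts(1,2) compact_sphere unit_shell_facts(3)])
  have "continuous_on ({x..y} \<times> sphere 0 1) (\<lambda>(s, y). chord2 s (y \<bullet> b) powr (p / 2 - 1))"
    by (rule continuous_on_chord2_powr_nonneg) (use assms in simp)
  then show "continuous_on ({x..y} \<times> sphere 0 1) (\<lambda>(s, y). p * chord2 s (y \<bullet> b) powr (p / 2 - 1) * (s - y \<bullet> b))"
    unfolding case_prod_unfold
    by (intro continuous_on_mult continuous_on_const continuous_on_diff continuous_on_inner
        continuous_on_fst continuous_on_snd continuous_on_id)
qed auto

lemma shell_potential_eq_radial_pot:
  assumes "0 \<le> s"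
  shows "shell_potential p 1 (s *\<^sub>R b) = radial_pot b p s"
  unfolding radial_pot_def
proof (rule integral_cong_AE)
  show "AE y in unit_shell. norm (s *\<^sub>R b - y) powr p = chord2 s (y \<bullet> b) powr (p / 2)"
    using unit_shell_facts(3)[where 'a='a]
  proof eventually_elim
    case (elim y)
    have "(norm (s *\<^sub>R b - y))\<^sup>2 = chord2 s (y \<bullet> b)"
      by (rule chord2_norm) (use elim b in auto)
    then have "chord2 s (y \<bullet> b) powr (p / 2) = ((norm (s *\<^sub>R b - y))\<^sup>2) powr (p / 2)" by simp
    also have "\<dots> = (norm (s *\<^sub>R b - y) powr 2) powr (p / 2)"
      by simp
    also have "\<dots> = norm (s *\<^sub>R b - y) powr p"
      unfolding powr_powr by simp
    finally show ?case ..
  qed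
qed (simp_all add: measurable_cong_sets[OF unit_shell_facts(2) refl])

text \<open>
  A reflection taking \<open>x\<close> to the ray through \<open>b\<close> leaves the shell invariant.
\<close>

lemma shell_potential_rotation:
  "shell_potential p 1 x = radial_pot b p (norm (x::'a))"
proof -
  obtain f where f: "orthogonal_transformation f" "f x = norm x *\<^sub>R b"
    using householder_reflection[of x "norm x *\<^sub>R b"] b by auto
  have "shell_potential p 1 x = (\<integral>y. norm (norm x *\<^sub>R b - f y) powr p \<partial>unit_shell)"
    using f by (metis (no_types, lifting) linear_diff orthogonal_transformation_linear orthogonal_transformation_norm)
  also have "\<dots> = shell_potential p 1 (norm x *\<^sub>R b)"
    by (rule integral_shell_orthogonal[OF f(1)]) measurable
  finally show ?thesis by (simp add: shell_potential_eq_radial_pot)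
qed

end

section \<open>The Euler--Lagrange condition for shells\<close>

text \<open>
  The radial potentials are differentiable away from \<open>s = 1\<close>, where the point reaches the sphere;
  continuity there is enough for monotonicity arguments.
\<close>

lemma nondecreasing_across_1:
  fixes f f' :: "real \<Rightarrow> real"
  assumes "continuous_on {x..y} f" and "x \<le> y"
    and D: "\<And>s. x < s \<Longrightarrow> s < y \<Longrightarrow> s \<noteq> 1 \<Longrightarrow> (f has_real_derivative f' s) (at s) \<and> 0 \<le> f' s"
  shows "f x \<le> f y"
proof (cases "x < 1 \<and> 1 < y")
  case True
  have "f x \<le> f 1"
  proof (rule DERIV_nonneg_imp_increasing_open[where f=f])
    show "continuous_on {x..1} f" by (rule continuous_on_subset[OF assms(1)]) (use True in auto)
    show "\<exists>d. (f has_real_derivative d) (at s) \<and> 0 \<le> d" if "x < s" "s < 1" for s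
      using D[of s] that True by auto
  qed (use True in simp)
  also have "f 1 \<le> f y"
  proof (rule DERIV_nonneg_imp_increasing_open[where f=f])
    show "continuous_on {1..y} f" by (rule continuous_on_subset[OF assms(1)]) (use True in auto)
    show "\<exists>d. (f has_real_derivative d) (at s) \<and> 0 \<le> d" if "1 < s" "s < y" for s
      using D[of s] that True by auto
  qed (use True in simp)
  finally show ?thesis .
next
  case False
  show ?thesis
  proof (rule DERIV_nonneg_imp_increasing_open[where f=f])
    fix s assume "x < s" "s < y"
    with False D[of s] show "\<exists>d. (f has_real_derivative d) (at s) \<and> 0 \<le> d" by fastforce
  qed (use assms in auto)
qed

context
  fixes b :: "'a::euclidean_space"
  assumes b: "b \<in> Basis" and dim: "DIM('a) \<ge> 2"
begin

interpretation U: prob_space "unit_shell :: 'a measure"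
  by (rule unit_shell_facts)

text \<open>
  The divergence form of the radial Laplacian.
\<close>

lemma weighted_radial_pot1_DERIV:
  assumes "s > 0" "s \<noteq> 1"
  shows "((\<lambda>s. s ^ (DIM('a) - 1) * radial_pot1 b p s) has_real_derivative
      p * (p + real DIM('a) - 2) * s ^ (DIM('a) - 1) * radial_pot b (p - 2) s) (at s)"
proof -
  obtain m where m: "DIM('a) - 1 = Suc m" "real DIM('a) - 1 = real (Suc m)"
    using dim by (cases "DIM('a)"; cases "DIM('a) - 1") auto
  have "((\<lambda>s. s ^ Suc m * radial_pot1 b p s) has_real_derivative
      real (Suc m) * s ^ m * radial_pot1 b p s + radial_pot2 b p s * s ^ Suc m) (at s)"
    by (rule DERIV_mult[OF DERIV_cong[OF DERIV_pow] DERIV_radial_pot1[OF b]]) (use assms in auto)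
  also have "real (Suc m) * s ^ m * radial_pot1 b p s + radial_pot2 b p s * s ^ Suc m
      = s ^ m * (s * radial_pot2 b p s + (real DIM('a) - 1) * radial_pot1 b p s)"
    by (simp add: m(2) algebra_simps)
  also have "\<dots> = s ^ m * (p * (p + real DIM('a) - 2) * s * radial_pot b (p - 2) s)"
    using assms by (subst radial_laplacian[OF b]) auto
  also have "\<dots> = p * (p + real DIM('a) - 2) * s ^ Suc m * radial_pot b (p - 2) s"
    by (simp add: mult_ac)
  finally show ?thesis by (simp only: m(1))
qed

text \<open>
  Inside the sphere, \<open>s ^ (n - 1)\<close> times the derivative vanishes at \<open>0\<close> and is nondecreasing by the divergence
  form, because \<open>p + n - 2 \<ge> 0\<close>. Outside, the integrand itself is nonnegative.
\<close>

lemma radial_pot1_nonneg: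
  assumes "0 < p" "0 < s" "s \<noteq> 1"
  shows "0 \<le> radial_pot1 b p s"
proof (cases "s < 1")
  case True
  have "0 ^ (DIM('a) - 1) * radial_pot1 b p 0 \<le> s ^ (DIM('a) - 1) * radial_pot1 b p s"
  proof (rule DERIV_nonneg_imp_increasing_open[where f="\<lambda>s. s ^ (DIM('a) - 1) * radial_pot1 b p s"])
    show "\<exists>d. ((\<lambda>s. s ^ (DIM('a) - 1) * radial_pot1 b p s) has_real_derivative d) (at x) \<and> 0 \<le> d"
      if "0 < x" "x < s" for x
      using weighted_radial_pot1_DERIV[of x p] that True assms dim radial_pot_nonneg[of b "p - 2" x]
      by (intro exI[of _ "p * (p + real DIM('a) - 2) * x ^ (DIM('a) - 1) * radial_pot b (p - 2) x"] conjI
           mult_nonneg_nonneg) auto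
    show "continuous_on {0..s} (\<lambda>s. s ^ (DIM('a) - 1) * radial_pot1 b p s)"
    proof (intro continuous_intros continuous_at_imp_continuous_on ballI)
      fix x assume "x \<in> {0..s}"
      then show "isCont (radial_pot1 b p) x" using True by (intro DERIV_isCont[OF DERIV_radial_pot1[OF b]]) auto
    qed
  qed (use assms in simp)
  moreover have "DIM('a) - 1 \<noteq> 0" using dim by simp
  ultimately have "0 \<le> s ^ (DIM('a) - 1) * radial_pot1 b p s" by (simp add: power_0_left)
  moreover have "0 < s ^ (DIM('a) - 1)" using assms by simp
  ultimately show ?thesis using mult_pos_neg[of "s ^ (DIM('a) - 1)" "radial_pot1 b p s"] by force
next
  case False
  have "AE y in unit_shell. 0 \<le> p * chord2 s (y \<bullet> b) powr (p / 2 - 1) * (s - y \<bullet> b)"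
    using AE_inner_le1[OF b] by eventually_elim (use False assms in auto)
  then show ?thesis unfolding radial_pot1_def by (rule integral_nonneg_AE)
qed

text \<open>
  Convexity of the potential as a function of \<open>s\<^sup>2\<close>. By the radial Laplacian, the derivative of the quotient is
  \<open>k s / s ^ (n + 1)\<close> with \<open>k\<close> as in the proof. This \<open>k\<close> vanishes at \<open>0\<close>, and its derivative is
  a nonnegative multiple of \<open>s ^ n\<close> times the derivative of the potential with exponent \<open>p - 2\<close>.
\<close>

lemma radial_pot1_over_s_mono:
  assumes p: "2 < p" and xy: "0 < x" "x \<le> y"
  shows "radial_pot1 b p x / x \<le> radial_pot1 b p y / y"
proof -
  define N c where "N = DIM('a) - 1" and "c = p * (p + real DIM('a) - 2)"
  have N: "real DIM('a) = real (Suc N)" "N \<noteq> 0" using dim by (auto simp: N_def)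
  have c0: "0 \<le> c" using p dim by (simp add: c_def)
  \<comment> \<open>\<open>c\<close> is the factor of the radial Laplacian; \<open>Suc N\<close> is the dimension\<close>
  define k where "k = (\<lambda>s. c * (s ^ Suc N * radial_pot b (p - 2) s) - real (Suc N) * (s ^ N * radial_pot1 b p s))"
  have k: "0 \<le> k s" if "0 \<le> s" for s
  proof -
    have "k 0 \<le> k s"
    proof (rule nondecreasing_across_1[where f=k])
      show "continuous_on {0..s} k"
        unfolding k_def using p by (intro continuous_intros continuous_on_radial_pot[OF b] continuous_on_radial_pot1[OF b]) auto
      fix z assume z: "0 < z" "z < s" "z \<noteq> (1::real)"
      have "(k has_real_derivative
          c * (real (Suc N) * z ^ N * radial_pot b (p - 2) z + radial_pot1 b (p - 2) z * z ^ Suc N)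
          - real (Suc N) * (c * z ^ N * radial_pot b (p - 2) z)) (at z)"
        unfolding k_def
      proof (intro DERIV_diff DERIV_cmult)
        show "((\<lambda>s. s ^ Suc N * radial_pot b (p - 2) s) has_real_derivative
            real (Suc N) * z ^ N * radial_pot b (p - 2) z + radial_pot1 b (p - 2) z * z ^ Suc N) (at z)"
          by (rule DERIV_mult[OF DERIV_cong[OF DERIV_pow] DERIV_radial_pot[OF b]]) (use z in auto)
        show "((\<lambda>s. s ^ N * radial_pot1 b p s) has_real_derivative c * z ^ N * radial_pot b (p - 2) z) (at z)"
          using weighted_radial_pot1_DERIV[of z p] z by (simp add: N_def c_def)
      qed
      then have "(k has_real_derivative c * (radial_pot1 b (p - 2) z * z ^ Suc N)) (at z)"
        by (rule DERIV_cong) (simp add: algebra_simps)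
      moreover have "0 \<le> c * (radial_pot1 b (p - 2) z * z ^ Suc N)"
        using c0 z radial_pot1_nonneg[of "p - 2" z] p by simp
      ultimately show "(k has_real_derivative c * (radial_pot1 b (p - 2) z * z ^ Suc N)) (at z)
          \<and> 0 \<le> c * (radial_pot1 b (p - 2) z * z ^ Suc N)" ..
    qed (use that in auto)
    moreover have "k 0 = 0" using N(2) by (simp add: k_def)
    ultimately show ?thesis by simp
  qed
  show ?thesis
  proof (rule nondecreasing_across_1[where f="\<lambda>s. radial_pot1 b p s / s"])
    show "continuous_on {x..y} (\<lambda>s. radial_pot1 b p s / s)"
      using p xy by (intro continuous_intros continuous_on_radial_pot1[OF b]) auto
    fix z assume z: "x < z" "z < y" "z \<noteq> 1"
    then have z0: "0 < z" using xy by simp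
    have D: "((\<lambda>s. radial_pot1 b p s / s) has_real_derivative (radial_pot2 b p z * z - radial_pot1 b p z * 1) / (z * z)) (at z)"
      by (rule DERIV_divide[OF DERIV_radial_pot1[OF b] DERIV_ident]) (use z z0 in auto)
    have "z * radial_pot2 b p z = c * z * radial_pot b (p - 2) z - real N * radial_pot1 b p z"
      using radial_laplacian[OF b, of z p] z z0 N(1) by (simp add: c_def)
    then have "z ^ N * (radial_pot2 b p z * z - radial_pot1 b p z * 1)
        = z ^ N * (c * z * radial_pot b (p - 2) z - real N * radial_pot1 b p z - radial_pot1 b p z)"
      by (simp add: mult.commute[of _ z])
    also have "\<dots> = k z" by (simp add: k_def algebra_simps)
    finally have "0 \<le> z ^ N * (radial_pot2 b p z * z - radial_pot1 b p z * 1)" using k[of z] z0 by simp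
    moreover have "0 < z ^ N" using z0 by simp
    ultimately have "0 \<le> radial_pot2 b p z * z - radial_pot1 b p z * 1"
      using mult_pos_neg[of "z ^ N" "radial_pot2 b p z * z - radial_pot1 b p z * 1"] by force
    with D z0 show "((\<lambda>s. radial_pot1 b p s / s) has_real_derivative (radial_pot2 b p z * z - radial_pot1 b p z * 1) / (z * z)) (at z)
        \<and> 0 \<le> (radial_pot2 b p z * z - radial_pot1 b p z * 1) / (z * z)"
      by (intro conjI divide_nonneg_nonneg) auto
  qed (use xy in auto)
qed

text \<open>
  The right-hand side has slope \<open>s * (q s - q 1)\<close> at \<open>s\<close>, where \<open>q s = radial_pot1 b p s / s\<close> is nondecreasing.
\<close>

lemma radial_pot_minus_square_min:
  assumes p: "2 < p" and s: "0 \<le> s"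
  shows "radial_pot b p 1 - radial_pot1 b p 1 / 2 \<le> radial_pot b p s - radial_pot1 b p 1 / 2 * s\<^sup>2"
proof -
  define V where "V = (\<lambda>s. radial_pot b p s - radial_pot1 b p 1 / 2 * s\<^sup>2)"
  have D: "(V has_real_derivative radial_pot1 b p z - radial_pot1 b p 1 * z) (at z)" if "0 < z" "z \<noteq> 1" for z
    unfolding V_def using that
    by (intro DERIV_diff DERIV_radial_pot[OF b]) (auto intro!: derivative_eq_intros)
  have C: "continuous_on {x..y} V" for x y
    unfolding V_def using p by (intro continuous_intros continuous_on_radial_pot[OF b]) auto
  have "V 1 \<le> V s"
  proof (cases "s \<le> 1")
    case True
    show ?thesis
    proof (rule DERIV_nonpos_imp_decreasing_open[where f=V, OF True _ C])
      fix z assume z: "s < z" "z < 1"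
      then have z0: "0 < z" using s by simp
      have "radial_pot1 b p z - radial_pot1 b p 1 * z \<le> 0"
        using radial_pot1_over_s_mono[OF p z0, of 1] z z0 by (simp add: divide_le_eq)
      with D[OF z0] z show "\<exists>d. (V has_real_derivative d) (at z) \<and> d \<le> 0" by auto
    qed
  next
    case False
    show ?thesis
    proof (rule DERIV_nonneg_imp_increasing_open[where f=V, OF _ _ C])
      fix z assume z: "1 < z" "z < s"
      have "0 \<le> radial_pot1 b p z - radial_pot1 b p 1 * z"
        using radial_pot1_over_s_mono[OF p, of 1 z] z by (simp add: le_divide_eq)
      with D[of z] z show "\<exists>d. (V has_real_derivative d) (at z) \<and> 0 \<le> d" by auto
    qed (use False in simp)
  qed
  then show ?thesis by (simp add: V_def)
qed

text \<open>
  The potential is \<open>1\<close> at the centre and at least \<open>1 + p / 2\<close> on the sphere: the squared distance between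
  two independent points of the sphere has mean \<open>2\<close>, and Bernoulli's inequality applies. If the slope at
  \<open>s = 1\<close> were not positive, the preceding minimality would make the value at the centre at least the value on the sphere.
\<close>

lemma radial_pot1_1_pos:
  assumes p: "2 < p"
  shows "0 < radial_pot1 b p 1"
proof -
  have "radial_pot b p 0 = 1" by (simp add: radial_pot_def chord2_def U.prob_space)
  moreover have "1 + p / 2 \<le> radial_pot b p 1"
  proof -
    have i: "integrable unit_shell (\<lambda>y. y \<bullet> b)"
      by (rule integrable_shell_inner[OF b, of "\<lambda>t. t"]) (auto intro: continuous_intros)
    have "orthogonal_transformation (\<lambda>y::'a. - y)"
      by (simp add: orthogonal_transformation_neg orthogonal_transformation_id)
    from integral_shell_orthogonal[OF this, of "\<lambda>y. y \<bullet> b" 1]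
    have z: "(\<integral>y. y \<bullet> b \<partial>unit_shell) = 0" by simp
    have "1 + p / 2 = (\<integral>y. 1 + p / 2 * (1 - 2 * (y \<bullet> b)) \<partial>unit_shell)"
      using i by (simp add: z U.prob_space)
    also have "\<dots> \<le> radial_pot b p 1"
      unfolding radial_pot_def
    proof (rule integral_mono_AE)
      show "integrable unit_shell (\<lambda>y. chord2 1 (y \<bullet> b) powr (p / 2))"
      proof (rule integrable_shell_inner[OF b])
        show "continuous_on {-1..1} (\<lambda>t. chord2 1 t powr (p / 2))"
        proof (rule continuous_on_powr')
          show "\<forall>t\<in>{-1..1}. 0 \<le> chord2 1 t \<and> (chord2 1 t = 0 \<longrightarrow> 0 < p / 2)"
            using chord2_nonneg[of _ 1] p by (auto simp: abs_le_iff)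
        qed (intro continuous_intros)+
      qed measurable
      show "AE y in unit_shell. 1 + p / 2 * (1 - 2 * (y \<bullet> b)) \<le> chord2 1 (y \<bullet> b) powr (p / 2)"
        using AE_inner_le1[OF b]
      proof eventually_elim
        case (elim y)
        have "1 + p / 2 * (chord2 1 (y \<bullet> b) - 1) \<le> (1 + (chord2 1 (y \<bullet> b) - 1)) powr (p / 2)"
        proof (cases "chord2 1 (y \<bullet> b) = 0")
          case True
          then show ?thesis using p by simp
        next
          case False
          then have w: "0 < chord2 1 (y \<bullet> b)" using chord2_nonneg[OF elim, of 1] by simp
          define w where "w = chord2 1 (y \<bullet> b)"
          have w0: "0 < w" using w by (simp add: w_def)
          have "(w powr (p / 2)) powr (2 / p) * 1 powr (1 - 2 / p) \<le> 2 / p * w powr (p / 2) + (1 - 2 / p) * 1"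
            using p w0 by (intro Youngs_inequality_0) auto
          then have "w \<le> 2 / p * w powr (p / 2) + (1 - 2 / p)"
            using p w0 by (simp add: powr_powr)
          then have "p / 2 * w \<le> p / 2 * (2 / p * w powr (p / 2) + (1 - 2 / p))"
            using p by (intro mult_left_mono) auto
          also have "\<dots> = w powr (p / 2) + (p / 2 - 1)"
            using p by (simp add: field_simps)
          finally show ?thesis unfolding w_def[symmetric] by (simp add: algebra_simps diff_divide_distrib)
        qed
        then show ?case by (simp add: chord2_def)
      qed
    qed (use i in simp)
    finally show ?thesis .
  qed
  moreover have "radial_pot b p 1 - radial_pot1 b p 1 / 2 \<le> radial_pot b p 0"
    using radial_pot_minus_square_min[OF p, of 0] by simp
  ultimately show ?thesis using p by simp
qed

end

lemma unit_shell_Euler_Lagrange: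
  assumes dim: "DIM('a::euclidean_space) \<ge> 2" and p: "2 < p"
  obtains \<Lambda> c :: real where "0 < \<Lambda>"
    and "\<And>x::'a. c + \<Lambda> / 2 * (norm x)\<^sup>2 \<le> shell_potential p 1 x"
    and "\<And>x::'a. norm x = 1 \<Longrightarrow> shell_potential p 1 x = c + \<Lambda> / 2"
proof -
  obtain b :: 'a where b: "b \<in> Basis" using nonempty_Basis by blast
  show ?thesis
  proof (rule that[of "radial_pot1 b p 1" "radial_pot b p 1 - radial_pot1 b p 1 / 2"])
    show "0 < radial_pot1 b p 1" by (rule radial_pot1_1_pos[OF b dim p])
    show "radial_pot b p 1 - radial_pot1 b p 1 / 2 + radial_pot1 b p 1 / 2 * (norm x)\<^sup>2 \<le> shell_potential p 1 x" for x :: 'a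
      using radial_pot_minus_square_min[OF b dim p, of "norm x"] by (simp add: shell_potential_rotation[OF b])
    show "shell_potential p 1 x = radial_pot b p 1 - radial_pot1 b p 1 / 2 + radial_pot1 b p 1 / 2" if "norm x = 1" for x :: 'a
      using that by (simp add: shell_potential_rotation[OF b])
  qed
qed

text \<open>
  Scaling the unit shell by \<open>r\<close> multiplies the constant \<open>\<Lambda>\<close> of the preceding lemma by \<open>r powr (p - 2)\<close>; the radius
  is the one for which the result is \<open>p\<close>. Then the potential of the shell at the exponents \<open>(p, 2)\<close>, which is
  the right-hand integral divided by \<open>p\<close> minus \<open>(norm x)\<^sup>2 / 2\<close> up to a constant, is minimal on the shell.
\<close>

lemma shell_Euler_Lagrange:
  assumes dim: "DIM('a::euclidean_space) \<ge> 2" and p: "2 < p"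
  obtains r c :: real where "0 < r"
    and "\<And>x::'a. c + p / 2 * (norm x)\<^sup>2 \<le> shell_potential p r x"
    and "\<And>x::'a. norm x = r \<Longrightarrow> shell_potential p r x = c + p / 2 * r\<^sup>2"
proof -
  obtain \<Lambda> c where \<Lambda>: "0 < \<Lambda>"
    and le: "\<And>x::'a. c + \<Lambda> / 2 * (norm x)\<^sup>2 \<le> shell_potential p 1 x"
    and eq: "\<And>x::'a. norm x = 1 \<Longrightarrow> shell_potential p 1 x = c + \<Lambda> / 2"
    using unit_shell_Euler_Lagrange[OF dim p] by metis
  define r where "r = (p / \<Lambda>) powr (1 / (p - 2))"
  have r: "0 < r" using p \<Lambda> by (simp add: r_def)
  have "r powr (p - 2) = p / \<Lambda>"
    unfolding r_def powr_powr using p \<Lambda> by simp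
  moreover have "r powr p = r powr (p - 2) * r powr 2" unfolding powr_add[symmetric] by simp
  ultimately have ra: "r powr p * \<Lambda> = p * r\<^sup>2" using r \<Lambda> by simp
  have pot: "shell_potential p r x
      = r powr p * shell_potential p 1 ((1 / r) *\<^sub>R x)" for x :: 'a
  proof -
    have sets1: "sets (unit_shell :: 'a measure) = sets borel" by (simp add: spherical_shell_def)
    note [measurable_cong] = sets1
    have "shell_potential p r x
        = (\<integral>y. norm (x - y) powr p \<partial>distr unit_shell borel (\<lambda>x. r *\<^sub>R x))"
      by (subst spherical_shell_scale) (rule refl)
    also have "\<dots> = (\<integral>y. norm (x - r *\<^sub>R y) powr p \<partial>unit_shell)"
      by (rule integral_distr) measurable
    also have "\<dots> = (\<integral>y. r powr p * norm ((1 / r) *\<^sub>R x - y) powr p \<partial>unit_shell)"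
    proof (rule Bochner_Integration.integral_cong[OF refl])
      fix y :: 'a
      have "x - r *\<^sub>R y = r *\<^sub>R ((1 / r) *\<^sub>R x - y)" using r by (simp add: scaleR_diff_right)
      then have "norm (x - r *\<^sub>R y) = r * norm ((1 / r) *\<^sub>R x - y)" using r by simp
      then show "norm (x - r *\<^sub>R y) powr p = r powr p * norm ((1 / r) *\<^sub>R x - y) powr p"
        by (simp only: powr_mult)
    qed
    finally show ?thesis by simp
  qed
  show ?thesis
  proof (rule that[OF r, of "r powr p * c"])
    fix x :: 'a
    have e: "r powr p * (c + \<Lambda> / 2 * (norm x)\<^sup>2 / r\<^sup>2) = r powr p * c + p / 2 * (norm x)\<^sup>2"
    proof -
      have "r powr p * (c + \<Lambda> / 2 * (norm x)\<^sup>2 / r\<^sup>2) = r powr p * c + (r powr p * \<Lambda>) / 2 * (norm x)\<^sup>2 / r\<^sup>2"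
        by (simp add: distrib_left)
      also have "\<dots> = r powr p * c + p / 2 * (norm x)\<^sup>2" unfolding ra using r by simp
      finally show ?thesis .
    qed
    have n: "(norm ((1 / r) *\<^sub>R x))\<^sup>2 = (norm x)\<^sup>2 / r\<^sup>2" by (simp add: power_divide)
    have "r powr p * (c + \<Lambda> / 2 * (norm x)\<^sup>2 / r\<^sup>2) \<le> shell_potential p r x"
      unfolding pot using le[of "(1 / r) *\<^sub>R x"] unfolding n by (intro mult_left_mono) auto
    then show "r powr p * c + p / 2 * (norm x)\<^sup>2 \<le> shell_potential p r x"
      unfolding e .
    assume x: "norm x = r"
    have "shell_potential p r x = r powr p * (c + \<Lambda> / 2)"
      unfolding pot using r x by (subst eq) auto
    then show "shell_potential p r x = r powr p * c + p / 2 * r\<^sup>2"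
      using e x r by simp
  qed
qed

section \<open>Pair integrals of measures with finite moments\<close>

definition moment_class :: "real \<Rightarrow> 'a::euclidean_space measure set" where
  "moment_class p = {\<mu> \<in> prob_measures. integrable \<mu> (\<lambda>x. norm x powr p)}"

definition pair_int :: "(real \<Rightarrow> real) \<Rightarrow> 'a::euclidean_space measure \<Rightarrow> 'a measure \<Rightarrow> real" where
  "pair_int f \<mu> \<nu> = (\<integral>z. f (norm (fst z - snd z)) \<partial>(\<mu> \<Otimes>\<^sub>M \<nu>))"

definition pair_integrable :: "(real \<Rightarrow> real) \<Rightarrow> 'a::euclidean_space measure \<Rightarrow> 'a measure \<Rightarrow> bool" where
  "pair_integrable f \<mu> \<nu> = integrable (\<mu> \<Otimes>\<^sub>M \<nu>) (\<lambda>z. f (norm (fst z - snd z)))"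

lemma moment_classD:
  assumes "\<mu> \<in> moment_class p"
  shows "prob_space \<mu>" "sets \<mu> = sets borel" "integrable \<mu> (\<lambda>x. norm x powr p)"
  using assms by (auto simp: moment_class_def prob_measures_def)

abbreviation second_moment :: "'a::euclidean_space measure \<Rightarrow> real" where
  "second_moment \<mu> \<equiv> \<integral>x. (norm x)\<^sup>2 \<partial>\<mu>"

lemma pair_int_linear:
  assumes "pair_integrable f \<mu> \<nu>" "pair_integrable g \<mu> \<nu>"
  shows "pair_integrable (\<lambda>d. a * f d + c * g d) \<mu> \<nu>"
    and "pair_int (\<lambda>d. a * f d + c * g d) \<mu> \<nu> = a * pair_int f \<mu> \<nu> + c * pair_int g \<mu> \<nu>"
  using assms by (simp_all add: pair_int_def pair_integrable_def)

lemma powr_le_1_plus: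
  fixes x :: real
  assumes "0 \<le> x" "0 \<le> p" "p \<le> q"
  shows "x powr p \<le> 1 + x powr q"
proof (cases "x \<le> 1")
  case True
  then have "x powr p \<le> 1" using assms by (intro powr_le1) auto
  then show ?thesis by (simp add: add_increasing2)
next
  case False
  then have "x powr p \<le> x powr q" using assms by (intro powr_mono) auto
  then show ?thesis by simp
qed

lemma norm_diff_powr_le:
  fixes x y :: "'a::real_normed_vector"
  assumes "0 \<le> p"
  shows "norm (x - y) powr p \<le> 2 powr p * (norm x powr p + norm y powr p)"
proof -
  define m where "m = max (norm x) (norm y)"
  have "norm (x - y) \<le> norm x + norm y" by (rule norm_triangle_ineq4)
  also have "\<dots> \<le> 2 * m" by (simp add: m_def)
  finally have "norm (x - y) powr p \<le> (2 * m) powr p" using assms by (intro powr_mono2) auto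
  also have "\<dots> = 2 powr p * m powr p" by (rule powr_mult)
  also have "\<dots> \<le> 2 powr p * (norm x powr p + norm y powr p)"
    by (intro mult_left_mono) (auto simp: m_def max_def)
  finally show ?thesis .
qed

lemma integrable_pair_first:
  fixes f :: "'a \<Rightarrow> real"
  assumes "prob_space \<mu>" "prob_space \<nu>" "integrable \<mu> f"
  shows "integrable (\<mu> \<Otimes>\<^sub>M \<nu>) (\<lambda>z. f (fst z))" "(\<integral>z. f (fst z) \<partial>(\<mu> \<Otimes>\<^sub>M \<nu>)) = (\<integral>x. f x \<partial>\<mu>)"
proof -
  interpret \<nu>: prob_space \<nu> by fact
  interpret \<mu>: prob_space \<mu> by fact
  interpret P: pair_prob_space \<mu> \<nu> ..
  have d: "distr (\<mu> \<Otimes>\<^sub>M \<nu>) \<mu> fst = \<mu>" by (rule \<nu>.distr_pair_fst)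
  show "integrable (\<mu> \<Otimes>\<^sub>M \<nu>) (\<lambda>z. f (fst z))"
    using assms(3) integrable_distr[of fst "\<mu> \<Otimes>\<^sub>M \<nu>" \<mu> f] by (simp add: d)
  show "(\<integral>z. f (fst z) \<partial>(\<mu> \<Otimes>\<^sub>M \<nu>)) = (\<integral>x. f x \<partial>\<mu>)"
    using integral_distr[of fst "\<mu> \<Otimes>\<^sub>M \<nu>" \<mu> f] assms(3) by (simp add: d)
qed

lemma integrable_pair_second:
  fixes f :: "'a \<Rightarrow> real"
  assumes "prob_space \<mu>" "prob_space \<nu>" "integrable \<nu> f"
  shows "integrable (\<mu> \<Otimes>\<^sub>M \<nu>) (\<lambda>z. f (snd z))" "(\<integral>z. f (snd z) \<partial>(\<mu> \<Otimes>\<^sub>M \<nu>)) = (\<integral>x. f x \<partial>\<nu>)"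
proof -
  interpret \<nu>: prob_space \<nu> by fact
  interpret \<mu>: prob_space \<mu> by fact
  interpret P: pair_sigma_finite \<mu> \<nu> ..
  have i: "integrable (\<nu> \<Otimes>\<^sub>M \<mu>) (\<lambda>z. f (fst z))" and e: "(\<integral>z. f (fst z) \<partial>(\<nu> \<Otimes>\<^sub>M \<mu>)) = (\<integral>x. f x \<partial>\<nu>)"
    using integrable_pair_first[OF assms(2,1,3)] by auto
  have [measurable]: "f \<in> borel_measurable \<nu>" using assms(3) by simp
  show "integrable (\<mu> \<Otimes>\<^sub>M \<nu>) (\<lambda>z. f (snd z))"
    using P.integrable_product_swap_iff[of "\<lambda>z. f (snd z)"] i by (simp add: case_prod_unfold)
  show "(\<integral>z. f (snd z) \<partial>(\<mu> \<Otimes>\<^sub>M \<nu>)) = (\<integral>x. f x \<partial>\<nu>)"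
    using P.integral_product_swap[of "\<lambda>z. f (snd z)"] e by (simp add: case_prod_unfold)
qed

lemma pair_integrable_powr:
  assumes "\<mu> \<in> moment_class p" "\<nu> \<in> moment_class p" "0 \<le> q" "q \<le> p"
  shows "pair_integrable (\<lambda>d. d powr q) \<mu> \<nu>"
  unfolding pair_integrable_def
proof (rule Bochner_Integration.integrable_bound)
  note [measurable_cong] = moment_classD(2)[OF assms(1)] moment_classD(2)[OF assms(2)]
  interpret \<mu>: prob_space \<mu> using moment_classD(1)[OF assms(1)] .
  interpret \<nu>: prob_space \<nu> using moment_classD(1)[OF assms(2)] .
  interpret P: pair_prob_space \<mu> \<nu> ..
  show "integrable (\<mu> \<Otimes>\<^sub>M \<nu>) (\<lambda>z. 1 + 2 powr p * (norm (fst z) powr p + norm (snd z) powr p))"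
    using integrable_pair_first[OF \<mu>.prob_space_axioms \<nu>.prob_space_axioms moment_classD(3)[OF assms(1)]]
      integrable_pair_second[OF \<mu>.prob_space_axioms \<nu>.prob_space_axioms moment_classD(3)[OF assms(2)]]
    by simp
  show "(\<lambda>z. norm (fst z - snd z) powr q) \<in> borel_measurable (\<mu> \<Otimes>\<^sub>M \<nu>)" by measurable
  show "AE z in \<mu> \<Otimes>\<^sub>M \<nu>. norm (norm (fst z - snd z) powr q)
      \<le> norm (1 + 2 powr p * (norm (fst z) powr p + norm (snd z) powr p))"
  proof (rule AE_I2)
    fix z :: "'a \<times> 'a"
    have "norm (fst z - snd z) powr p \<le> 2 powr p * (norm (fst z) powr p + norm (snd z) powr p)"
      using assms by (intro norm_diff_powr_le) auto
    moreover have "norm (fst z - snd z) powr q \<le> 1 + norm (fst z - snd z) powr p"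
      using assms by (intro powr_le_1_plus) auto
    ultimately show "norm (norm (fst z - snd z) powr q)
        \<le> norm (1 + 2 powr p * (norm (fst z) powr p + norm (snd z) powr p))"
      by simp
  qed
qed

lemma moment_class_lower:
  assumes "\<mu> \<in> moment_class p" "0 \<le> q" "q \<le> p"
  shows "integrable \<mu> (\<lambda>x. norm x powr q)"
proof (rule Bochner_Integration.integrable_bound)
  note [measurable_cong] = moment_classD(2)[OF assms(1)]
  interpret \<mu>: prob_space \<mu> using moment_classD(1)[OF assms(1)] .
  show "integrable \<mu> (\<lambda>x. 1 + norm x powr p)" using moment_classD(3)[OF assms(1)] by simp
  show "AE x in \<mu>. norm (norm x powr q) \<le> norm (1 + norm x powr p)"
    using assms powr_le_1_plus[OF norm_ge_zero] by (intro AE_I2) auto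
qed (use moment_classD(2)[OF assms(1)] in measurable)

lemma moment_class_mean:
  assumes "\<mu> \<in> moment_class p" "1 \<le> p"
  shows "integrable \<mu> (\<lambda>x. x)"
proof (rule Bochner_Integration.integrable_bound)
  note [measurable_cong] = moment_classD(2)[OF assms(1)]
  show "integrable \<mu> (\<lambda>x. norm x powr 1)" by (rule moment_class_lower[OF assms(1)]) (use assms in auto)
  show "(\<lambda>x. x) \<in> borel_measurable \<mu>" by measurable
qed simp

section \<open>Powers of the distance as mixtures of Gaussian kernels\<close>

lemma exp_remainder_bounds:
  fixes u :: real
  assumes "0 \<le> u"
  shows "0 \<le> exp (- u) - 1 + u" "exp (- u) - 1 + u \<le> u" "exp (- u) - 1 + u \<le> u\<^sup>2"
proof -
  show "0 \<le> exp (- u) - 1 + u" using exp_ge_add_one_self[of "- u"] by simp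
  show "exp (- u) - 1 + u \<le> u" using assms by simp
  have "exp (- u) \<le> 1 / (1 + u)"
    using exp_ge_add_one_self[of u] assms by (simp add: exp_minus inverse_eq_divide frac_le)
  also have "\<dots> \<le> 1 - u + u\<^sup>2"
  proof -
    have "(1 - u + u\<^sup>2) * (1 + u) = 1 + u * u\<^sup>2" by (simp add: algebra_simps power2_eq_square)
    then show ?thesis using assms by (simp add: pos_divide_le_eq)
  qed
  finally show "exp (- u) - 1 + u \<le> u\<^sup>2" by simp
qed

text \<open>
  The remainder of \<open>exp (- u)\<close> after its linear Taylor polynomial, at \<open>u = t * d\<^sup>2\<close>: subtracting \<open>1 - u\<close> makes
  the integral over \<open>t\<close> in \<open>powr_gaussian_mixture\<close> converge at \<open>0\<close>.
\<close>

definition gauss_remainder :: "real \<Rightarrow> real \<Rightarrow> real" where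
  "gauss_remainder t d = exp (- (t * d\<^sup>2)) - 1 + t * d\<^sup>2"

lemma gauss_remainder_nonneg: "0 \<le> t \<Longrightarrow> 0 \<le> gauss_remainder t d"
  unfolding gauss_remainder_def by (rule exp_remainder_bounds) simp

abbreviation remainder_mixture :: "real \<Rightarrow> real \<Rightarrow> ennreal" where
  "remainder_mixture p d \<equiv>
    \<integral>\<^sup>+t. ennreal (gauss_remainder t d * t powr (-1 - p / 2) * indicator {0<..} t) \<partial>lborel"

text \<open>
  The substitution \<open>u = t * d\<^sup>2\<close> produces the factor \<open>d powr p\<close>. The integral for \<open>d = 1\<close> converges because the remainder is at most
  \<open>t\<^sup>2\<close> near \<open>0\<close>, where \<open>p < 4\<close> is used, and at most \<open>t\<close> near infinity, where \<open>p > 2\<close> is used.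
\<close>

lemma powr_gaussian_mixture:
  assumes p: "2 < p" "p < 4"
  obtains C :: real where "0 < C"
    and "\<And>d. 0 \<le> d \<Longrightarrow> remainder_mixture p d
            = ennreal (C * d powr p)"
proof -
  define F where "F = (\<lambda>d t. gauss_remainder t d * t powr (-1 - p / 2) * indicator {0<..} t)"
  have [measurable]: "F d \<in> borel_measurable borel" for d unfolding F_def gauss_remainder_def by measurable
  have F0: "0 \<le> F d t" for d t unfolding F_def using gauss_remainder_nonneg[of t d] by (auto simp: indicator_def)
  define I where "I = (\<integral>\<^sup>+t. ennreal (F 1 t) \<partial>lborel)"
  have "I \<le> (\<integral>\<^sup>+t. ennreal (t powr (1 - p / 2)) * indicator {0..1} t + ennreal (t powr (- p / 2)) * indicator {1..} t \<partial>lborel)"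
    unfolding I_def
  proof (rule nn_integral_mono)
    fix t :: real
    show "ennreal (F 1 t) \<le> ennreal (t powr (1 - p / 2)) * indicator {0..1} t + ennreal (t powr (- p / 2)) * indicator {1..} t"
    proof (cases "0 < t")
      case False
      then show ?thesis by (simp add: F_def)
    next
      case True
      have le: "F 1 t \<le> t powr (1 - p / 2)"
      proof -
        have "F 1 t \<le> t\<^sup>2 * t powr (-1 - p / 2)"
          using exp_remainder_bounds(3)[of t] True by (simp add: F_def gauss_remainder_def mult_right_mono)
        also have "\<dots> = t powr 2 * t powr (-1 - p / 2)" using True by simp
        also have "\<dots> = t powr (1 - p / 2)" unfolding powr_add[symmetric] by simp
        finally show ?thesis .
      qed
      have le': "F 1 t \<le> t powr (- p / 2)"
      proof -
        have "F 1 t \<le> t * t powr (-1 - p / 2)"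
          using exp_remainder_bounds(2)[of t] True by (simp add: F_def gauss_remainder_def mult_right_mono)
        also have "\<dots> = t powr 1 * t powr (-1 - p / 2)" using True by simp
        also have "\<dots> = t powr (- p / 2)" unfolding powr_add[symmetric] by simp
        finally show ?thesis .
      qed
      show ?thesis
      proof (cases "t \<le> 1")
        case True
        then show ?thesis using \<open>0 < t\<close> ennreal_leI[OF le] by (simp add: add_increasing2)
      next
        case False
        then show ?thesis using ennreal_leI[OF le'] by simp
      qed
    qed
  qed
  also have "\<dots> = (\<integral>\<^sup>+t. ennreal (t powr (1 - p / 2)) * indicator {0..1} t \<partial>lborel)
      + (\<integral>\<^sup>+t. ennreal (t powr (- p / 2)) * indicator {1..} t \<partial>lborel)"
    by (rule nn_integral_add) auto
  also have "\<dots> < \<infinity>"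
  proof -
    have 1: "((\<lambda>t::real. t powr (1 - p / 2)) has_integral (1 powr (1 - p / 2 + 1) / (1 - p / 2 + 1))) {0..1}"
      by (rule has_integral_powr_from_0) (use p in auto)
    have 2: "((\<lambda>t::real. t powr (- p / 2)) has_integral (- (1 powr (- p / 2 + 1)) / (- p / 2 + 1))) {1..}"
      by (rule has_integral_powr_to_inf) (use p in auto)
    show ?thesis
      using nn_integral_has_integral_lebesgue'[OF _ 1] nn_integral_has_integral_lebesgue'[OF _ 2]
      by simp
  qed
  finally have fin: "I < \<infinity>" .
  have pos: "0 < I"
  proof -
    \<comment> \<open>a lower bound for the integrand on \<open>{1..2}\<close>, where \<open>gauss_remainder t 1 \<ge> exp (- t)\<close>\<close>
    define c where "c = exp (- 2) * 2 powr (-1 - p / 2)"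
    have "ennreal c = (\<integral>\<^sup>+t. ennreal c * indicator {1..2::real} t \<partial>lborel)"
      by (simp add: nn_integral_cmult_indicator)
    also have "\<dots> \<le> I"
      unfolding I_def
    proof (rule nn_integral_mono)
      fix t :: real
      show "ennreal c * indicator {1..2} t \<le> ennreal (F 1 t)"
      proof (cases "t \<in> {1..2}")
        case True
        have "exp (- 2) * 2 powr (-1 - p / 2) \<le> gauss_remainder t 1 * t powr (-1 - p / 2)"
        proof (intro mult_mono)
          show "exp (- 2) \<le> gauss_remainder t 1" using True exp_le_cancel_iff[of "-2" "-t"] by (simp add: gauss_remainder_def del: exp_le_cancel_iff)
          show "2 powr (-1 - p / 2) \<le> t powr (-1 - p / 2)"
            using True p by (intro powr_mono2') auto
        qed (use True gauss_remainder_nonneg[of t 1] in auto)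
        then show ?thesis using True by (simp add: F_def c_def ennreal_leI)
      qed simp
    qed
    finally show ?thesis by (rule less_le_trans[rotated]) (simp add: c_def)
  qed
  have scale: "(\<integral>\<^sup>+t. ennreal (F d t) \<partial>lborel) = ennreal (d powr p) * I" if "0 < d" for d
  proof -
    have "(\<integral>\<^sup>+t. ennreal (F d t) \<partial>lborel) = \<bar>1 / d\<^sup>2\<bar> * (\<integral>\<^sup>+u. ennreal (F d (0 + 1 / d\<^sup>2 * u)) \<partial>lborel)"
      by (rule nn_integral_real_affine) (use that in auto)
    also have "(\<integral>\<^sup>+u. ennreal (F d (0 + 1 / d\<^sup>2 * u)) \<partial>lborel) = (\<integral>\<^sup>+u. ennreal (d powr (2 + p)) * ennreal (F 1 u) \<partial>lborel)"
    proof (rule nn_integral_cong)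
      fix u :: real
      have "F d (1 / d\<^sup>2 * u) = d powr (2 + p) * F 1 u"
      proof (cases "0 < u")
        case True
        have "1 / d\<^sup>2 = d powr (-2)" using that by (simp add: powr_minus_divide)
        then have "(1 / d\<^sup>2 * u) powr (-1 - p / 2) = (d powr (-2)) powr (-1 - p / 2) * u powr (-1 - p / 2)"
          by (simp only: powr_mult)
        also have "(d powr (-2)) powr (-1 - p / 2) = d powr (2 + p)"
          unfolding powr_powr by (simp add: add.commute)
        finally show ?thesis using True that by (simp add: F_def gauss_remainder_def)
      next
        case False
        then show ?thesis using that by (simp add: F_def zero_less_mult_iff zero_less_divide_iff)
      qed
      then show "ennreal (F d (0 + 1 / d\<^sup>2 * u)) = ennreal (d powr (2 + p)) * ennreal (F 1 u)"
        by (simp add: ennreal_mult' F0)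
    qed
    also have "\<dots> = ennreal (d powr (2 + p)) * I"
      unfolding I_def by (rule nn_integral_cmult) simp
    also have "ennreal \<bar>1 / d\<^sup>2\<bar> * (ennreal (d powr (2 + p)) * I) = ennreal (d powr p) * I"
    proof -
      have "\<bar>1 / d\<^sup>2\<bar> * d powr (2 + p) = d powr p"
        using that by (simp add: powr_add)
      then have "ennreal \<bar>1 / d\<^sup>2\<bar> * ennreal (d powr (2 + p)) = ennreal (d powr p)"
        by (subst ennreal_mult'[symmetric]) auto
      then show ?thesis by (simp add: mult.assoc[symmetric])
    qed
    finally show ?thesis .
  qed
  show ?thesis
  proof (rule that[of "enn2real I"])
    show "0 < enn2real I" using fin pos by (simp add: enn2real_positive_iff)
    fix d :: real assume "0 \<le> d"
    show "remainder_mixture p d = ennreal (enn2real I * d powr p)"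
    proof (cases "d = 0")
      case True
      then show ?thesis by (simp add: gauss_remainder_def)
    next
      case False
      then show ?thesis
        using scale[of d] \<open>0 \<le> d\<close> fin by (simp add: F_def ennreal_mult' mult.commute)
    qed
  qed
qed

lemma has_bochner_integral_gauss_remainder_mixture:
  assumes \<mu>: "\<mu> \<in> moment_class p" and \<nu>: "\<nu> \<in> moment_class p" and p: "2 < p"
    and C: "0 < C" "\<And>d. 0 \<le> d \<Longrightarrow>
      remainder_mixture p d = ennreal (C * d powr p)"
  shows "has_bochner_integral lborel
      (\<lambda>t. pair_int (gauss_remainder t) \<mu> \<nu> * t powr (-1 - p / 2) * indicator {0<..} t) (C * pair_int (\<lambda>d. d powr p) \<mu> \<nu>)"
proof -
  let ?h = "\<lambda>t z. ennreal (gauss_remainder t (norm (fst z - snd z)) * t powr (-1 - p / 2) * indicator {0<..} t)" and ?k = "\<lambda>t. pair_int (gauss_remainder t) \<mu> \<nu> * t powr (-1 - p / 2) * indicator {0<..} t"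
  note [measurable_cong] = moment_classD(2)[OF \<mu>] moment_classD(2)[OF \<nu>]
  interpret \<mu>: prob_space \<mu> using moment_classD(1)[OF \<mu>] .
  interpret \<nu>: prob_space \<nu> using moment_classD(1)[OF \<nu>] .
  interpret P: pair_prob_space \<mu> \<nu> ..
  interpret Q: pair_sigma_finite lborel "\<mu> \<Otimes>\<^sub>M \<nu>" ..
  have [measurable]: "(\<lambda>z. gauss_remainder (fst z) (norm (fst (snd z) - snd (snd z)))) \<in> borel_measurable (lborel \<Otimes>\<^sub>M (\<mu> \<Otimes>\<^sub>M \<nu>))"
    unfolding gauss_remainder_def by measurable
  have sq: "integrable (\<mu> \<Otimes>\<^sub>M \<nu>) (\<lambda>z. (norm (fst z - snd z))\<^sup>2)"
    using pair_integrable_powr[OF \<mu> \<nu>, of 2] p by (simp add: pair_integrable_def)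
  have int: "integrable (\<mu> \<Otimes>\<^sub>M \<nu>) (\<lambda>z. gauss_remainder t (norm (fst z - snd z)))" if "0 \<le> t" for t
  proof (rule Bochner_Integration.integrable_bound)
    show "integrable (\<mu> \<Otimes>\<^sub>M \<nu>) (\<lambda>z. t * (norm (fst z - snd z))\<^sup>2)" using sq by simp
    show "(\<lambda>z. gauss_remainder t (norm (fst z - snd z))) \<in> borel_measurable (\<mu> \<Otimes>\<^sub>M \<nu>)" unfolding gauss_remainder_def by measurable
    show "AE z in \<mu> \<Otimes>\<^sub>M \<nu>. norm (gauss_remainder t (norm (fst z - snd z))) \<le> norm (t * (norm (fst z - snd z))\<^sup>2)"
      using that gauss_remainder_nonneg[OF that] exp_remainder_bounds(2) by (intro AE_I2) (simp add: gauss_remainder_def)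
  qed
  have "ennreal (C * pair_int (\<lambda>d. d powr p) \<mu> \<nu>) = (\<integral>\<^sup>+z. ennreal (C * norm (fst z - snd z) powr p) \<partial>(\<mu> \<Otimes>\<^sub>M \<nu>))"
    using pair_integrable_powr[OF \<mu> \<nu>, of p] p C(1)
    by (subst nn_integral_eq_integral) (auto simp: pair_integrable_def pair_int_def)
  also have "\<dots> = (\<integral>\<^sup>+z. \<integral>\<^sup>+t. ?h t z \<partial>lborel \<partial>(\<mu> \<Otimes>\<^sub>M \<nu>))"
    by (simp add: C(2))
  also have "\<dots> = (\<integral>\<^sup>+t. \<integral>\<^sup>+z. ?h t z \<partial>(\<mu> \<Otimes>\<^sub>M \<nu>) \<partial>lborel)"
    by (rule Q.Fubini') (simp add: case_prod_unfold)
  also have "\<dots> = (\<integral>\<^sup>+t. ennreal (?k t) \<partial>lborel)"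
  proof (rule nn_integral_cong)
    fix t :: real
    show "(\<integral>\<^sup>+z. ?h t z \<partial>(\<mu> \<Otimes>\<^sub>M \<nu>))
        = ennreal (?k t)"
    proof (cases "0 < t")
      case True
      then show ?thesis
        using int[of t] gauss_remainder_nonneg[of t] by (subst nn_integral_eq_integral) (auto simp: pair_int_def)
    qed simp
  qed
  finally have eq: "(\<integral>\<^sup>+t. ennreal (?k t) \<partial>lborel)
     = ennreal (C * pair_int (\<lambda>d. d powr p) \<mu> \<nu>)" ..
  show ?thesis
  proof (rule has_bochner_integral_nn_integral)
    have "(\<lambda>t. pair_int (gauss_remainder t) \<mu> \<nu>) \<in> borel_measurable lborel"
      unfolding pair_int_def by (rule P.borel_measurable_lebesgue_integral) (simp add: case_prod_unfold)
    then show "?k \<in> borel_measurable lborel"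
      by measurable
    show "AE t in lborel. 0 \<le> ?k t"
      by (rule AE_I2) (auto simp: indicator_def pair_int_def intro!: mult_nonneg_nonneg Bochner_Integration.integral_nonneg gauss_remainder_nonneg)
    show "0 \<le> C * pair_int (\<lambda>d. d powr p) \<mu> \<nu>"
      using C(1) by (auto simp: pair_int_def intro!: mult_nonneg_nonneg Bochner_Integration.integral_nonneg)
  qed (rule eq)
qed

abbreviation gauss_kernel :: "real \<Rightarrow> real \<Rightarrow> real" where
  "gauss_kernel t \<equiv> \<lambda>d. exp (- (t * d\<^sup>2))"

text \<open>
  The quadratic form of the kernel \<open>f (norm (x - y))\<close> on the signed measure \<open>\<mu> - \<nu>\<close>.
\<close>

definition pair_diff :: "(real \<Rightarrow> real) \<Rightarrow> 'a::euclidean_space measure \<Rightarrow> 'a measure \<Rightarrow> real" where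
  "pair_diff f \<mu> \<nu> = pair_int f \<mu> \<mu> - 2 * pair_int f \<mu> \<nu> + pair_int f \<nu> \<nu>"

lemma pair_int_square:
  assumes \<mu>: "\<mu> \<in> moment_class p" and \<nu>: "\<nu> \<in> moment_class p" and p: "2 \<le> p"
    and mean: "(\<integral>x. x \<partial>\<mu>) = 0"
  shows "pair_int (\<lambda>d. d\<^sup>2) \<mu> \<nu> = second_moment \<mu> + second_moment \<nu>"
proof -
  note [measurable_cong] = moment_classD(2)[OF \<mu>] moment_classD(2)[OF \<nu>]
  interpret \<mu>: prob_space \<mu> using moment_classD(1)[OF \<mu>] .
  interpret \<nu>: prob_space \<nu> using moment_classD(1)[OF \<nu>] .
  interpret P: pair_prob_space \<mu> \<nu> ..
  have m: "integrable \<mu> (\<lambda>x. x)" using moment_class_mean[OF \<mu>] p by simp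
  have n: "integrable \<nu> (\<lambda>x. x)" using moment_class_mean[OF \<nu>] p by simp
  have sq: "integrable \<mu> (\<lambda>x. (norm x)\<^sup>2)" "integrable \<nu> (\<lambda>x. (norm x)\<^sup>2)"
    using moment_class_lower[OF \<mu>, of 2] moment_class_lower[OF \<nu>, of 2] p by simp_all
  have cross: "integrable (\<mu> \<Otimes>\<^sub>M \<nu>) (\<lambda>z. fst z \<bullet> snd z)"
  proof (rule Bochner_Integration.integrable_bound)
    show "integrable (\<mu> \<Otimes>\<^sub>M \<nu>) (\<lambda>z. (norm (fst z))\<^sup>2 + (norm (snd z))\<^sup>2)"
      using integrable_pair_first(1)[OF \<mu>.prob_space_axioms \<nu>.prob_space_axioms sq(1)]
        integrable_pair_second(1)[OF \<mu>.prob_space_axioms \<nu>.prob_space_axioms sq(2)] by simp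
    show "(\<lambda>z. fst z \<bullet> snd z) \<in> borel_measurable (\<mu> \<Otimes>\<^sub>M \<nu>)" by measurable
    show "AE z in \<mu> \<Otimes>\<^sub>M \<nu>. norm (fst z \<bullet> snd z) \<le> norm ((norm (fst z))\<^sup>2 + (norm (snd z))\<^sup>2)"
    proof (rule AE_I2)
      fix z :: "'a \<times> 'a"
      have "\<bar>fst z \<bullet> snd z\<bar> \<le> norm (fst z) * norm (snd z)" by (rule Cauchy_Schwarz_ineq2)
      also have "\<dots> \<le> (norm (fst z))\<^sup>2 + (norm (snd z))\<^sup>2"
        using sum_squares_bound[of "norm (fst z)" "norm (snd z)"] mult_nonneg_nonneg[of "norm (fst z)" "norm (snd z)"]
        unfolding mult.assoc by (simp del: mult_nonneg_nonneg)
      finally show "norm (fst z \<bullet> snd z) \<le> norm ((norm (fst z))\<^sup>2 + (norm (snd z))\<^sup>2)" by simp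
    qed
  qed
  have "(\<integral>z. fst z \<bullet> snd z \<partial>(\<mu> \<Otimes>\<^sub>M \<nu>)) = (\<integral>y. (\<integral>x. x \<bullet> y \<partial>\<mu>) \<partial>\<nu>)"
    using P.integral_snd[of "\<lambda>x y. x \<bullet> y"] cross by (simp add: case_prod_unfold)
  also have "\<dots> = 0" using m by (simp add: integral_inner_left mean)
  finally have z: "(\<integral>z. fst z \<bullet> snd z \<partial>(\<mu> \<Otimes>\<^sub>M \<nu>)) = 0" .
  have "pair_int (\<lambda>d. d\<^sup>2) \<mu> \<nu> = (\<integral>z. (norm (fst z))\<^sup>2 + (norm (snd z))\<^sup>2 - 2 * (fst z \<bullet> snd z) \<partial>(\<mu> \<Otimes>\<^sub>M \<nu>))"
    unfolding pair_int_def
    by (intro Bochner_Integration.integral_cong) (simp_all add: power2_norm_eq_inner inner_diff_left inner_diff_right inner_commute)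
  also have "\<dots> = second_moment \<mu> + second_moment \<nu>"
    using integrable_pair_first[OF \<mu>.prob_space_axioms \<nu>.prob_space_axioms sq(1)]
        integrable_pair_second[OF \<mu>.prob_space_axioms \<nu>.prob_space_axioms sq(2)] cross z by simp
  finally show ?thesis .
qed

lemma pair_diff_square_zero:
  assumes "\<mu> \<in> moment_class p" "\<nu> \<in> moment_class p" "2 \<le> p"
    and "(\<integral>x. x \<partial>\<mu>) = 0" "(\<integral>x. x \<partial>\<nu>) = 0"
  shows "pair_diff (\<lambda>d. d\<^sup>2) \<mu> \<nu> = 0"
  using assms by (simp add: pair_diff_def pair_int_square)

text \<open>
  In the Gaussian mixture for \<open>d powr p\<close> the polynomial \<open>1 - t * d\<^sup>2\<close> contributes nothing to the form, because
  \<open>\<mu>\<close> and \<open>\<nu>\<close> have the same mass and the same mean. Only the Gaussian kernels remain.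
\<close>

lemma pair_diff_mixture:
  assumes \<mu>: "\<mu> \<in> moment_class p" and \<nu>: "\<nu> \<in> moment_class p" and p: "2 < p"
    and mean: "(\<integral>x. x \<partial>\<mu>) = 0" "(\<integral>x. x \<partial>\<nu>) = 0"
    and C: "0 < C" "\<And>d. 0 \<le> d \<Longrightarrow>
      remainder_mixture p d = ennreal (C * d powr p)"
  shows "has_bochner_integral lborel
      (\<lambda>t. pair_diff (gauss_kernel t) \<mu> \<nu> * t powr (-1 - p / 2) * indicator {0<..} t)
      (C * pair_diff (\<lambda>d. d powr p) \<mu> \<nu>)"
proof -
  have lin: "pair_int (gauss_remainder t) \<mu>' \<nu>' = pair_int (gauss_kernel t) \<mu>' \<nu>' - 1 + t * pair_int (\<lambda>d. d\<^sup>2) \<mu>' \<nu>'"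
    if "\<mu>' \<in> moment_class p" "\<nu>' \<in> moment_class p" "0 < t" for \<mu>' \<nu>' :: "'a measure" and t
  proof -
    note [measurable_cong] = moment_classD(2)[OF that(1)] moment_classD(2)[OF that(2)]
    interpret \<mu>: prob_space \<mu>' using moment_classD(1)[OF that(1)] .
    interpret \<nu>: prob_space \<nu>' using moment_classD(1)[OF that(2)] .
    interpret P: pair_prob_space \<mu>' \<nu>' ..
    have 1: "integrable (\<mu>' \<Otimes>\<^sub>M \<nu>') (\<lambda>z. exp (- (t * (norm (fst z - snd z))\<^sup>2)))"
      by (rule P.P.integrable_const_bound[where B=1]) (use that(3) in \<open>auto intro!: AE_I2\<close>)
    have 2: "integrable (\<mu>' \<Otimes>\<^sub>M \<nu>') (\<lambda>z. (norm (fst z - snd z))\<^sup>2)"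
      using pair_integrable_powr[OF that(1,2), of 2] p by (simp add: pair_integrable_def)
    show ?thesis
      using 1 2 by (simp add: pair_int_def gauss_remainder_def P.P.prob_space)
  qed
  let ?A = "\<lambda>t. pair_int (gauss_remainder t) \<mu> \<mu> * t powr (-1 - p / 2) * indicator {0<..} t
        - 2 * (pair_int (gauss_remainder t) \<mu> \<nu> * t powr (-1 - p / 2) * indicator {0<..} t)
        + pair_int (gauss_remainder t) \<nu> \<nu> * t powr (-1 - p / 2) * indicator {0<..} t"
  have "has_bochner_integral lborel
      ?A
      (C * pair_int (\<lambda>d. d powr p) \<mu> \<mu> - 2 * (C * pair_int (\<lambda>d. d powr p) \<mu> \<nu>) + C * pair_int (\<lambda>d. d powr p) \<nu> \<nu>)"
    by (intro has_bochner_integral_add has_bochner_integral_diff has_bochner_integral_mult_right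
        has_bochner_integral_gauss_remainder_mixture[OF _ _ p C] \<mu> \<nu>)
  also have "?A
     = (\<lambda>t. pair_diff (gauss_kernel t) \<mu> \<nu> * t powr (-1 - p / 2) * indicator {0<..} t)"
  proof
    fix t :: real
    show "?A t
       = pair_diff (gauss_kernel t) \<mu> \<nu> * t powr (-1 - p / 2) * indicator {0<..} t"
    proof (cases "0 < t")
      case True
      have "pair_int (gauss_remainder t) \<mu> \<mu> - 2 * pair_int (gauss_remainder t) \<mu> \<nu> + pair_int (gauss_remainder t) \<nu> \<nu>
          = pair_diff (gauss_kernel t) \<mu> \<nu> + t * pair_diff (\<lambda>d. d\<^sup>2) \<mu> \<nu>"
        using lin[OF \<mu> \<mu> True] lin[OF \<mu> \<nu> True] lin[OF \<nu> \<nu> True] by (simp add: pair_diff_def algebra_simps)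
      also have "pair_diff (\<lambda>d. d\<^sup>2) \<mu> \<nu> = 0"
        by (rule pair_diff_square_zero[OF \<mu> \<nu>]) (use p mean in auto)
      finally show ?thesis using True by (simp add: distrib_right[symmetric] left_diff_distrib[symmetric] mult.assoc[symmetric])
    qed simp
  qed
  finally show ?thesis by (simp add: pair_diff_def algebra_simps)
qed

section \<open>Gaussian smoothing\<close>

text \<open>
  The integral of \<open>exp (- (a * (norm x)\<^sup>2))\<close> over the space; the type argument carries the dimension.
\<close>

definition gauss_mass :: "real \<Rightarrow> 'a::euclidean_space itself \<Rightarrow> real" where
  "gauss_mass a _ = sqrt (pi / a) ^ DIM('a)"

lemma nn_integral_gauss_1d:
  assumes "0 < a"
  shows "(\<integral>\<^sup>+x. ennreal (exp (- (a * x\<^sup>2))) \<partial>lborel) = ennreal (sqrt (pi / a))"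
proof -
  define \<sigma> where "\<sigma> = 1 / sqrt (2 * a)"
  have \<sigma>: "0 < \<sigma>" "\<sigma>\<^sup>2 = 1 / (2 * a)" using assms by (simp_all add: \<sigma>_def power_divide)
  have "exp (- (a * x\<^sup>2)) = sqrt (pi / a) * normal_density 0 \<sigma> x" for x
    using assms by (simp add: normal_density_def \<sigma>)
  moreover have "(\<integral>\<^sup>+x. ennreal (sqrt (pi / a) * normal_density 0 \<sigma> x) \<partial>lborel) = ennreal (sqrt (pi / a))"
    using integrable_normal_density[OF \<sigma>(1)] integral_normal_density[OF \<sigma>(1)] assms
    by (subst nn_integral_eq_integral) auto
  ultimately show ?thesis by simp
qed

lemma nn_integral_gauss:
  fixes c :: "'a::euclidean_space"
  assumes "0 < a"
  shows "(\<integral>\<^sup>+x. ennreal (exp (- (a * (norm (x - c))\<^sup>2))) \<partial>lborel) = ennreal (gauss_mass a TYPE('a))"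
proof -
  have "(\<integral>\<^sup>+x. ennreal (exp (- (a * (norm (x - c))\<^sup>2))) \<partial>lborel) = (\<integral>\<^sup>+x. ennreal (exp (- (a * (norm (x::'a))\<^sup>2))) \<partial>lborel)"
    using nn_integral_lborel_reflect_shift(2)[of "\<lambda>x. ennreal (exp (- (a * (norm x)\<^sup>2)))" "- c"] by simp
  also have "\<dots> = (\<integral>\<^sup>+x. (\<Prod>b\<in>Basis. ennreal (exp (- (a * ((x::'a) \<bullet> b)\<^sup>2)))) \<partial>lborel)"
  proof (rule nn_integral_cong)
    fix x :: 'a
    have "(norm x)\<^sup>2 = (\<Sum>b\<in>Basis. (x \<bullet> b)\<^sup>2)"
      unfolding power2_norm_eq_inner by (subst euclidean_inner) (simp add: power2_eq_square)
    then show "ennreal (exp (- (a * (norm x)\<^sup>2))) = (\<Prod>b\<in>Basis. ennreal (exp (- (a * (x \<bullet> b)\<^sup>2))))"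
      by (simp add: prod_ennreal exp_sum[symmetric] sum_distrib_left sum_negf)
  qed
  also have "\<dots> = (\<Prod>b\<in>(Basis::'a set). (\<integral>\<^sup>+x. ennreal (exp (- (a * x\<^sup>2))) \<partial>lborel))"
    by (rule nn_integral_lborel_prod) auto
  also have "\<dots> = ennreal (gauss_mass a TYPE('a))"
    using assms by (simp add: nn_integral_gauss_1d gauss_mass_def ennreal_power)
  finally show ?thesis .
qed

lemma gauss_mass_pos: "0 < a \<Longrightarrow> 0 < gauss_mass a TYPE('a::euclidean_space)"
  by (simp add: gauss_mass_def)

lemma has_bochner_integral_gauss:
  fixes c :: "'a::euclidean_space"
  assumes "0 < a"
  shows "has_bochner_integral lborel (\<lambda>x. exp (- (a * (norm (x - c))\<^sup>2))) (gauss_mass a TYPE('a))"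
  by (rule has_bochner_integral_nn_integral)
     (use gauss_mass_pos[OF assms, where 'a='a] nn_integral_gauss[OF assms, of c] in auto)

text \<open>
  The smoothing of \<open>\<mu>\<close> by an unnormalised Gaussian. The factor \<open>2\<close> in the exponent is chosen so that products of two
  smoothings integrate to the pair integral of \<open>exp (- (t * d\<^sup>2))\<close>.
\<close>

definition gauss_conv :: "real \<Rightarrow> 'a::euclidean_space measure \<Rightarrow> 'a \<Rightarrow> real" where
  "gauss_conv t \<mu> z = (\<integral>x. exp (- (2 * t * (norm (z - x))\<^sup>2)) \<partial>\<mu>)"

text \<open>
  By the parallelogram law, the product of two Gaussians centred at \<open>x\<close> and \<open>y\<close> is a Gaussian centred at the
  midpoint times \<open>exp (- (t * (norm (x - y))\<^sup>2))\<close>.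
\<close>

lemma gauss_conv_product:
  fixes \<mu> \<nu> :: "'a::euclidean_space measure"
  assumes \<mu>: "prob_space \<mu>" "sets \<mu> = sets borel" and \<nu>: "prob_space \<nu>" "sets \<nu> = sets borel" and t: "0 < t"
  shows "has_bochner_integral lborel (\<lambda>z. gauss_conv t \<mu> z * gauss_conv t \<nu> z)
      (gauss_mass (4 * t) TYPE('a) * pair_int (gauss_kernel t) \<mu> \<nu>)"
proof -
  note [measurable_cong] = \<mu>(2) \<nu>(2)
  interpret \<mu>: prob_space \<mu> by fact
  interpret \<nu>: prob_space \<nu> by fact
  interpret P: pair_prob_space \<mu> \<nu> ..
  interpret Q: pair_sigma_finite lborel "\<mu> \<Otimes>\<^sub>M \<nu>" ..
  let ?g = "\<lambda>z p. ennreal (exp (- (2 * t * (norm (z - fst p))\<^sup>2)) * exp (- (2 * t * (norm (z - snd p))\<^sup>2)))"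
  have g1: "norm (exp (- (2 * t * (norm (z - x))\<^sup>2))) \<le> 1" for z x :: 'a using t by simp
  have i\<mu>: "integrable \<mu> (\<lambda>x. exp (- (2 * t * (norm (z - x))\<^sup>2)))" for z
    by (rule \<mu>.integrable_const_bound[where B=1]) (use g1 in auto)
  have i\<nu>: "integrable \<nu> (\<lambda>x. exp (- (2 * t * (norm (z - x))\<^sup>2)))" for z
    by (rule \<nu>.integrable_const_bound[where B=1]) (use g1 in auto)
  have [measurable]: "gauss_conv t \<mu> \<in> borel_measurable lborel" "gauss_conv t \<nu> \<in> borel_measurable lborel"
    unfolding gauss_conv_def[abs_def]
    by (rule \<mu>.borel_measurable_lebesgue_integral \<nu>.borel_measurable_lebesgue_integral; measurable)+
  have prod: "ennreal (gauss_conv t \<mu> z * gauss_conv t \<nu> z)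
      = (\<integral>\<^sup>+p. ?g z p \<partial>(\<mu> \<Otimes>\<^sub>M \<nu>))" for z
  proof -
    have "(\<integral>\<^sup>+p. ?g z p \<partial>(\<mu> \<Otimes>\<^sub>M \<nu>))
        = (\<integral>\<^sup>+x. \<integral>\<^sup>+y. ennreal (exp (- (2 * t * (norm (z - x))\<^sup>2))) * ennreal (exp (- (2 * t * (norm (z - y))\<^sup>2))) \<partial>\<nu> \<partial>\<mu>)"
      by (subst \<nu>.nn_integral_fst[symmetric]) (auto simp: ennreal_mult)
    also have "\<dots> = (\<integral>\<^sup>+x. ennreal (exp (- (2 * t * (norm (z - x))\<^sup>2))) * ennreal (gauss_conv t \<nu> z) \<partial>\<mu>)"
      using i\<nu>[of z] by (subst nn_integral_cmult) (auto simp: gauss_conv_def nn_integral_eq_integral)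
    also have "\<dots> = ennreal (gauss_conv t \<mu> z) * ennreal (gauss_conv t \<nu> z)"
      using i\<mu>[of z] by (subst nn_integral_multc) (auto simp: gauss_conv_def nn_integral_eq_integral)
    also have "\<dots> = ennreal (gauss_conv t \<mu> z * gauss_conv t \<nu> z)"
      by (rule ennreal_mult[symmetric]) (auto simp: gauss_conv_def intro!: Bochner_Integration.integral_nonneg)
    finally show ?thesis ..
  qed
  have "(\<integral>\<^sup>+z. ennreal (gauss_conv t \<mu> z * gauss_conv t \<nu> z) \<partial>lborel)
     = (\<integral>\<^sup>+z. \<integral>\<^sup>+p. ?g z p \<partial>(\<mu> \<Otimes>\<^sub>M \<nu>) \<partial>lborel)"
    by (simp add: prod)
  also have "\<dots> = (\<integral>\<^sup>+p. \<integral>\<^sup>+z. ?g z p \<partial>lborel \<partial>(\<mu> \<Otimes>\<^sub>M \<nu>))"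
    by (rule Q.Fubini'[symmetric]) (simp add: case_prod_unfold)
  also have "\<dots> = (\<integral>\<^sup>+p. ennreal (gauss_mass (4 * t) TYPE('a)) * ennreal (exp (- (t * (norm (fst p - snd p))\<^sup>2))) \<partial>(\<mu> \<Otimes>\<^sub>M \<nu>))"
  proof (rule nn_integral_cong)
    fix p :: "'a \<times> 'a"
    let ?c = "(1/2) *\<^sub>R (fst p + snd p)"
    have "exp (- (2 * t * (norm (z - fst p))\<^sup>2)) * exp (- (2 * t * (norm (z - snd p))\<^sup>2))
        = exp (- (4 * t * (norm (z - ?c))\<^sup>2)) * exp (- (t * (norm (fst p - snd p))\<^sup>2))" for z
    proof -
      have "2 * (norm (z - fst p))\<^sup>2 + 2 * (norm (z - snd p))\<^sup>2 = 4 * (norm (z - ?c))\<^sup>2 + (norm (fst p - snd p))\<^sup>2"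
        unfolding power2_norm_eq_inner
        by (simp add: inner_diff_left inner_diff_right inner_add_left inner_add_right inner_commute algebra_simps)
      then have "t * (2 * (norm (z - fst p))\<^sup>2 + 2 * (norm (z - snd p))\<^sup>2) = t * (4 * (norm (z - ?c))\<^sup>2 + (norm (fst p - snd p))\<^sup>2)"
        by simp
      then show ?thesis unfolding mult_exp_exp by (simp add: algebra_simps)
    qed
    then show "(\<integral>\<^sup>+z. ?g z p \<partial>lborel)
        = ennreal (gauss_mass (4 * t) TYPE('a)) * ennreal (exp (- (t * (norm (fst p - snd p))\<^sup>2)))"
      using t nn_integral_gauss[of "4 * t" ?c] by (simp add: ennreal_mult nn_integral_multc)
  qed
  also have "\<dots> = ennreal (gauss_mass (4 * t) TYPE('a) * pair_int (gauss_kernel t) \<mu> \<nu>)"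
  proof -
    have "integrable (\<mu> \<Otimes>\<^sub>M \<nu>) (\<lambda>z. exp (- (t * (norm (fst z - snd z))\<^sup>2)))"
      by (rule P.P.integrable_const_bound[where B=1]) (use t in \<open>auto intro!: AE_I2\<close>)
    then show ?thesis
      using gauss_mass_pos[of "4 * t", where 'a='a] t
      by (subst nn_integral_cmult) (auto simp: pair_int_def nn_integral_eq_integral ennreal_mult)
  qed
  finally have eq: "(\<integral>\<^sup>+z. ennreal (gauss_conv t \<mu> z * gauss_conv t \<nu> z) \<partial>lborel)
      = ennreal (gauss_mass (4 * t) TYPE('a) * pair_int (gauss_kernel t) \<mu> \<nu>)" .
  show ?thesis
  proof (rule has_bochner_integral_nn_integral)
    show "AE z in lborel. 0 \<le> gauss_conv t \<mu> z * gauss_conv t \<nu> z"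
      by (auto simp: gauss_conv_def intro!: AE_I2 mult_nonneg_nonneg Bochner_Integration.integral_nonneg)
    show "0 \<le> gauss_mass (4 * t) TYPE('a) * pair_int (gauss_kernel t) \<mu> \<nu>"
      using gauss_mass_pos[of "4 * t", where 'a='a] t
      by (auto simp: pair_int_def intro!: mult_nonneg_nonneg Bochner_Integration.integral_nonneg)
  qed (simp_all add: eq)
qed

text \<open>
  Positive definiteness of the Gaussian kernel: its quadratic form is a squared \<open>L\<^sup>2\<close> norm.
\<close>

lemma gauss_conv_diff_square:
  fixes \<mu> \<nu> :: "'a::euclidean_space measure"
  assumes \<mu>: "prob_space \<mu>" "sets \<mu> = sets borel" and \<nu>: "prob_space \<nu>" "sets \<nu> = sets borel" and t: "0 < t"
  shows "has_bochner_integral lborel (\<lambda>z. (gauss_conv t \<mu> z - gauss_conv t \<nu> z)\<^sup>2)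
      (gauss_mass (4 * t) TYPE('a) * pair_diff (gauss_kernel t) \<mu> \<nu>)"
    and "0 \<le> pair_diff (gauss_kernel t) \<mu> \<nu>"
proof -
  let ?M = "gauss_mass (4 * t) TYPE('a)" and ?J = "pair_int (gauss_kernel t)"
  have "has_bochner_integral lborel
     (\<lambda>z. gauss_conv t \<mu> z * gauss_conv t \<mu> z - 2 * (gauss_conv t \<mu> z * gauss_conv t \<nu> z) + gauss_conv t \<nu> z * gauss_conv t \<nu> z)
     (?M * ?J \<mu> \<mu> - 2 * (?M * ?J \<mu> \<nu>) + ?M * ?J \<nu> \<nu>)"
    by (intro has_bochner_integral_add has_bochner_integral_diff has_bochner_integral_mult_right gauss_conv_product assms)
  then show 1: "has_bochner_integral lborel (\<lambda>z. (gauss_conv t \<mu> z - gauss_conv t \<nu> z)\<^sup>2)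
      (?M * pair_diff (gauss_kernel t) \<mu> \<nu>)"
    by (simp add: pair_diff_def power2_eq_square algebra_simps)
  have "0 \<le> ?M * pair_diff (gauss_kernel t) \<mu> \<nu>"
    using has_bochner_integral_integral_eq[OF 1] Bochner_Integration.integral_nonneg[of lborel "\<lambda>z. (gauss_conv t \<mu> z - gauss_conv t \<nu> z)\<^sup>2"]
    by simp
  then show "0 \<le> pair_diff (gauss_kernel t) \<mu> \<nu>"
    using gauss_mass_pos[of "4 * t", where 'a='a] t by (simp add: zero_le_mult_iff)
qed

lemma pair_diff_powr_nonneg:
  assumes "\<mu> \<in> moment_class p" "\<nu> \<in> moment_class p" and p: "2 < p" "p < 4"
    and "(\<integral>x. x \<partial>\<mu>) = 0" "(\<integral>x. x \<partial>\<nu>) = 0"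
  shows "0 \<le> pair_diff (\<lambda>d. d powr p) \<mu> \<nu>"
proof -
  obtain C where C: "0 < C" "\<And>d. 0 \<le> d \<Longrightarrow>
      remainder_mixture p d = ennreal (C * d powr p)"
    using powr_gaussian_mixture[OF p] by metis
  let ?h = "\<lambda>t. pair_diff (gauss_kernel t) \<mu> \<nu> * t powr (-1 - p / 2) * indicator {0<..} t"
  have "(\<integral>t. ?h t \<partial>lborel) = C * pair_diff (\<lambda>d. d powr p) \<mu> \<nu>"
    by (rule has_bochner_integral_integral_eq[OF pair_diff_mixture[OF assms(1,2) p(1) assms(5,6) C]])
  moreover have "0 \<le> (\<integral>t. ?h t \<partial>lborel)"
  proof (rule Bochner_Integration.integral_nonneg)
    fix t :: real
    show "0 \<le> ?h t"
      using gauss_conv_diff_square(2)[OF moment_classD(1,2)[OF assms(1)] moment_classD(1,2)[OF assms(2)], of t]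
      by (auto simp: indicator_def)
  qed
  ultimately show ?thesis using C(1) by (simp add: zero_le_mult_iff)
qed

section \<open>From the quadratic form to weak convergence\<close>

text \<open>
  The quadratic part of the modulus of continuity is integrated with \<open>t * u \<le> exp (t * u)\<close>, which trades the factor
  \<open>u = (norm (z - x))\<^sup>2\<close> for a Gaussian of twice the variance and a gain of \<open>1 / t\<close>.
\<close>

lemma gauss_smoothing_error:
  fixes f :: "'a::euclidean_space \<Rightarrow> real"
  assumes [measurable]: "f \<in> borel_measurable borel" and M: "\<And>x. \<bar>f x\<bar> \<le> M"
    and mod: "\<And>x z. \<bar>f z - f x\<bar> \<le> \<epsilon> + L * (norm (z - x))\<^sup>2" and t: "0 < t" and L: "0 \<le> L"
  shows "\<bar>(\<integral>z. f z * exp (- (2 * t * (norm (z - x))\<^sup>2)) \<partial>lborel) - gauss_mass (2 * t) TYPE('a) * f x\<bar>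
      \<le> gauss_mass (2 * t) TYPE('a) * \<epsilon> + L / t * gauss_mass t TYPE('a)"
proof -
  let ?g = "\<lambda>z. exp (- (2 * t * (norm (z - x))\<^sup>2))" and ?h = "\<lambda>z. exp (- (t * (norm (z - x))\<^sup>2))"
  have g: "integrable lborel ?g" "(\<integral>z. ?g z \<partial>lborel) = gauss_mass (2 * t) TYPE('a)"
    using has_bochner_integral_gauss[of "2 * t" x] t by (auto simp: has_bochner_integral_iff)
  have h: "integrable lborel ?h" "(\<integral>z. ?h z \<partial>lborel) = gauss_mass t TYPE('a)"
    using has_bochner_integral_gauss[of t x] t by (auto simp: has_bochner_integral_iff)
  have fg: "integrable lborel (\<lambda>z. f z * ?g z)"
  proof (rule Bochner_Integration.integrable_bound[of _ "\<lambda>z. M * ?g z"])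
    show "AE z in lborel. norm (f z * ?g z) \<le> norm (M * ?g z)"
      using M order.trans[OF M abs_ge_self] by (intro AE_I2) (simp add: abs_mult mult_right_mono)
  qed (use g in auto)
  have "(\<integral>z. f z * ?g z \<partial>lborel) - gauss_mass (2 * t) TYPE('a) * f x = (\<integral>z. (f z - f x) * ?g z \<partial>lborel)"
    using fg g by (simp add: left_diff_distrib mult.commute)
  also have "\<bar>\<dots>\<bar> \<le> (\<integral>z. \<epsilon> * ?g z + L / t * ?h z \<partial>lborel)"
    unfolding real_norm_def[symmetric]
  proof (rule Bochner_Integration.integral_norm_bound_integral)
    show "integrable lborel (\<lambda>z. (f z - f x) * ?g z)" using fg g by (simp add: left_diff_distrib)
    show "integrable lborel (\<lambda>z. \<epsilon> * ?g z + L / t * ?h z)" using g h by simp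
    fix z
    define u where "u = (norm (z - x))\<^sup>2"
    have "t * u \<le> exp (t * u)" using exp_ge_add_one_self[of "t * u"] by linarith
    then have "t * u * exp (- (2 * t * u)) \<le> exp (t * u) * exp (- (2 * t * u))" by (rule mult_right_mono) simp
    also have "\<dots> = exp (- (t * u))" unfolding mult_exp_exp by simp
    finally have "u * exp (- (2 * t * u)) \<le> exp (- (t * u)) / t" using t by (simp add: le_divide_eq mult_ac)
    then have le: "L * (u * exp (- (2 * t * u))) \<le> L * (exp (- (t * u)) / t)" using L by (rule mult_left_mono)
    have "norm ((f z - f x) * ?g z) \<le> (\<epsilon> + L * u) * ?g z"
      using mod[of z x] by (simp add: abs_mult u_def mult_right_mono)
    also have "\<dots> \<le> \<epsilon> * ?g z + L / t * ?h z"
      using le by (simp add: u_def distrib_right mult.assoc)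
    finally show "norm ((f z - f x) * ?g z) \<le> \<epsilon> * ?g z + L / t * ?h z" .
  qed
  also have "\<dots> = gauss_mass (2 * t) TYPE('a) * \<epsilon> + L / t * gauss_mass t TYPE('a)"
    using g h by (simp add: mult.commute)
  finally show ?thesis .
qed

lemma integral_smoothed_test_function:
  fixes f :: "'a::euclidean_space \<Rightarrow> real"
  assumes \<mu>: "prob_space \<mu>" "sets \<mu> = sets borel" and t: "0 < t"
    and [measurable]: "f \<in> borel_measurable borel" and fi: "integrable lborel f"
  shows "integrable lborel (\<lambda>z. f z * gauss_conv t \<mu> z)"
    and "integrable \<mu> (\<lambda>x. \<integral>z. f z * exp (- (2 * t * (norm (z - x))\<^sup>2)) \<partial>lborel)"
    and "(\<integral>z. f z * gauss_conv t \<mu> z \<partial>lborel)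
       = (\<integral>x. (\<integral>z. f z * exp (- (2 * t * (norm (z - x))\<^sup>2)) \<partial>lborel) \<partial>\<mu>)"
proof -
  note [measurable_cong] = \<mu>(2)
  interpret \<mu>: prob_space \<mu> by fact
  interpret P: pair_sigma_finite lborel \<mu> ..
  let ?F = "\<lambda>z x. f z * exp (- (2 * t * (norm (z - x))\<^sup>2))"
  have "integrable (lborel \<Otimes>\<^sub>M \<mu>) (\<lambda>p. f (fst p))"
  proof (rule P.Fubini_integrable)
    show "(\<lambda>p. f (fst p)) \<in> borel_measurable (lborel \<Otimes>\<^sub>M \<mu>)" by measurable
    show "integrable lborel (\<lambda>x. \<integral>y. norm (f (fst (x, y))) \<partial>\<mu>)" using fi by (simp add: \<mu>.prob_space)
  qed simp
  then have int: "integrable (lborel \<Otimes>\<^sub>M \<mu>) (\<lambda>p. ?F (fst p) (snd p))"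
  proof (rule Bochner_Integration.integrable_bound)
    show "(\<lambda>p. ?F (fst p) (snd p)) \<in> borel_measurable (lborel \<Otimes>\<^sub>M \<mu>)" by measurable
    show "AE p in lborel \<Otimes>\<^sub>M \<mu>. norm (?F (fst p) (snd p)) \<le> norm (f (fst p))"
      using t by (intro AE_I2) (simp add: abs_mult mult_left_le)
  qed
  then have int': "integrable (lborel \<Otimes>\<^sub>M \<mu>) (\<lambda>(z, x). ?F z x)" by (simp add: case_prod_unfold)
  have eq: "f z * gauss_conv t \<mu> z = (\<integral>x. ?F z x \<partial>\<mu>)" for z
    by (simp add: gauss_conv_def)
  show "integrable lborel (\<lambda>z. f z * gauss_conv t \<mu> z)"
    unfolding eq using P.integrable_fst[OF int'] .
  show "integrable \<mu> (\<lambda>x. \<integral>z. ?F z x \<partial>lborel)"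
    using P.integrable_snd[OF int'] .
  show "(\<integral>z. f z * gauss_conv t \<mu> z \<partial>lborel) = (\<integral>x. (\<integral>z. ?F z x \<partial>lborel) \<partial>\<mu>)"
    unfolding eq by (rule P.Fubini_integral[OF int', symmetric])
qed

text \<open>
  The test function is replaced by its Gaussian average, with an error controlled by its modulus of continuity. By Fubini
  the average can be moved onto the measures, and the product of \<open>f\<close> with the smoothed difference is
  split by \<open>2 * a * b \<le> \<eta> * a\<^sup>2 + b\<^sup>2 / \<eta>\<close>.
\<close>

lemma test_function_bound:
  fixes f :: "'a::euclidean_space \<Rightarrow> real"
  assumes \<mu>: "prob_space \<mu>" "sets \<mu> = sets borel" and \<nu>: "prob_space \<nu>" "sets \<nu> = sets borel"
    and f [measurable]: "f \<in> borel_measurable borel" and M: "\<And>x. \<bar>f x\<bar> \<le> M"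
    and fi: "integrable lborel f" and f2: "integrable lborel (\<lambda>x. (f x)\<^sup>2)"
    and mod: "\<And>x z. \<bar>f z - f x\<bar> \<le> \<epsilon> + L * (norm (z - x))\<^sup>2" and t: "0 < t" and L: "0 \<le> L" and \<eta>: "0 < \<eta>"
  shows "gauss_mass (2 * t) TYPE('a) * \<bar>(\<integral>x. f x \<partial>\<mu>) - (\<integral>x. f x \<partial>\<nu>)\<bar>
    \<le> 2 * (gauss_mass (2 * t) TYPE('a) * \<epsilon> + L / t * gauss_mass t TYPE('a))
      + \<eta> / 2 * (\<integral>x. (f x)\<^sup>2 \<partial>lborel)
      + gauss_mass (4 * t) TYPE('a) * pair_diff (gauss_kernel t) \<mu> \<nu> / (2 * \<eta>)"
proof -
  define m where "m = gauss_mass (2 * t) TYPE('a)"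
  define E where "E = m * \<epsilon> + L / t * gauss_mass t TYPE('a)"
  define S where "S = (\<lambda>x. \<integral>z. f z * exp (- (2 * t * (norm (z - x))\<^sup>2)) \<partial>lborel)"
  have err: "\<bar>m * (\<integral>x. f x \<partial>\<rho>) - (\<integral>x. S x \<partial>\<rho>)\<bar> \<le> E" if \<rho>: "prob_space \<rho>" "sets \<rho> = sets borel" for \<rho>
  proof -
    interpret \<rho>: prob_space \<rho> by fact
    have i: "integrable \<rho> f"
    proof (rule \<rho>.integrable_const_bound[where B=M])
      show "f \<in> borel_measurable \<rho>" using f by (simp add: measurable_cong_sets[OF \<rho>(2) refl])
    qed (use M in auto)
    have s: "integrable \<rho> S"
      unfolding S_def by (rule integral_smoothed_test_function(2)[OF \<rho> t f fi])
    have "m * (\<integral>x. f x \<partial>\<rho>) - (\<integral>x. S x \<partial>\<rho>) = (\<integral>x. m * f x - S x \<partial>\<rho>)" using i s by simp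
    also have "\<bar>\<dots>\<bar> \<le> (\<integral>x. E \<partial>\<rho>)"
      unfolding real_norm_def[symmetric]
    proof (rule Bochner_Integration.integral_norm_bound_integral)
      show "norm (m * f x - S x) \<le> E" for x
        using gauss_smoothing_error[OF f M mod t L, of x] by (simp add: E_def m_def S_def abs_minus_commute)
    qed (use i s in auto)
    finally show ?thesis by (simp add: \<rho>.prob_space)
  qed
  have \<mu>i: "integrable lborel (\<lambda>z. f z * gauss_conv t \<mu> z)" "(\<integral>z. f z * gauss_conv t \<mu> z \<partial>lborel) = (\<integral>x. S x \<partial>\<mu>)"
    unfolding S_def using integral_smoothed_test_function[OF \<mu> t f fi] by auto
  have \<nu>i: "integrable lborel (\<lambda>z. f z * gauss_conv t \<nu> z)" "(\<integral>z. f z * gauss_conv t \<nu> z \<partial>lborel) = (\<integral>x. S x \<partial>\<nu>)"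
    unfolding S_def using integral_smoothed_test_function[OF \<nu> t f fi] by auto
  note sq = gauss_conv_diff_square(1)[OF \<mu> \<nu> t]
  have "(\<integral>x. S x \<partial>\<mu>) - (\<integral>x. S x \<partial>\<nu>) = (\<integral>z. f z * gauss_conv t \<mu> z - f z * gauss_conv t \<nu> z \<partial>lborel)"
    using \<mu>i \<nu>i by simp
  also have "\<bar>\<dots>\<bar> \<le> (\<integral>z. \<eta> / 2 * (f z)\<^sup>2 + (gauss_conv t \<mu> z - gauss_conv t \<nu> z)\<^sup>2 / (2 * \<eta>) \<partial>lborel)"
    unfolding real_norm_def[symmetric]
  proof (rule Bochner_Integration.integral_norm_bound_integral)
    show "integrable lborel (\<lambda>z. \<eta> / 2 * (f z)\<^sup>2 + (gauss_conv t \<mu> z - gauss_conv t \<nu> z)\<^sup>2 / (2 * \<eta>))"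
      using f2 sq by (auto simp: has_bochner_integral_iff)
    fix z
    define F where "F = gauss_conv t \<mu> z - gauss_conv t \<nu> z"
    have "2 * \<eta> * \<bar>f z * F\<bar> \<le> \<eta>\<^sup>2 * (f z)\<^sup>2 + F\<^sup>2"
      using sum_squares_bound[of "\<eta> * \<bar>f z\<bar>" "\<bar>F\<bar>"] by (simp add: abs_mult power_mult_distrib mult_ac)
    then have "\<bar>f z * F\<bar> \<le> (\<eta>\<^sup>2 * (f z)\<^sup>2 + F\<^sup>2) / (2 * \<eta>)"
      using \<eta> by (simp add: le_divide_eq mult_ac)
    also have "\<dots> = \<eta> / 2 * (f z)\<^sup>2 + F\<^sup>2 / (2 * \<eta>)"
      using \<eta> by (simp add: field_simps power2_eq_square)
    finally show "norm (f z * gauss_conv t \<mu> z - f z * gauss_conv t \<nu> z)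
        \<le> \<eta> / 2 * (f z)\<^sup>2 + (gauss_conv t \<mu> z - gauss_conv t \<nu> z)\<^sup>2 / (2 * \<eta>)"
      by (simp add: F_def right_diff_distrib)
  qed (use \<mu>i \<nu>i in auto)
  also have "\<dots> = \<eta> / 2 * (\<integral>x. (f x)\<^sup>2 \<partial>lborel)
      + gauss_mass (4 * t) TYPE('a) * pair_diff (gauss_kernel t) \<mu> \<nu> / (2 * \<eta>)"
    using f2 sq by (auto simp: has_bochner_integral_iff)
  finally have main: "\<bar>(\<integral>x. S x \<partial>\<mu>) - (\<integral>x. S x \<partial>\<nu>)\<bar> \<le> \<eta> / 2 * (\<integral>x. (f x)\<^sup>2 \<partial>lborel)
      + gauss_mass (4 * t) TYPE('a) * pair_diff (gauss_kernel t) \<mu> \<nu> / (2 * \<eta>)" .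
  have "0 < m" unfolding m_def by (rule gauss_mass_pos) (use t in simp)
  then have "m * \<bar>(\<integral>x. f x \<partial>\<mu>) - (\<integral>x. f x \<partial>\<nu>)\<bar> = \<bar>m * (\<integral>x. f x \<partial>\<mu>) - m * (\<integral>x. f x \<partial>\<nu>)\<bar>"
    by (simp add: abs_mult right_diff_distrib[symmetric])
  then show ?thesis
    using main err[OF \<mu>] err[OF \<nu>] unfolding m_def[symmetric] E_def[symmetric] by linarith
qed

text \<open>
  The integrand in \<open>pair_diff_mixture\<close> is nonnegative, so it cannot exceed \<open>\<delta>\<close> on all of an interval of length one
  if its integral is less than \<open>\<delta>\<close>.
\<close>

lemma powr_diff_controls_gaussian:
  assumes \<mu>: "\<mu> \<in> moment_class p" and \<nu>: "\<nu> \<in> moment_class p" and p: "2 < p"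
    and mean: "(\<integral>x. x \<partial>\<mu>) = 0" "(\<integral>x. x \<partial>\<nu>) = 0"
    and C: "0 < C" "\<And>d. 0 \<le> d \<Longrightarrow>
      remainder_mixture p d = ennreal (C * d powr p)"
    and small: "C * pair_diff (\<lambda>d. d powr p) \<mu> \<nu> < \<delta>" and T: "0 < T"
  obtains t where "T \<le> t" "t \<le> T + 1"
    "pair_diff (gauss_kernel t) \<mu> \<nu> \<le> \<delta> * (T + 1) powr (1 + p / 2)"
proof -
  let ?H = "\<lambda>t. pair_diff (gauss_kernel t) \<mu> \<nu>"
  let ?h = "\<lambda>t. ?H t * t powr (-1 - p / 2) * indicator {0<..} t"
  have hb: "has_bochner_integral lborel ?h (C * pair_diff (\<lambda>d. d powr p) \<mu> \<nu>)"
    by (rule pair_diff_mixture[OF \<mu> \<nu> p mean C])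
  have H0: "0 \<le> ?H t" if "0 < t" for t
    by (rule gauss_conv_diff_square(2)[OF moment_classD(1,2)[OF \<mu>] moment_classD(1,2)[OF \<nu>] that])
  have "\<exists>t\<in>{T..T+1}. ?h t \<le> \<delta>"
  proof (rule ccontr)
    assume "\<not> ?thesis"
    then have gt: "\<delta> < ?h t" if "t \<in> {T..T+1}" for t using that by force
    have "\<delta> = (\<integral>t. \<delta> * indicator {T..T+1} t \<partial>lborel)" by simp
    also have "\<dots> \<le> (\<integral>t. ?h t \<partial>lborel)"
    proof (rule integral_mono)
      show "integrable lborel (\<lambda>t. \<delta> * indicator {T..T+1} t)" by simp
      show "integrable lborel ?h" using hb by (simp add: has_bochner_integral_iff)
      show "\<delta> * indicator {T..T+1} t \<le> ?h t" for t
      proof (cases "t \<in> {T..T+1}")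
        case True
        then show ?thesis using gt[OF True] by simp
      next
        case False
        then show ?thesis using H0[of t] by (auto simp: indicator_def)
      qed
    qed
    also have "\<dots> = C * pair_diff (\<lambda>d. d powr p) \<mu> \<nu>" using hb by (simp add: has_bochner_integral_iff)
    finally show False using small by simp
  qed
  then obtain t where t: "T \<le> t" "t \<le> T + 1" "?h t \<le> \<delta>" by auto
  have t0: "0 < t" using t T by simp
  have \<delta>0: "0 \<le> \<delta>" using t(3) H0[OF t0] t0 by (auto intro: order.trans[rotated])
  have "?H t = ?h t * t powr (1 + p / 2)"
    using t0 by (simp add: mult.assoc powr_add[symmetric])
  also have "\<dots> \<le> \<delta> * (T + 1) powr (1 + p / 2)"
    using t t0 \<delta>0 p by (intro mult_mono powr_mono2) auto
  finally show ?thesis using that t by blast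
qed

lemma gauss_mass_ratio:
  "0 < t \<Longrightarrow> gauss_mass t TYPE('a::euclidean_space) = sqrt 2 ^ DIM('a) * gauss_mass (2 * t) TYPE('a)"
  by (simp add: gauss_mass_def power_mult_distrib[symmetric] real_sqrt_mult[symmetric])

lemma gauss_mass_antimono:
  "0 < s \<Longrightarrow> s \<le> t \<Longrightarrow> gauss_mass t TYPE('a::euclidean_space) \<le> gauss_mass s TYPE('a)"
  unfolding gauss_mass_def by (intro power_mono real_sqrt_le_mono divide_left_mono) auto

text \<open>
  Uniform continuity handles nearby points; for distant points the quadratic term is at least \<open>2 * M\<close>.
\<close>

lemma compactly_supported_modulus:
  fixes f :: "'a::euclidean_space \<Rightarrow> real"
  assumes cont: "continuous_on UNIV f" and supp: "\<And>x. R < norm x \<Longrightarrow> f x = 0" and \<epsilon>: "0 < \<epsilon>"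
    and M: "\<And>x. \<bar>f x\<bar> \<le> M"
  obtains L where "0 \<le> L" "\<And>x z. \<bar>f z - f x\<bar> \<le> \<epsilon> + L * (norm (z - x))\<^sup>2"
proof -
  have "uniformly_continuous_on (cball 0 (R + 1)) f"
    by (rule compact_uniformly_continuous) (auto intro: continuous_on_subset[OF cont])
  then obtain \<delta> where \<delta>: "0 < \<delta>"
    "\<And>x z. x \<in> cball 0 (R + 1) \<Longrightarrow> z \<in> cball 0 (R + 1) \<Longrightarrow> dist z x < \<delta> \<Longrightarrow> dist (f z) (f x) < \<epsilon>"
    using \<epsilon> unfolding uniformly_continuous_on_def by metis
  \<comment> \<open>with \<open>r \<le> 1\<close>, two points at distance less than \<open>r\<close> lie both in \<open>cball 0 (R + 1)\<close> or both outside the support\<close>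
  define r where "r = min \<delta> 1"
  have r: "0 < r" "r \<le> 1" "r \<le> \<delta>" using \<delta> by (auto simp: r_def)
  have M0: "0 \<le> M" using M[of 0] by simp
  have near: "\<bar>f z - f x\<bar> \<le> \<epsilon>" if "norm (z - x) < r" for x z
  proof (cases "norm x \<le> R + 1 \<and> norm z \<le> R + 1")
    case True
    then have "dist (f z) (f x) < \<epsilon>" using that r by (intro \<delta>(2)) (auto simp: dist_norm)
    then show ?thesis by (simp add: dist_norm)
  next
    case False
    have "norm x \<le> norm z + norm (z - x)" "norm z \<le> norm x + norm (z - x)"
      using norm_triangle_ineq[of z "x - z"] norm_triangle_ineq[of x "z - x"] by (simp_all add: norm_minus_commute)
    then have "R < norm x" "R < norm z" using False that r by linarith+
    then show ?thesis using supp \<epsilon> by simp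
  qed
  show ?thesis
  proof (rule that[of "2 * M / r\<^sup>2"])
    show "0 \<le> 2 * M / r\<^sup>2" using M0 by simp
    show "\<bar>f z - f x\<bar> \<le> \<epsilon> + 2 * M / r\<^sup>2 * (norm (z - x))\<^sup>2" for x z
    proof (cases "norm (z - x) < r")
      case True
      have "0 \<le> 2 * M / r\<^sup>2 * (norm (z - x))\<^sup>2" using M0 by simp
      then show ?thesis using near[OF True] by linarith
    next
      case False
      then have "r\<^sup>2 \<le> (norm (z - x))\<^sup>2" using r by (intro power_mono) auto
      then have "2 * M / r\<^sup>2 * r\<^sup>2 \<le> 2 * M / r\<^sup>2 * (norm (z - x))\<^sup>2" using M0 by (intro mult_left_mono) auto
      then have "2 * M \<le> 2 * M / r\<^sup>2 * (norm (z - x))\<^sup>2" using r by simp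
      then show ?thesis using M[of z] M[of x] \<epsilon> by linarith
    qed
  qed
qed

text \<open>
  The constants are chosen in the order \<open>L\<close>, \<open>T\<close>, \<open>\<eta>\<close>, \<open>\<delta>\<close>: the modulus of continuity of \<open>f\<close> determines how large \<open>t\<close> must be
  for the smoothing error to be small, then \<open>\<eta>\<close> makes the \<open>L\<^sup>2\<close> norm of \<open>f\<close> harmless, and \<open>\<delta>\<close> is the smallness then required
  of the quadratic form. Monotonicity of the Gaussian masses makes \<open>\<eta>\<close> and \<open>\<delta>\<close> independent of \<open>t\<close> in \<open>[T, T + 1]\<close>.
\<close>

lemma converges_compactly_supported:
  fixes \<nu> :: "nat \<Rightarrow> 'a::euclidean_space measure" and f :: "'a \<Rightarrow> real"
  assumes p: "2 < p" "p < 4"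
    and \<nu>: "\<And>k. \<nu> k \<in> moment_class p" "\<And>k. (\<integral>x. x \<partial>\<nu> k) = 0"
    and \<sigma>: "\<sigma> \<in> moment_class p" "(\<integral>x. x \<partial>\<sigma>) = 0"
    and lim: "(\<lambda>k. pair_diff (\<lambda>d. d powr p) (\<nu> k) \<sigma>) \<longlonglongrightarrow> 0"
    and cont: "continuous_on UNIV f" and supp: "\<And>x. R < norm x \<Longrightarrow> f x = 0" and M: "\<And>x. \<bar>f x\<bar> \<le> M"
  shows "(\<lambda>k. \<integral>x. f x \<partial>\<nu> k) \<longlonglongrightarrow> (\<integral>x. f x \<partial>\<sigma>)"
proof (rule LIMSEQ_I)
  fix e :: real assume e: "0 < e"
  have f [measurable]: "f \<in> borel_measurable borel" using cont by (rule borel_measurable_continuous_onI)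
  have M0: "0 \<le> M" using M[of 0] by simp
  have ind: "integrable lborel (\<lambda>x. c * indicator (cball (0::'a) R) x)" for c :: real
    by (intro integrable_mult_right integrable_real_indicator emeasure_bounded_finite) auto
  have fi: "integrable lborel f"
    by (rule Bochner_Integration.integrable_bound[OF ind[of M]])
      (use M supp M0 in \<open>auto intro!: AE_I2 simp: indicator_def not_le\<close>)
  have f2: "integrable lborel (\<lambda>x. (f x)\<^sup>2)"
    by (rule Bochner_Integration.integrable_bound[OF ind[of "M\<^sup>2"]])
      (use M supp M0 in \<open>auto intro!: AE_I2 simp: indicator_def not_le abs_le_square_iff[symmetric]\<close>)
  obtain L where L: "0 \<le> L" "\<And>x z. \<bar>f z - f x\<bar> \<le> e / 8 + L * (norm (z - x))\<^sup>2"
    using compactly_supported_modulus[OF cont supp _ M, of R "e / 8"] e by auto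
  obtain C where C: "0 < C" "\<And>d. 0 \<le> d \<Longrightarrow>
      remainder_mixture p d = ennreal (C * d powr p)"
    using powr_gaussian_mixture[OF p] by metis
  define q where "q = sqrt 2 ^ DIM('a)"
  have q: "0 < q" by (simp add: q_def)
  \<comment> \<open>\<open>q\<close> is the ratio of the Gaussian masses at \<open>t\<close> and \<open>2 * t\<close>, so the smoothing error is \<open>L * q / t\<close>\<close>
  define T where "T = 8 * L * q / e + 1"
  have T: "0 < T" "L * q / T \<le> e / 8"
  proof -
    have "0 \<le> 8 * L * q / e" using L(1) q e by simp
    then show T0: "0 < T" by (simp add: T_def)
    have "8 * L * q / e \<le> T" by (simp add: T_def)
    then have "8 * (L * q) \<le> e * T" using e by (simp add: divide_le_eq mult_ac)
    then show "L * q / T \<le> e / 8" using T0 by (simp add: divide_le_eq)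
  qed
  define Q where "Q = (\<integral>x. (f x)\<^sup>2 \<partial>lborel)"
  have Q: "0 \<le> Q" unfolding Q_def by (rule Bochner_Integration.integral_nonneg) simp
  define m0 where "m0 = gauss_mass (2 * (T + 1)) TYPE('a)"
  define m1 where "m1 = gauss_mass (4 * T) TYPE('a)"
  have m0: "0 < m0" and m1: "0 < m1" using T by (auto simp: m0_def m1_def intro!: gauss_mass_pos)
  define \<eta> where "\<eta> = m0 * e / (4 * (Q + 1))"
  have \<eta>: "0 < \<eta>" using m0 e Q by (simp add: \<eta>_def)
  have \<eta>Q: "\<eta> / 2 * Q \<le> m0 * (e / 8)"
  proof -
    have "\<eta> / 2 * Q \<le> \<eta> / 2 * (Q + 1)" using \<eta> by (intro mult_left_mono) auto
    also have "\<dots> = m0 * (e / 8)" using Q by (simp add: \<eta>_def field_simps)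
    finally show ?thesis .
  qed
  define S where "S = (T + 1) powr (1 + p / 2)"
  have S: "0 < S" using T by (simp add: S_def)
  define \<delta> where "\<delta> = m0 * (e / 8) * (2 * \<eta>) / (m1 * S)"
  have \<delta>: "0 < \<delta>" using m0 m1 S \<eta> e by (simp add: \<delta>_def)
  have "\<forall>\<^sub>F k in sequentially. C * pair_diff (\<lambda>d. d powr p) (\<nu> k) \<sigma> < \<delta>"
    using order_tendstoD(2)[OF tendsto_mult_left[OF lim, of C], of \<delta>] \<delta> by simp
  then obtain k0 where k0: "\<And>k. k0 \<le> k \<Longrightarrow> C * pair_diff (\<lambda>d. d powr p) (\<nu> k) \<sigma> < \<delta>"
    by (auto simp: eventually_sequentially)
  show "\<exists>no. \<forall>n\<ge>no. norm ((\<integral>x. f x \<partial>\<nu> n) - (\<integral>x. f x \<partial>\<sigma>)) < e"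
  proof (intro exI allI impI)
    fix k assume k: "k0 \<le> k"
    obtain t where t: "T \<le> t" "t \<le> T + 1"
      "pair_diff (gauss_kernel t) (\<nu> k) \<sigma> \<le> \<delta> * S"
      using powr_diff_controls_gaussian[OF \<nu>(1) \<sigma>(1) p(1) \<nu>(2) \<sigma>(2) C k0[OF k] T(1)] unfolding S_def by metis
    have t0: "0 < t" using t T by simp
    define m where "m = gauss_mass (2 * t) TYPE('a)"
    have m: "m0 \<le> m" unfolding m_def m0_def by (rule gauss_mass_antimono) (use t t0 in auto)
    have mt: "gauss_mass t TYPE('a) = q * m" unfolding m_def q_def by (rule gauss_mass_ratio[OF t0])
    have m4: "gauss_mass (4 * t) TYPE('a) \<le> m1" unfolding m1_def by (rule gauss_mass_antimono) (use t T in auto)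
    define H where "H = pair_diff (gauss_kernel t) (\<nu> k) \<sigma>"
    have H0: "0 \<le> H" unfolding H_def
      by (rule gauss_conv_diff_square(2)[OF moment_classD(1,2)[OF \<nu>(1)] moment_classD(1,2)[OF \<sigma>(1)] t0])
    have "m * \<bar>(\<integral>x. f x \<partial>\<nu> k) - (\<integral>x. f x \<partial>\<sigma>)\<bar>
        \<le> 2 * (m * (e / 8) + L / t * (q * m)) + \<eta> / 2 * Q + gauss_mass (4 * t) TYPE('a) * H / (2 * \<eta>)"
      using test_function_bound[OF moment_classD(1,2)[OF \<nu>(1)] moment_classD(1,2)[OF \<sigma>(1)] f M fi f2 L(2) t0 L(1) \<eta>, of k]
      unfolding m_def[symmetric] mt Q_def[symmetric] H_def[symmetric] .
    also have "L / t * (q * m) \<le> m * (e / 8)"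
    proof -
      have "L * q / t \<le> L * q / T" using t T L(1) q by (intro divide_left_mono) auto
      then have "L * q / t \<le> e / 8" using T(2) by linarith
      then have "m * (L * q / t) \<le> m * (e / 8)" using m m0 by (intro mult_left_mono) auto
      then show ?thesis by (simp add: mult_ac)
    qed
    also have "\<eta> / 2 * Q \<le> m * (e / 8)"
      using \<eta>Q mult_right_mono[OF m, of "e / 8"] e by linarith
    also have "gauss_mass (4 * t) TYPE('a) * H / (2 * \<eta>) \<le> m * (e / 8)"
    proof -
      have "gauss_mass (4 * t) TYPE('a) * H \<le> m1 * (\<delta> * S)"
        using m4 t(3) H0 m1 by (intro mult_mono) (auto simp: H_def)
      also have "\<dots> = m0 * (e / 8) * (2 * \<eta>)" using m1 S by (simp add: \<delta>_def)
      finally have "gauss_mass (4 * t) TYPE('a) * H / (2 * \<eta>) \<le> m0 * (e / 8)"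
        using \<eta> by (simp only: pos_divide_le_eq[of "2 * \<eta>"] mult_pos_pos zero_less_numeral)
      also have "\<dots> \<le> m * (e / 8)" using m e by (intro mult_right_mono) auto
      finally show ?thesis .
    qed
    finally have "m * \<bar>(\<integral>x. f x \<partial>\<nu> k) - (\<integral>x. f x \<partial>\<sigma>)\<bar> \<le> m * (6 * (e / 8))" by (simp add: algebra_simps)
    then have "\<bar>(\<integral>x. f x \<partial>\<nu> k) - (\<integral>x. f x \<partial>\<sigma>)\<bar> \<le> 6 * (e / 8)"
      using m m0 by (simp only: mult_le_cancel_left_pos)
    then show "norm ((\<integral>x. f x \<partial>\<nu> k) - (\<integral>x. f x \<partial>\<sigma>)) < e" using e by simp
  qed
qed

definition cutoff :: "real \<Rightarrow> 'a::real_normed_vector \<Rightarrow> real" where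
  "cutoff R x = max 0 (min 1 (R + 1 - norm x))"

lemma cutoff_bounds: "0 \<le> cutoff R x" "cutoff R x \<le> 1" "R + 1 < norm x \<Longrightarrow> cutoff R x = 0"
  by (auto simp: cutoff_def)

lemma cutoff_complement:
  assumes "0 < R"
  shows "1 - cutoff R x \<le> (norm x)\<^sup>2 / R\<^sup>2"
proof (cases "norm x \<le> R")
  case True
  then show ?thesis by (simp add: cutoff_def)
next
  case False
  then have "R\<^sup>2 \<le> (norm x)\<^sup>2" using assms by (intro power_mono) auto
  then have "1 \<le> (norm x)\<^sup>2 / R\<^sup>2" using assms by simp
  then show ?thesis using cutoff_bounds(1)[of R x] by linarith
qed

text \<open>
  By Chebyshev's inequality, the bound on second moments lets a bounded continuous function be cut off at a large radius
  with a small error, uniformly in the measure.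
\<close>

lemma weakly_converges_of_pair_diff:
  fixes \<nu> :: "nat \<Rightarrow> 'a::euclidean_space measure"
  assumes p: "2 < p" "p < 4"
    and \<nu>: "\<And>k. \<nu> k \<in> moment_class p" "\<And>k. (\<integral>x. x \<partial>\<nu> k) = 0"
    and \<sigma>: "\<sigma> \<in> moment_class p" "(\<integral>x. x \<partial>\<sigma>) = 0"
    and lim: "(\<lambda>k. pair_diff (\<lambda>d. d powr p) (\<nu> k) \<sigma>) \<longlonglongrightarrow> 0"
    and K: "\<And>k. second_moment (\<nu> k) \<le> K" "second_moment \<sigma> \<le> K"
  shows "weakly_converges \<nu> \<sigma>"
  unfolding weakly_converges_def
proof (intro allI impI)
  fix f :: "'a \<Rightarrow> real" assume cont: "continuous_on UNIV f" and "bounded (range f)"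
  then obtain M where M: "\<And>x. \<bar>f x\<bar> \<le> M" by (auto simp: bounded_iff)
  have M0: "0 \<le> M" using M[of 0] by simp
  have f: "f \<in> borel_measurable borel" using cont by (rule borel_measurable_continuous_onI)
  have cc: "continuous_on UNIV (cutoff R :: 'a \<Rightarrow> real)" for R
    unfolding cutoff_def by (intro continuous_intros)
  have cm: "cutoff R \<in> borel_measurable (borel :: 'a measure)" for R
    using cc by (rule borel_measurable_continuous_onI)
  have "0 \<le> second_moment \<sigma>" by (rule Bochner_Integration.integral_nonneg) simp
  then have K0: "0 \<le> K" using K(2) by linarith
  have tail: "\<bar>(\<integral>x. f x \<partial>\<rho>) - (\<integral>x. f x * cutoff R x \<partial>\<rho>)\<bar> \<le> M * K / R\<^sup>2"
    if \<rho>: "\<rho> \<in> moment_class p" and k: "second_moment \<rho> \<le> K" and R: "0 < R" for \<rho> R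
  proof -
    note [measurable_cong] = moment_classD(2)[OF \<rho>]
    interpret \<rho>: prob_space \<rho> using moment_classD(1)[OF \<rho>] .
    have [measurable]: "f \<in> borel_measurable \<rho>" "cutoff R \<in> borel_measurable \<rho>"
      using f cm[of R] by measurable
    have i: "integrable \<rho> f" by (rule \<rho>.integrable_const_bound[where B=M]) (use M in auto)
    have ic: "integrable \<rho> (\<lambda>x. f x * cutoff R x)"
    proof (rule \<rho>.integrable_const_bound[where B="M * 1"])
      show "AE x in \<rho>. norm (f x * cutoff R x) \<le> M * 1"
      proof (rule AE_I2)
        fix x :: 'a
        have "\<bar>cutoff R x\<bar> \<le> 1" using cutoff_bounds[of R x] by simp
        then show "norm (f x * cutoff R x) \<le> M * 1"
          unfolding real_norm_def abs_mult using M M0 by (intro mult_mono) auto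
      qed
    qed simp
    have sq: "integrable \<rho> (\<lambda>x. (norm x)\<^sup>2)"
      using moment_class_lower[OF \<rho>, of 2] p by simp
    have "(\<integral>x. f x \<partial>\<rho>) - (\<integral>x. f x * cutoff R x \<partial>\<rho>) = (\<integral>x. f x - f x * cutoff R x \<partial>\<rho>)" using i ic by simp
    also have "\<bar>\<dots>\<bar> \<le> (\<integral>x. M / R\<^sup>2 * (norm x)\<^sup>2 \<partial>\<rho>)"
      unfolding real_norm_def[symmetric]
    proof (rule Bochner_Integration.integral_norm_bound_integral)
      fix x
      have "f x - f x * cutoff R x = f x * (1 - cutoff R x)" by (simp add: right_diff_distrib)
      then have "norm (f x - f x * cutoff R x) = \<bar>f x\<bar> * (1 - cutoff R x)"
        using cutoff_bounds[of R x] by (simp add: abs_mult)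
      also have "\<dots> \<le> M * ((norm x)\<^sup>2 / R\<^sup>2)"
        using M cutoff_complement[OF R, of x] cutoff_bounds[of R x] M0 by (intro mult_mono) auto
      finally show "norm (f x - f x * cutoff R x) \<le> M / R\<^sup>2 * (norm x)\<^sup>2" by simp
    qed (use i ic sq in auto)
    also have "\<dots> = M / R\<^sup>2 * second_moment \<rho>" by simp
    also have "\<dots> \<le> M / R\<^sup>2 * K" using k M0 by (intro mult_left_mono) auto
    finally show ?thesis by simp
  qed
  show "(\<lambda>k. \<integral>x. f x \<partial>\<nu> k) \<longlonglongrightarrow> (\<integral>x. f x \<partial>\<sigma>)"
  proof (rule LIMSEQ_I)
    fix e :: real assume e: "0 < e"
    define R where "R = sqrt (4 * M * K / e) + 1"
    have R: "0 < R" "M * K / R\<^sup>2 \<le> e / 4"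
    proof -
      have s: "0 \<le> 4 * M * K / e" using M0 K0 e by simp
      then show R0: "0 < R" by (simp add: R_def add_nonneg_pos)
      have "(sqrt (4 * M * K / e))\<^sup>2 \<le> R\<^sup>2" using s by (intro power_mono) (auto simp: R_def)
      then have "4 * M * K / e \<le> R\<^sup>2" using s by simp
      then have "4 * (M * K) \<le> e * R\<^sup>2" using e by (simp add: divide_le_eq mult_ac)
      then show "M * K / R\<^sup>2 \<le> e / 4" using R0 by (simp add: divide_le_eq)
    qed
    have "(\<lambda>k. \<integral>x. f x * cutoff R x \<partial>\<nu> k) \<longlonglongrightarrow> (\<integral>x. f x * cutoff R x \<partial>\<sigma>)"
    proof (rule converges_compactly_supported[OF p \<nu> \<sigma> lim])
      show "continuous_on UNIV (\<lambda>x. f x * cutoff R x)" using cont cc by (intro continuous_intros)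
      show "R + 1 < norm x \<Longrightarrow> f x * cutoff R x = 0" for x by (simp add: cutoff_bounds)
      show "\<bar>f x * cutoff R x\<bar> \<le> M * 1" for x
      proof -
        have "\<bar>cutoff R x\<bar> \<le> 1" using cutoff_bounds[of R x] by simp
        then show ?thesis unfolding abs_mult using M M0 by (intro mult_mono) auto
      qed
    qed
    then obtain N where N: "\<And>k. N \<le> k \<Longrightarrow> \<bar>(\<integral>x. f x * cutoff R x \<partial>\<nu> k) - (\<integral>x. f x * cutoff R x \<partial>\<sigma>)\<bar> < e / 2"
      using LIMSEQ_D[of _ _ "e / 2"] e by fastforce
    show "\<exists>no. \<forall>n\<ge>no. norm ((\<integral>x. f x \<partial>\<nu> n) - (\<integral>x. f x \<partial>\<sigma>)) < e"
    proof (intro exI allI impI)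
      fix k assume "N \<le> k"
      from N[OF this] tail[OF \<nu>(1) K(1) R(1), of k] tail[OF \<sigma>(1) K(2) R(1)] R(2)
      show "norm ((\<integral>x. f x \<partial>\<nu> k) - (\<integral>x. f x \<partial>\<sigma>)) < e" unfolding real_norm_def by linarith
    qed
  qed
qed

section \<open>Energies and the role of the exponents\<close>

lemma shell_moment_class:
  assumes "0 \<le> r"
  shows "(spherical_shell r :: 'a::euclidean_space measure) \<in> moment_class \<alpha>"
    and "(\<integral>x. x \<partial>(spherical_shell r :: 'a measure)) = 0"
    and "second_moment (spherical_shell r :: 'a measure) = r\<^sup>2"
proof -
  let ?S = "spherical_shell r :: 'a measure"
  have p: "prob_space ?S" and s: "sets ?S = sets borel"
    using spherical_shell_prob[of r, where 'a='a] by (auto simp: prob_measures_def)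
  note [measurable_cong] = s
  interpret prob_space ?S by fact
  have AE: "AE x in ?S. norm x = r" using AE_spherical_shell[OF assms, where 'a='a] by simp
  have "integrable ?S (\<lambda>x. norm x powr \<alpha>)"
  proof (rule integrable_const_bound[where B="r powr \<alpha>"])
    show "AE x in ?S. norm (norm x powr \<alpha>) \<le> r powr \<alpha>" using AE by eventually_elim simp
  qed measurable
  then show "?S \<in> moment_class \<alpha>" using p s by (simp add: moment_class_def prob_measures_def)
  have "second_moment ?S = (\<integral>x. r\<^sup>2 \<partial>?S)"
  proof (rule integral_cong_AE)
    show "AE x in ?S. (norm x)\<^sup>2 = r\<^sup>2" using AE by eventually_elim simp
  qed measurable
  then show "second_moment ?S = r\<^sup>2" by (simp add: prob_space)
  have o: "orthogonal_transformation (\<lambda>y::'a. - y)"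
    by (simp add: orthogonal_transformation_neg orthogonal_transformation_id)
  have "(\<integral>x. x \<partial>?S) = (\<integral>x. x \<partial>distr ?S borel uminus)"
    by (simp add: spherical_shell_orthogonal[OF o])
  also have "\<dots> = - (\<integral>x. x \<partial>?S)" by (subst integral_distr) auto
  finally have "2 *\<^sub>R (\<integral>x. x \<partial>?S) = 0" by (simp add: scaleR_2 eq_neg_iff_add_eq_0)
  then show "(\<integral>x. x \<partial>?S) = 0" by simp
qed

text \<open>
  Twice the energy, as a real number, for measures whose \<open>\<alpha>\<close>-moment is finite.
\<close>

definition reduced_energy :: "real \<Rightarrow> real \<Rightarrow> 'a::euclidean_space measure \<Rightarrow> real" where
  "reduced_energy \<alpha> \<beta> \<mu> = pair_int (\<lambda>d. d powr \<alpha>) \<mu> \<mu> / \<alpha> - pair_int (\<lambda>d. d powr \<beta>) \<mu> \<mu> / \<beta>"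

lemma pair_int_eq_iterated:
  assumes "\<mu> \<in> moment_class \<alpha>" "\<nu> \<in> moment_class \<alpha>" "0 \<le> \<alpha>"
  shows "pair_int (\<lambda>d. d powr \<alpha>) \<mu> \<nu> = (\<integral>x. (\<integral>y. norm (x - y) powr \<alpha> \<partial>\<nu>) \<partial>\<mu>)"
    and "integrable \<mu> (\<lambda>x. \<integral>y. norm (x - y) powr \<alpha> \<partial>\<nu>)"
proof -
  interpret \<mu>: prob_space \<mu> using moment_classD(1)[OF assms(1)] .
  interpret \<nu>: prob_space \<nu> using moment_classD(1)[OF assms(2)] .
  interpret P: pair_prob_space \<mu> \<nu> ..
  have i: "integrable (\<mu> \<Otimes>\<^sub>M \<nu>) (\<lambda>(x, y). norm (x - y) powr \<alpha>)"
    using pair_integrable_powr[OF assms(1,2,3)] by (simp add: pair_integrable_def case_prod_unfold)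
  show "pair_int (\<lambda>d. d powr \<alpha>) \<mu> \<nu> = (\<integral>x. (\<integral>y. norm (x - y) powr \<alpha> \<partial>\<nu>) \<partial>\<mu>)"
    using P.integral_fst[OF i] by (simp add: pair_int_def case_prod_unfold)
  show "integrable \<mu> (\<lambda>x. \<integral>y. norm (x - y) powr \<alpha> \<partial>\<nu>)"
    using P.integrable_fst[OF i] .
qed

text \<open>
  Expansion of the energy about the shell. The first-order term is nonnegative by the Euler--Lagrange condition.
  The second-order term is the quadratic form on the difference, to which the squared distance contributes
  nothing since both measures are centred.
\<close>

lemma shell_energy_gap:
  fixes \<nu> :: "'a::euclidean_space measure"
  assumes \<alpha>: "2 < \<alpha>" and r: "0 < r"
    and le: "\<And>x::'a. c + \<alpha> / 2 * (norm x)\<^sup>2 \<le> shell_potential \<alpha> r x"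
    and eq: "\<And>x::'a. norm x = r \<Longrightarrow> shell_potential \<alpha> r x = c + \<alpha> / 2 * r\<^sup>2"
    and \<nu>: "\<nu> \<in> moment_class \<alpha>" "(\<integral>x. x \<partial>\<nu>) = 0"
  shows "pair_diff (\<lambda>d. d powr \<alpha>) \<nu> (spherical_shell r) / \<alpha>
    \<le> reduced_energy \<alpha> 2 \<nu> - reduced_energy \<alpha> 2 (spherical_shell r :: 'a measure)"
proof -
  let ?S = "spherical_shell r :: 'a measure" and ?J = "pair_int (\<lambda>d. d powr \<alpha>)"
  note S = shell_moment_class[OF less_imp_le[OF r], where 'a='a]
  interpret \<nu>: prob_space \<nu> using moment_classD(1)[OF \<nu>(1)] .
  interpret S: prob_space ?S using moment_classD(1)[OF S(1)] .
  define m where "m = second_moment \<nu>"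
  have sq: "integrable \<nu> (\<lambda>x. (norm x)\<^sup>2)" using moment_class_lower[OF \<nu>(1), of 2] \<alpha> by simp
  have "c + \<alpha> / 2 * m = (\<integral>x. c + \<alpha> / 2 * (norm x)\<^sup>2 \<partial>\<nu>)"
    using sq by (simp add: m_def \<nu>.prob_space)
  also have "\<dots> \<le> ?J \<nu> ?S"
    unfolding pair_int_eq_iterated(1)[OF \<nu>(1) S(1) order.trans[OF zero_le_numeral less_imp_le[OF \<alpha>]]]
    by (intro integral_mono pair_int_eq_iterated(2)[OF \<nu>(1) S(1)]) (use sq le \<alpha> in auto)
  finally have 1: "c + \<alpha> / 2 * m \<le> ?J \<nu> ?S" .
  have "?J ?S ?S = (\<integral>x. (\<integral>y. norm (x - y) powr \<alpha> \<partial>?S) \<partial>?S)"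
    using \<alpha> by (intro pair_int_eq_iterated(1) S) auto
  also have "\<dots> = (\<integral>x. c + \<alpha> / 2 * r\<^sup>2 \<partial>?S)"
  proof (rule integral_cong_AE)
    show "AE x in ?S. (\<integral>y. norm (x - y) powr \<alpha> \<partial>?S) = c + \<alpha> / 2 * r\<^sup>2"
      using AE_spherical_shell[OF less_imp_le[OF r], where 'a='a] by eventually_elim (simp add: eq)
    show "(\<lambda>x. \<integral>y. norm (x - y) powr \<alpha> \<partial>?S) \<in> borel_measurable ?S"
      using pair_int_eq_iterated(2)[OF S(1) S(1)] \<alpha> by (intro borel_measurable_integrable) auto
  qed simp
  finally have 2: "?J ?S ?S = c + \<alpha> / 2 * r\<^sup>2" by (simp add: S.prob_space)
  have sq_powr: "pair_int (\<lambda>d. d powr 2) \<rho> \<rho> = pair_int (\<lambda>d. d\<^sup>2) \<rho> \<rho>" for \<rho> :: "'a measure"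
    by (simp add: pair_int_def)
  have 3: "pair_int (\<lambda>d. d powr 2) \<nu> \<nu> = 2 * m"
    unfolding sq_powr using pair_int_square[OF \<nu>(1) \<nu>(1) _ \<nu>(2)] \<alpha> by (simp add: m_def)
  have 4: "pair_int (\<lambda>d. d powr 2) ?S ?S = 2 * r\<^sup>2"
    unfolding sq_powr using pair_int_square[OF S(1) S(1) less_imp_le[OF \<alpha>] S(2)] by (simp add: S(3))
  have "reduced_energy \<alpha> 2 \<nu> - reduced_energy \<alpha> 2 ?S - pair_diff (\<lambda>d. d powr \<alpha>) \<nu> ?S / \<alpha>
      = 2 / \<alpha> * (?J \<nu> ?S - ?J ?S ?S) - (m - r\<^sup>2)"
    by (simp add: reduced_energy_def pair_diff_def 3 4 add_divide_distrib diff_divide_distrib algebra_simps)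
  also have "\<dots> \<ge> 2 / \<alpha> * (\<alpha> / 2 * m - \<alpha> / 2 * r\<^sup>2) - (m - r\<^sup>2)"
    using 1 2 \<alpha> by (intro diff_right_mono mult_left_mono) auto
  also have "2 / \<alpha> * (\<alpha> / 2 * m - \<alpha> / 2 * r\<^sup>2) - (m - r\<^sup>2) = 0"
    using \<alpha> by (simp add: field_simps)
  finally show ?thesis by simp
qed

text \<open>
  The constant is the value of the left-hand side at the point where it equals \<open>d powr \<alpha> / (2 * \<alpha>)\<close>.
\<close>

lemma absorb_lower_power:
  fixes \<alpha> \<beta> :: real
  assumes "0 < \<beta>" "\<beta> < \<alpha>"
  obtains K where "0 \<le> K" "\<And>d. 0 \<le> d \<Longrightarrow> d powr \<beta> / \<beta> \<le> d powr \<alpha> / (2 * \<alpha>) + K"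
proof -
  define R where "R = (2 * \<alpha> / \<beta>) powr (1 / (\<alpha> - \<beta>))"
  have R: "R powr (\<alpha> - \<beta>) = 2 * \<alpha> / \<beta>" unfolding R_def powr_powr using assms by simp
  show ?thesis
  proof (rule that[of "R powr \<beta> / \<beta>"])
    show "0 \<le> R powr \<beta> / \<beta>" using assms by simp
    fix d :: real assume d: "0 \<le> d"
    show "d powr \<beta> / \<beta> \<le> d powr \<alpha> / (2 * \<alpha>) + R powr \<beta> / \<beta>"
    proof (cases "d \<le> R")
      case True
      then have "d powr \<beta> \<le> R powr \<beta>" using d assms by (intro powr_mono2) auto
      then have "d powr \<beta> / \<beta> \<le> R powr \<beta> / \<beta>" using assms by (intro divide_right_mono) auto
      moreover have "0 \<le> d powr \<alpha> / (2 * \<alpha>)" using assms by simp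
      ultimately show ?thesis by linarith
    next
      case False
      have "R powr (\<alpha> - \<beta>) \<le> d powr (\<alpha> - \<beta>)" using False assms by (intro powr_mono2) (auto simp: R_def)
      then have "d powr \<beta> * (2 * \<alpha> / \<beta>) \<le> d powr \<beta> * d powr (\<alpha> - \<beta>)" unfolding R by (rule mult_left_mono) simp
      also have "\<dots> = d powr \<alpha>" unfolding powr_add[symmetric] by simp
      finally have "d powr \<beta> / \<beta> \<le> d powr \<alpha> / (2 * \<alpha>)" using assms by (simp add: field_simps)
      moreover have "0 \<le> R powr \<beta> / \<beta>" using assms by simp
      ultimately show ?thesis by linarith
    qed
  qed
qed

text \<open>
  The negative part of the potential is bounded, so finite energy means that its positive part is integrable, and
  this part controls \<open>d powr \<alpha>\<close> up to a constant.
\<close>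

lemma finite_energy_pair_integrable:
  fixes \<mu> :: "'a::euclidean_space measure"
  assumes \<mu>: "\<mu> \<in> prob_measures" and \<beta>: "0 < \<beta>" "\<beta> < \<alpha>" and fin: "energy \<alpha> \<beta> \<mu> < \<infinity>"
  shows "pair_integrable (\<lambda>d. d powr \<alpha>) \<mu> \<mu>"
proof -
  have p: "prob_space \<mu>" and s: "sets \<mu> = sets borel" using \<mu> by (auto simp: prob_measures_def)
  note [measurable_cong] = s
  interpret prob_space \<mu> by fact
  interpret P: pair_prob_space \<mu> \<mu> ..
  let ?V = "\<lambda>z::'a \<times> 'a. pair_potential \<alpha> \<beta> (fst z) (snd z)"
  have [measurable]: "?V \<in> borel_measurable (\<mu> \<Otimes>\<^sub>M \<mu>)" unfolding pair_potential_def by measurable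
  let ?P = "\<integral>\<^sup>+z. ennreal (?V z) \<partial>(\<mu> \<Otimes>\<^sub>M \<mu>)" and ?N = "\<integral>\<^sup>+z. ennreal (- ?V z) \<partial>(\<mu> \<Otimes>\<^sub>M \<mu>)"
  have "?N \<le> (\<integral>\<^sup>+z. ennreal (1 / \<beta> - 1 / \<alpha>) \<partial>(\<mu> \<Otimes>\<^sub>M \<mu>))"
    using pair_potential_ge[OF \<beta>(2,1)] by (intro nn_integral_mono ennreal_leI) (simp add: algebra_simps)
  also have "\<dots> < \<infinity>" by (simp add: P.P.emeasure_space_1)
  finally have N: "?N < \<infinity>" .
  have "?P \<noteq> \<infinity>"
  proof
    assume "?P = \<infinity>"
    then have "energy \<alpha> \<beta> \<mu> = \<infinity>" using N by (cases "?N") (auto simp: energy_def case_prod_unfold)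
    then show False using fin by simp
  qed
  then have Pfin: "?P < \<infinity>" by (simp add: less_top)
  obtain K where K: "0 \<le> K" "\<And>d. 0 \<le> d \<Longrightarrow> d powr \<beta> / \<beta> \<le> d powr \<alpha> / (2 * \<alpha>) + K"
    using absorb_lower_power[OF \<beta>] by metis
  have "(\<integral>\<^sup>+z. ennreal (norm (norm (fst z - snd z) powr \<alpha>)) \<partial>(\<mu> \<Otimes>\<^sub>M \<mu>))
      \<le> (\<integral>\<^sup>+z. ennreal (2 * \<alpha>) * ennreal (?V z) + ennreal (2 * \<alpha> * K) \<partial>(\<mu> \<Otimes>\<^sub>M \<mu>))"
  proof (rule nn_integral_mono)
    fix z :: "'a \<times> 'a"
    define d where "d = norm (fst z - snd z)"
    have "d powr \<alpha> / (2 * \<alpha>) \<le> ?V z + K" using K(2)[of d] by (simp add: d_def pair_potential_def)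
    then have "d powr \<alpha> \<le> 2 * \<alpha> * ?V z + 2 * \<alpha> * K" using \<beta> by (simp add: divide_le_eq algebra_simps)
    then have "ennreal (d powr \<alpha>) \<le> ennreal (2 * \<alpha> * ?V z + 2 * \<alpha> * K)" by (rule ennreal_leI)
    also have "\<dots> \<le> ennreal (2 * \<alpha> * ?V z) + ennreal (2 * \<alpha> * K)"
    proof (cases "0 \<le> 2 * \<alpha> * ?V z")
      case True
      then show ?thesis using K(1) \<beta> by (simp add: ennreal_plus)
    next
      case False
      then have "ennreal (2 * \<alpha> * ?V z + 2 * \<alpha> * K) \<le> ennreal (2 * \<alpha> * K)" by (intro ennreal_leI) simp
      then show ?thesis by (rule order.trans) (simp add: add_increasing)
    qed
    also have "ennreal (2 * \<alpha> * ?V z) = ennreal (2 * \<alpha>) * ennreal (?V z)"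
      using \<beta> by (intro ennreal_mult') simp
    finally show "ennreal (norm (norm (fst z - snd z) powr \<alpha>)) \<le> ennreal (2 * \<alpha>) * ennreal (?V z) + ennreal (2 * \<alpha> * K)"
      by (simp add: d_def)
  qed
  also have "\<dots> = ennreal (2 * \<alpha>) * ?P + ennreal (2 * \<alpha> * K)"
    by (simp add: nn_integral_add nn_integral_cmult P.P.emeasure_space_1)
  also have "\<dots> < \<infinity>" using Pfin by (simp add: ennreal_mult_less_top)
  finally show ?thesis
    unfolding pair_integrable_def by (intro integrableI_bounded) measurable
qed

text \<open>
  By Fubini the moment about almost every point is finite; one such point suffices.
\<close>

lemma moment_class_of_pair_integrable:
  fixes \<mu> :: "'a::euclidean_space measure"
  assumes \<mu>: "\<mu> \<in> prob_measures" and i: "pair_integrable (\<lambda>d. d powr \<alpha>) \<mu> \<mu>" and \<alpha>: "0 \<le> \<alpha>"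
  shows "\<mu> \<in> moment_class \<alpha>"
proof -
  have p: "prob_space \<mu>" and s: "sets \<mu> = sets borel" using \<mu> by (auto simp: prob_measures_def)
  note [measurable_cong] = s
  interpret prob_space \<mu> by fact
  interpret P: pair_prob_space \<mu> \<mu> ..
  have "AE x in \<mu>. integrable \<mu> (\<lambda>y. norm (x - y) powr \<alpha>)"
    using P.AE_integrable_fst'[OF i[unfolded pair_integrable_def]] by simp
  then obtain x0 where x0: "integrable \<mu> (\<lambda>y. norm (x0 - y) powr \<alpha>)"
    using AE_False eventually_mono[of _ "ae_filter \<mu>" "\<lambda>_. False"] by blast
  have "integrable \<mu> (\<lambda>y. norm y powr \<alpha>)"
  proof (rule Bochner_Integration.integrable_bound)
    show "integrable \<mu> (\<lambda>y. 2 powr \<alpha> * (norm x0 powr \<alpha> + norm (x0 - y) powr \<alpha>))" using x0 by simp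
    show "AE y in \<mu>. norm (norm y powr \<alpha>) \<le> norm (2 powr \<alpha> * (norm x0 powr \<alpha> + norm (x0 - y) powr \<alpha>))"
      using norm_diff_powr_le[OF \<alpha>, of x0 "x0 - _"] by (intro AE_I2) simp
  qed measurable
  then show ?thesis using \<mu> by (simp add: moment_class_def)
qed

lemma centred_moment_class:
  fixes \<mu> :: "'a::euclidean_space measure"
  assumes \<mu>: "\<mu> \<in> moment_class \<alpha>" and \<alpha>: "1 \<le> \<alpha>"
  shows "centred \<mu> \<in> moment_class \<alpha>" and "(\<integral>x. x \<partial>centred \<mu>) = 0"
    and "f \<in> borel_measurable borel \<Longrightarrow> pair_int f (centred \<mu>) (centred \<mu>) = pair_int f \<mu> \<mu>"
proof -
  note [measurable_cong] = moment_classD(2)[OF \<mu>]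
  interpret prob_space \<mu> using moment_classD(1)[OF \<mu>] .
  define m where "m = (\<integral>y. y \<partial>\<mu>)"
  have c: "centred \<mu> = distr \<mu> borel (\<lambda>x. x - m)" by (simp add: centred_def m_def)
  have pc: "prob_space (centred \<mu>)" unfolding c by (rule prob_space_distr) measurable
  have "integrable \<mu> (\<lambda>x. norm (x - m) powr \<alpha>)"
  proof (rule Bochner_Integration.integrable_bound)
    show "integrable \<mu> (\<lambda>y. 2 powr \<alpha> * (norm y powr \<alpha> + norm m powr \<alpha>))"
      using moment_classD(3)[OF \<mu>] by simp
    show "AE y in \<mu>. norm (norm (y - m) powr \<alpha>) \<le> norm (2 powr \<alpha> * (norm y powr \<alpha> + norm m powr \<alpha>))"
      using norm_diff_powr_le[of \<alpha> _ m] \<alpha> by (intro AE_I2) simp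
  qed measurable
  then have "integrable (centred \<mu>) (\<lambda>x. norm x powr \<alpha>)"
    unfolding c by (subst integrable_distr_eq) auto
  then show cm: "centred \<mu> \<in> moment_class \<alpha>"
    using pc by (simp add: moment_class_def prob_measures_def) (simp add: c)
  have "(\<integral>x. x \<partial>centred \<mu>) = (\<integral>x. x - m \<partial>\<mu>)" unfolding c by (rule integral_distr) auto
  also have "\<dots> = 0" using moment_class_mean[OF \<mu> \<alpha>] by (simp add: m_def prob_space)
  finally show "(\<integral>x. x \<partial>centred \<mu>) = 0" .
  assume [measurable]: "f \<in> borel_measurable borel"
  have sfc: "sigma_finite_measure (distr \<mu> borel (\<lambda>x. x - m))"
    using pc unfolding c by (simp add: prob_space_imp_sigma_finite)
  have "pair_int f (centred \<mu>) (centred \<mu>)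
      = (\<integral>z. f (norm (fst z - snd z)) \<partial>distr (\<mu> \<Otimes>\<^sub>M \<mu>) (borel \<Otimes>\<^sub>M borel) (\<lambda>(x, y). (x - m, y - m)))"
    unfolding pair_int_def c by (subst pair_measure_distr[OF _ _ sfc]) auto
  also have "\<dots> = pair_int f \<mu> \<mu>"
    unfolding pair_int_def by (subst integral_distr) (auto simp: case_prod_unfold)
  finally show "pair_int f (centred \<mu>) (centred \<mu>) = pair_int f \<mu> \<mu>" .
qed

lemma energy_eq_reduced_energy:
  fixes \<mu> :: "'a::euclidean_space measure"
  assumes \<mu>: "\<mu> \<in> moment_class \<alpha>" and \<beta>: "0 < \<beta>" "\<beta> < \<alpha>"
  shows "energy \<alpha> \<beta> \<mu> = ereal (1 / 2 * reduced_energy \<alpha> \<beta> \<mu>)"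
proof -
  have a: "pair_integrable (\<lambda>d. d powr \<alpha>) \<mu> \<mu>" and b: "pair_integrable (\<lambda>d. d powr \<beta>) \<mu> \<mu>"
    using pair_integrable_powr[OF \<mu> \<mu>] \<beta> by auto
  have "integrable (\<mu> \<Otimes>\<^sub>M \<mu>) (\<lambda>(x, y). pair_potential \<alpha> \<beta> x y)"
    using a b by (simp add: pair_integrable_def pair_potential_def case_prod_unfold)
  then have "energy \<alpha> \<beta> \<mu> = ereal (1 / 2 * (\<integral>(x, y). pair_potential \<alpha> \<beta> x y \<partial>(\<mu> \<Otimes>\<^sub>M \<mu>)))"
    by (rule energy_eq_integral)
  also have "(\<integral>(x, y). pair_potential \<alpha> \<beta> x y \<partial>(\<mu> \<Otimes>\<^sub>M \<mu>)) = reduced_energy \<alpha> \<beta> \<mu>"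
    using a b by (simp add: pair_integrable_def pair_potential_def case_prod_unfold reduced_energy_def pair_int_def)
  finally show ?thesis .
qed

text \<open>
  Young's inequality for \<open>\<beta> = \<theta> * \<alpha> + (1 - \<theta>) * 2\<close>.
\<close>

lemma powr_interpolation:
  fixes d :: real
  assumes "0 \<le> d" "2 < \<beta>" "\<beta> < \<alpha>"
  shows "d powr \<beta> / \<beta> \<le> d powr 2 / 2 + (\<beta> - 2) / (\<alpha> - 2) * d powr \<alpha> / 2"
proof (cases "d = 0")
  case False
  define \<theta> where "\<theta> = (\<beta> - 2) / (\<alpha> - 2)"
  have \<theta>: "0 \<le> \<theta>" "\<theta> \<le> 1" "\<alpha> * \<theta> + 2 * (1 - \<theta>) = \<beta>"
  proof -
    show "0 \<le> \<theta>" "\<theta> \<le> 1" using assms by (auto simp: \<theta>_def divide_le_eq)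
    have "\<theta> * (\<alpha> - 2) = \<beta> - 2" using assms by (simp add: \<theta>_def)
    then show "\<alpha> * \<theta> + 2 * (1 - \<theta>) = \<beta>" by (simp add: algebra_simps)
  qed
  have "(d powr \<alpha>) powr \<theta> * (d powr 2) powr (1 - \<theta>) \<le> \<theta> * d powr \<alpha> + (1 - \<theta>) * d powr 2"
    by (rule Youngs_inequality_0) (use \<theta> False assms in auto)
  also have "(d powr \<alpha>) powr \<theta> * (d powr 2) powr (1 - \<theta>) = d powr \<beta>"
    unfolding powr_powr powr_add[symmetric] \<theta>(3) ..
  also have "\<theta> * d powr \<alpha> + (1 - \<theta>) * d powr 2 \<le> \<theta> * d powr \<alpha> + d powr 2"
    using \<theta> by (intro add_left_mono mult_left_le_one_le) auto
  finally have "d powr \<beta> / 2 \<le> d powr 2 / 2 + \<theta> * d powr \<alpha> / 2" by simp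
  moreover have "d powr \<beta> / \<beta> \<le> d powr \<beta> / 2" using assms by (intro divide_left_mono) auto
  ultimately have "d powr \<beta> / \<beta> \<le> d powr 2 / 2 + \<theta> * d powr \<alpha> / 2" by linarith
  then show ?thesis unfolding \<theta>_def .
qed simp

lemma pair_int_mono:
  assumes "pair_integrable f \<mu> \<nu>" "pair_integrable g \<mu> \<nu>" "\<And>d. 0 \<le> d \<Longrightarrow> f d \<le> g d"
  shows "pair_int f \<mu> \<nu> \<le> pair_int g \<mu> \<nu>"
  unfolding pair_int_def using assms by (intro integral_mono) (auto simp: pair_integrable_def)

lemma pair_integrable_const:
  assumes "prob_space \<mu>" "prob_space \<nu>"
  shows "pair_integrable (\<lambda>_. c) \<mu> \<nu>" "pair_int (\<lambda>_. c) \<mu> \<nu> = c"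
proof -
  interpret \<mu>: prob_space \<mu> by fact
  interpret \<nu>: prob_space \<nu> by fact
  interpret P: pair_prob_space \<mu> \<nu> ..
  show "pair_integrable (\<lambda>_. c) \<mu> \<nu>" "pair_int (\<lambda>_. c) \<mu> \<nu> = c"
    by (simp_all add: pair_integrable_def pair_int_def P.P.prob_space)
qed

text \<open>
  The two estimates have different uses. The first is applied to minimizers: it carries the \<open>\<alpha>\<close>-moment, with a
  factor that tends to \<open>0\<close> as \<open>\<beta>\<close> tends to \<open>2\<close>. The second is applied to the competing shell and
  is the lower bound on the pair potential with exponents \<open>(\<beta>, 2)\<close>.
\<close>

lemma reduced_energy_comparison:
  fixes \<mu> :: "'a::euclidean_space measure"
  assumes \<mu>: "\<mu> \<in> moment_class \<alpha>" and \<beta>: "2 < \<beta>" "\<beta> < \<alpha>"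
  shows "reduced_energy \<alpha> 2 \<mu> \<le> reduced_energy \<alpha> \<beta> \<mu> + (\<beta> - 2) / (\<alpha> - 2) / 2 * pair_int (\<lambda>d. d powr \<alpha>) \<mu> \<mu>"
    and "reduced_energy \<alpha> \<beta> \<mu> \<le> reduced_energy \<alpha> 2 \<mu> + (1 / 2 - 1 / \<beta>)"
proof -
  let ?J = "\<lambda>p. pair_int (\<lambda>d. d powr p) \<mu> \<mu>"
  define \<theta> where "\<theta> = (\<beta> - 2) / (\<alpha> - 2) / 2"
  have i: "pair_integrable (\<lambda>d. d powr p) \<mu> \<mu>" if "0 \<le> p" "p \<le> \<alpha>" for p
    using pair_integrable_powr[OF \<mu> \<mu> that] .
  have ia: "pair_integrable (\<lambda>d. d powr \<alpha>) \<mu> \<mu>" and ib: "pair_integrable (\<lambda>d. d powr \<beta>) \<mu> \<mu>"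
    and i2: "pair_integrable (\<lambda>d. d powr 2) \<mu> \<mu>" using \<beta> by (auto intro!: i)
  note p = moment_classD(1)[OF \<mu>]
  have "pair_int (\<lambda>d. 1 / \<beta> * d powr \<beta> + 0 * d powr \<beta>) \<mu> \<mu> \<le> pair_int (\<lambda>d. 1 / 2 * d powr 2 + \<theta> * d powr \<alpha>) \<mu> \<mu>"
    using powr_interpolation[OF _ \<beta>] by (intro pair_int_mono pair_int_linear ia ib i2) (simp add: \<theta>_def)
  then have "?J \<beta> / \<beta> \<le> ?J 2 / 2 + \<theta> * ?J \<alpha>"
    unfolding pair_int_linear(2)[OF ib ib] pair_int_linear(2)[OF i2 ia] by simp
  then show "reduced_energy \<alpha> 2 \<mu> \<le> reduced_energy \<alpha> \<beta> \<mu> + (\<beta> - 2) / (\<alpha> - 2) / 2 * ?J \<alpha>"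
    unfolding reduced_energy_def \<theta>_def by linarith
  have pp: "1 / 2 * d powr 2 + (-1) * (1 / 2 - 1 / \<beta>) \<le> 1 / \<beta> * d powr \<beta> + 0 * d powr \<beta>" if "0 \<le> d" for d
    using pair_potential_ge[of 2 \<beta> d 0] that \<beta> by (simp add: pair_potential_def)
  have "pair_int (\<lambda>d. 1 / 2 * d powr 2 + (-1) * (1 / 2 - 1 / \<beta>)) \<mu> \<mu> \<le> pair_int (\<lambda>d. 1 / \<beta> * d powr \<beta> + 0 * d powr \<beta>) \<mu> \<mu>"
    by (intro pair_int_mono pair_int_linear ib i2 pair_integrable_const p pp)
  then have "?J 2 / 2 - (1 / 2 - 1 / \<beta>) \<le> ?J \<beta> / \<beta>"
    unfolding pair_int_linear(2)[OF ib ib] pair_int_linear(2)[OF i2 pair_integrable_const(1)[OF p p]]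
      pair_integrable_const(2)[OF p p] by simp
  then show "reduced_energy \<alpha> \<beta> \<mu> \<le> reduced_energy \<alpha> 2 \<mu> + (1 / 2 - 1 / \<beta>)"
    unfolding reduced_energy_def by linarith
qed

lemma reduced_energy_coercive:
  fixes \<mu> :: "'a::euclidean_space measure"
  assumes \<mu>: "\<mu> \<in> moment_class \<alpha>" and \<alpha>: "2 < \<alpha>"
    and K: "\<And>d. 0 \<le> d \<Longrightarrow> d powr 2 / 2 \<le> d powr \<alpha> / (2 * \<alpha>) + K"
  shows "pair_int (\<lambda>d. d powr \<alpha>) \<mu> \<mu> / (2 * \<alpha>) - K \<le> reduced_energy \<alpha> 2 \<mu>"
proof -
  note p = moment_classD(1)[OF \<mu>]
  have ia: "pair_integrable (\<lambda>d. d powr \<alpha>) \<mu> \<mu>" and i2: "pair_integrable (\<lambda>d. d powr 2) \<mu> \<mu>"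
    using pair_integrable_powr[OF \<mu> \<mu>] \<alpha> by auto
  have K': "1 / 2 * d powr 2 + 0 * d powr 2 \<le> 1 / (2 * \<alpha>) * d powr \<alpha> + 1 * K" if "0 \<le> d" for d
    using K[OF that] by simp
  have "pair_int (\<lambda>d. 1 / 2 * d powr 2 + 0 * d powr 2) \<mu> \<mu> \<le> pair_int (\<lambda>d. 1 / (2 * \<alpha>) * d powr \<alpha> + 1 * K) \<mu> \<mu>"
    by (intro pair_int_mono pair_int_linear ia i2 pair_integrable_const p K')
  then have "pair_int (\<lambda>d. d powr 2) \<mu> \<mu> / 2 \<le> pair_int (\<lambda>d. d powr \<alpha>) \<mu> \<mu> / (2 * \<alpha>) + K"
    unfolding pair_int_linear(2)[OF i2 i2] pair_int_linear(2)[OF ia pair_integrable_const(1)[OF p p]]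
      pair_integrable_const(2)[OF p p] by simp
  moreover have "pair_int (\<lambda>d. d powr \<alpha>) \<mu> \<mu> / \<alpha> = 2 * (pair_int (\<lambda>d. d powr \<alpha>) \<mu> \<mu> / (2 * \<alpha>))" by simp
  ultimately show ?thesis unfolding reduced_energy_def by linarith
qed

lemma energy_minimizerD:
  fixes \<mu> \<sigma> :: "'a::euclidean_space measure"
  assumes \<mu>: "\<mu> \<in> energy_minimizers \<alpha> \<beta>" and \<beta>: "0 < \<beta>" "\<beta> < \<alpha>" and \<alpha>: "1 \<le> \<alpha>" and \<sigma>: "\<sigma> \<in> moment_class \<alpha>"
  shows "centred \<mu> \<in> moment_class \<alpha>" "(\<integral>x. x \<partial>centred \<mu>) = 0"
    and "reduced_energy \<alpha> \<beta> (centred \<mu>) \<le> reduced_energy \<alpha> \<beta> \<sigma>"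
proof -
  have \<mu>p: "\<mu> \<in> prob_measures" and min: "\<And>\<nu> :: 'a measure. \<nu> \<in> prob_measures \<Longrightarrow> energy \<alpha> \<beta> \<mu> \<le> energy \<alpha> \<beta> \<nu>"
    using \<mu> by (auto simp: energy_minimizers_def is_arg_min_def not_less)
  have \<sigma>p: "\<sigma> \<in> prob_measures" using \<sigma> by (simp add: moment_class_def)
  have le: "energy \<alpha> \<beta> \<mu> \<le> ereal (1 / 2 * reduced_energy \<alpha> \<beta> \<sigma>)"
    using min[OF \<sigma>p] energy_eq_reduced_energy[OF \<sigma> \<beta>] by simp
  then have "energy \<alpha> \<beta> \<mu> < \<infinity>" by (rule le_less_trans) simp
  then have \<mu>m: "\<mu> \<in> moment_class \<alpha>"
    using finite_energy_pair_integrable[OF \<mu>p \<beta>] moment_class_of_pair_integrable[OF \<mu>p] \<alpha> by simp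
  show "centred \<mu> \<in> moment_class \<alpha>" "(\<integral>x. x \<partial>centred \<mu>) = 0"
    using centred_moment_class(1,2)[OF \<mu>m \<alpha>] by auto
  have "reduced_energy \<alpha> \<beta> (centred \<mu>) = reduced_energy \<alpha> \<beta> \<mu>"
    unfolding reduced_energy_def by (subst (1 2) centred_moment_class(3)[OF \<mu>m \<alpha>]) auto
  then show "reduced_energy \<alpha> \<beta> (centred \<mu>) \<le> reduced_energy \<alpha> \<beta> \<sigma>"
    using le energy_eq_reduced_energy[OF \<mu>m \<beta>] by simp
qed

section \<open>Convergence of the centred minimizers\<close>

text \<open>
  Comparing each minimizer with the shell bounds the excess \<open>reduced_energy \<alpha> 2 (\<nu> k) - W\<close> by \<open>\<theta> k\<close> times the
  \<open>\<alpha>\<close>-moment plus a null sequence. Coercivity turns this into a uniform bound on the moments once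
  \<open>\<theta> k\<close> is below \<open>1 / (4 * \<alpha>)\<close>, which is why the first \<open>N\<close> terms are dropped. Hence the
  excess tends to \<open>0\<close>, and \<open>shell_energy_gap\<close> passes this on to the quadratic form.
\<close>

lemma centred_minimizers_converge:
  fixes \<mu> :: "nat \<Rightarrow> 'a::euclidean_space measure"
  assumes dim: "DIM('a) \<ge> 2" and \<alpha>: "2 < \<alpha>" "\<alpha> < 4"
    and \<beta>: "\<And>k. 2 < \<beta> k" "\<And>k. \<beta> k < \<alpha>" and lim: "\<beta> \<longlonglongrightarrow> 2"
    and min: "\<And>k. \<mu> k \<in> energy_minimizers \<alpha> (\<beta> k)"
  obtains r N where "0 \<le> r" "weakly_converges (\<lambda>k. centred (\<mu> (k + N))) (spherical_shell r)"
proof -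
  obtain r c where r: "0 < r"
    and le: "\<And>x::'a. c + \<alpha> / 2 * (norm x)\<^sup>2 \<le> shell_potential \<alpha> r x"
    and eq: "\<And>x::'a. norm x = r \<Longrightarrow> shell_potential \<alpha> r x = c + \<alpha> / 2 * r\<^sup>2"
    using shell_Euler_Lagrange[OF dim \<alpha>(1)] by metis
  let ?S = "spherical_shell r :: 'a measure" and ?J = "\<lambda>\<mu>. pair_int (\<lambda>d. d powr \<alpha>) \<mu> \<mu>"
  note S = shell_moment_class[OF less_imp_le[OF r], where 'a='a]
  have \<alpha>1: "1 \<le> \<alpha>" using \<alpha> by simp
  have \<beta>0: "0 < \<beta> k" for k using \<beta>(1)[of k] by simp
  define \<nu> where "\<nu> = (\<lambda>k. centred (\<mu> k))"
  have \<nu>: "\<nu> k \<in> moment_class \<alpha>" "(\<integral>x. x \<partial>\<nu> k) = 0"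
     "reduced_energy \<alpha> (\<beta> k) (\<nu> k) \<le> reduced_energy \<alpha> (\<beta> k) ?S" for k
    unfolding \<nu>_def using energy_minimizerD[OF min \<beta>0 \<beta>(2) \<alpha>1 S(1)] by auto
  define \<theta> where "\<theta> = (\<lambda>k. (\<beta> k - 2) / (\<alpha> - 2) / 2)"
  have \<theta>lim: "\<theta> \<longlonglongrightarrow> 0"
    unfolding \<theta>_def using \<alpha> by (auto intro!: tendsto_eq_intros lim)
  define W where "W = reduced_energy \<alpha> 2 ?S"
  have gap: "reduced_energy \<alpha> 2 (\<nu> k) - W \<le> \<theta> k * ?J (\<nu> k) + (1 / 2 - 1 / \<beta> k)" for k
    using \<nu>(3)[of k] reduced_energy_comparison(1)[OF \<nu>(1) \<beta>(1) \<beta>(2), of k k]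
      reduced_energy_comparison(2)[OF S(1) \<beta>(1) \<beta>(2), of k]
    unfolding W_def \<theta>_def by linarith
  have "0 < (2::real)" "2 < \<alpha>" using \<alpha> by auto
  from absorb_lower_power[OF this] obtain K where K: "0 \<le> K" "\<And>d. 0 \<le> d \<Longrightarrow> d powr 2 / 2 \<le> d powr \<alpha> / (2 * \<alpha>) + K"
    by metis
  have J0: "0 \<le> ?J \<rho>" for \<rho> :: "'a measure"
    unfolding pair_int_def by (rule Bochner_Integration.integral_nonneg) simp
  have "eventually (\<lambda>k. \<theta> k < 1 / (4 * \<alpha>)) sequentially"
    by (rule order_tendstoD(2)[OF \<theta>lim]) (use \<alpha> in simp)
  then obtain N where N: "\<And>k. N \<le> k \<Longrightarrow> \<theta> k < 1 / (4 * \<alpha>)" by (auto simp: eventually_sequentially)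
  define B where "B = 4 * \<alpha> * (K + W + 1 / 2)"
  have JB: "?J (\<nu> k) \<le> B" if "N \<le> k" for k
  proof -
    have "?J (\<nu> k) / (2 * \<alpha>) - K \<le> reduced_energy \<alpha> 2 (\<nu> k)"
      by (rule reduced_energy_coercive[OF \<nu>(1) \<alpha>(1) K(2)])
    moreover have "\<theta> k * ?J (\<nu> k) \<le> 1 / (4 * \<alpha>) * ?J (\<nu> k)"
      using N[OF that] J0 by (intro mult_right_mono) auto
    moreover have "0 \<le> 1 / \<beta> k" using \<beta>0[of k] by simp
    moreover have "?J (\<nu> k) / (2 * \<alpha>) = 2 * (1 / (4 * \<alpha>) * ?J (\<nu> k))" by simp
    ultimately have "1 / (4 * \<alpha>) * ?J (\<nu> k) \<le> K + W + 1 / 2" using gap[of k] by linarith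
    then show ?thesis using \<alpha> by (simp add: B_def divide_le_eq mult_ac)
  qed
  have B0: "0 \<le> B" using JB[of N] J0[of "\<nu> N"] by simp
  have D0: "0 \<le> pair_diff (\<lambda>d. d powr \<alpha>) (\<nu> k) ?S" for k
    by (rule pair_diff_powr_nonneg[OF \<nu>(1) S(1) \<alpha> \<nu>(2) S(2)])
  have D: "pair_diff (\<lambda>d. d powr \<alpha>) (\<nu> k) ?S \<le> \<alpha> * (\<theta> k * B + (1 / 2 - 1 / \<beta> k))" if "N \<le> k" for k
  proof -
    have "0 \<le> \<theta> k" using \<beta>(1)[of k] \<alpha> by (simp add: \<theta>_def)
    then have "\<theta> k * ?J (\<nu> k) \<le> \<theta> k * B" using JB[OF that] by (intro mult_left_mono)
    moreover have "pair_diff (\<lambda>d. d powr \<alpha>) (\<nu> k) ?S / \<alpha> \<le> reduced_energy \<alpha> 2 (\<nu> k) - W"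
      unfolding W_def by (rule shell_energy_gap[OF \<alpha>(1) r le eq \<nu>(1,2)])
    ultimately have "pair_diff (\<lambda>d. d powr \<alpha>) (\<nu> k) ?S / \<alpha> \<le> \<theta> k * B + (1 / 2 - 1 / \<beta> k)"
      using gap[of k] by linarith
    then show ?thesis using \<alpha> by (simp add: divide_le_eq mult.commute)
  qed
  have lim0: "(\<lambda>k. \<alpha> * (\<theta> k * B + (1 / 2 - 1 / \<beta> k))) \<longlonglongrightarrow> 0"
    by (auto intro!: tendsto_eq_intros lim \<theta>lim)
  have Dlim: "(\<lambda>k. pair_diff (\<lambda>d. d powr \<alpha>) (\<nu> k) ?S) \<longlonglongrightarrow> 0"
    by (rule tendsto_sandwich[OF _ _ tendsto_const lim0])
      (use D0 D in \<open>auto simp: eventually_sequentially\<close>)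
  have m2: "second_moment (\<nu> (k + N)) \<le> 1 + B" for k
  proof -
    let ?\<nu> = "\<nu> (k + N)"
    note p = moment_classD(1)[OF \<nu>(1)[of "k + N"]]
    have ia: "pair_integrable (\<lambda>d. d powr \<alpha>) ?\<nu> ?\<nu>" and i2: "pair_integrable (\<lambda>d. d powr 2) ?\<nu> ?\<nu>"
      using pair_integrable_powr[OF \<nu>(1) \<nu>(1), of _ "k + N" "k + N"] \<alpha> by auto
    have "2 * second_moment ?\<nu> = pair_int (\<lambda>d. d\<^sup>2) ?\<nu> ?\<nu>"
      using pair_int_square[OF \<nu>(1) \<nu>(1) _ \<nu>(2), of "k + N" "k + N"] \<alpha> by simp
    also have "\<dots> = pair_int (\<lambda>d. d powr 2) ?\<nu> ?\<nu>" by (simp add: pair_int_def)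
    also have "\<dots> \<le> pair_int (\<lambda>d. 1 * d powr \<alpha> + 1 * 1) ?\<nu> ?\<nu>"
      using powr_le_1_plus[of _ 2 \<alpha>] \<alpha>
      by (intro pair_int_mono pair_int_linear ia i2 pair_integrable_const p) (simp add: add.commute)
    also have "\<dots> = ?J ?\<nu> + 1"
      unfolding pair_int_linear(2)[OF ia pair_integrable_const(1)[OF p p]] pair_integrable_const(2)[OF p p] by simp
    finally have "2 * second_moment ?\<nu> \<le> 1 + B" using JB[of "k + N"] by simp
    moreover have "0 \<le> second_moment ?\<nu>" by (rule Bochner_Integration.integral_nonneg) simp
    ultimately show ?thesis by linarith
  qed
  have "weakly_converges (\<lambda>k. \<nu> (k + N)) ?S"
  proof (rule weakly_converges_of_pair_diff[OF \<alpha> \<nu>(1,2) S(1,2), where K="max (1 + B) (r\<^sup>2)"])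
    show "(\<lambda>k. pair_diff (\<lambda>d. d powr \<alpha>) (\<nu> (k + N)) ?S) \<longlonglongrightarrow> 0"
      using LIMSEQ_ignore_initial_segment[OF Dlim] .
    show "second_moment (\<nu> (k + N)) \<le> max (1 + B) (r\<^sup>2)" for k
      using m2[of k] by simp
  qed (simp add: S(3))
  then show ?thesis using that[of r N] r by (simp add: \<nu>_def)
qed

theorem theorem3p3:
  fixes \<alpha> :: real
    and \<beta> :: "nat \<Rightarrow> real"
    and \<mu> :: "nat \<Rightarrow> (real ^ 'n) measure"
  assumes "CARD('n) \<ge> 2"
    and "\<alpha> \<in> {2<..<4}"
    and "\<And>m. \<beta> m \<in> {2<..<\<alpha>}"
    and "decseq \<beta>"
    and "\<beta> \<longlonglongrightarrow> 2"
    and "\<And>m. \<mu> m \<in> energy_minimizers \<alpha> (\<beta> m)"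
  shows "\<forall>s :: nat \<Rightarrow> nat. strict_mono s \<longrightarrow>
           (\<exists>t :: nat \<Rightarrow> nat. strict_mono t \<and>
             (\<exists>r \<ge> 0. weakly_converges (\<lambda>k. centred (\<mu> (s (t k)))) (spherical_shell r)))"
proof (intro allI impI)
  fix s :: "nat \<Rightarrow> nat" assume s: "strict_mono s"
  obtain r N where rN: "0 \<le> r" "weakly_converges (\<lambda>k. centred (\<mu> (s (k + N)))) (spherical_shell r)"
  proof (rule centred_minimizers_converge)
    show "2 \<le> DIM(real ^ 'n)" using assms(1) by simp
    show "2 < \<alpha>" "\<alpha> < 4" using assms(2) by auto
    show "2 < \<beta> (s k)" "\<beta> (s k) < \<alpha>" for k using assms(3)[of "s k"] by auto
    show "(\<lambda>k. \<beta> (s k)) \<longlonglongrightarrow> 2" using LIMSEQ_subseq_LIMSEQ[OF assms(5) s] by (simp add: comp_def)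
    show "\<mu> (s k) \<in> energy_minimizers \<alpha> (\<beta> (s k))" for k by (rule assms(6))
  qed
  show "\<exists>t :: nat \<Rightarrow> nat. strict_mono t \<and>
      (\<exists>r \<ge> 0. weakly_converges (\<lambda>k. centred (\<mu> (s (t k)))) (spherical_shell r))"
  proof (intro exI conjI)
    show "strict_mono (\<lambda>k. k + N)" by (simp add: strict_mono_def)
  qed (use rN in auto)
qed

end
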